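(* Let $n\ge 1$ be an integer and let $k$ be a positive divisor of $n$. Let $T_k$ denote a maximal torus of $\mathrm{SU}_n(\mathbb C)/C_k$ and let $W$ (the symmetric group $\mathfrak S_n$) denote the corresponding Weyl group. There is a homotopy equivalence \[ T_k/\!/W\;\simeq\;\coprod_\mu\ (S^1)^{b(\mu)-1}\times Y_\mu , \] where the disjoint union is over all partitions $\mu$ of $n$ and $Y_\mu$ is a discrete set of cardinality \[ \frac{g(\mu)}{a}\sum_{s=0}^{a-1}\gcd(a,s),\qquad a=\gcd\left(g(\mu),\frac{n}{g(\mu)},k,\frac nk\right). \] In particular, interchanging $\mathrm{SU}_n(\mathbb C)/C_k$ with its Langlands dual $\mathrm{SU}_n(\mathbb C)/C_{n/k}$ does not change the homotopy type of the extended quotient.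
   Context: $C_k$ denotes the group of $k$-th roots of unity in $\mathbb C$, identified (when $k$ divides $n$) with the subgroup $C_kI_n$ of the centre of $\mathrm{SU}_n(\mathbb C)$. $S^1$ is the unit circle. For a partition $\mu$ of $n$, $g(\mu)$ is the greatest common divisor of its parts and $b(\mu)$ is the number of distinct parts. Convention: $\gcd(a,0)=a$. Extended quotient: if a finite group $\Gamma$ acts on a topological space $X$ by homeomorphisms, set $\widetilde X=\{(\gamma,x)\in\Gamma\times X:\gamma x=x\}$, with $\Gamma$ acting by $\alpha(\gamma,x)=(\alpha\gamma\alpha^{-1},\alpha x)$; then $X/\!/\Gamma:=\widetilde X/\Gamma$. Equivalently $X/\!/\Gamma=\coprod_{\gamma} X^\gamma/Z(\gamma)$, with $\gamma$ running over representatives of the conjugacy classes of $\Gamma$ and $Z(\gamma)$ the centraliser of $\gamma$. One may take $T_k=T/C_k$, where $T$ is the group of diagonal matrices in $\mathrm{SU}_n(\mathbb C)$, with $W=\mathfrak S_n$ acting by permuting the diagonal entries. *)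

theory Defs
  imports "HOL-Analysis.Analysis" "HOL-Library.Multiset" "HOL-Algebra.Group_Action"
begin

text \<open>The quotient topology on the image of \<open>f\<close>, i.e. the identification topology in which
  points of \<open>X\<close> with the same value under \<open>f\<close> are glued.\<close>

definition quotient_space :: "'a topology \<Rightarrow> ('a \<Rightarrow> 'b) \<Rightarrow> 'b topology" where
  "quotient_space X f =
     topology (\<lambda>U. U \<subseteq> f ` topspace X \<and> openin X {x \<in> topspace X. f x \<in> U})"

lemma openin_quotient_space:
  "openin (quotient_space X f) U \<longleftrightarrow>
     U \<subseteq> f ` topspace X \<and> openin X {x \<in> topspace X. f x \<in> U}"
proof -
  have "istopology (\<lambda>U. U \<subseteq> f ` topspace X \<and> openin X {x \<in> topspace X. f x \<in> U})"
    unfolding istopology_def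
  proof (intro conjI allI impI)
    fix S T
    assume S: "S \<subseteq> f ` topspace X \<and> openin X {x \<in> topspace X. f x \<in> S}"
      and T: "T \<subseteq> f ` topspace X \<and> openin X {x \<in> topspace X. f x \<in> T}"
    show "S \<inter> T \<subseteq> f ` topspace X" using S by blast
    have "{x \<in> topspace X. f x \<in> S \<inter> T} =
        {x \<in> topspace X. f x \<in> S} \<inter> {x \<in> topspace X. f x \<in> T}" by blast
    then show "openin X {x \<in> topspace X. f x \<in> S \<inter> T}" using S T by auto
  next
    fix K
    assume K: "\<forall>S\<in>K. S \<subseteq> f ` topspace X \<and> openin X {x \<in> topspace X. f x \<in> S}"
    show "\<Union>K \<subseteq> f ` topspace X" using K by blast
    have "{x \<in> topspace X. f x \<in> \<Union>K} = (\<Union>S\<in>K. {x \<in> topspace X. f x \<in> S})" by blast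
    then show "openin X {x \<in> topspace X. f x \<in> \<Union>K}" using K by auto
  qed
  then show ?thesis
    by (simp add: quotient_space_def topology_inverse')
qed

lemma topspace_quotient_space [simp]: "topspace (quotient_space X f) = f ` topspace X"
proof
  show "topspace (quotient_space X f) \<subseteq> f ` topspace X"
    by (metis openin_quotient_space openin_topspace)
  have "{x \<in> topspace X. f x \<in> f ` topspace X} = topspace X" by blast
  then have "openin (quotient_space X f) (f ` topspace X)"
    by (simp add: openin_quotient_space)
  then show "f ` topspace X \<subseteq> topspace (quotient_space X f)"
    by (rule openin_subset)
qed

lemma quotient_map_quotient_space: "quotient_map X (quotient_space X f) f"
  by (auto simp: quotient_map_def openin_quotient_space)

definition inertia_space ::
  "('g, 'm) monoid_scheme \<Rightarrow> ('g \<Rightarrow> 'a \<Rightarrow> 'a) \<Rightarrow> 'a topology \<Rightarrow> ('g \<times> 'a) topology" where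
  "inertia_space G \<phi> X =
     subtopology (prod_topology (discrete_topology (carrier G)) X) {(\<gamma>, x). \<phi> \<gamma> x = x}"

definition inertia_action ::
  "('g, 'm) monoid_scheme \<Rightarrow> ('g \<Rightarrow> 'a \<Rightarrow> 'a) \<Rightarrow> 'g \<Rightarrow> 'g \<times> 'a \<Rightarrow> 'g \<times> 'a" where
  "inertia_action G \<phi> \<alpha> = (\<lambda>(\<gamma>, x). (\<alpha> \<otimes>\<^bsub>G\<^esub> \<gamma> \<otimes>\<^bsub>G\<^esub> inv\<^bsub>G\<^esub> \<alpha>, \<phi> \<alpha> x))"

definition extended_quotient ::
  "('g, 'm) monoid_scheme \<Rightarrow> ('g \<Rightarrow> 'a \<Rightarrow> 'a) \<Rightarrow> 'a topology \<Rightarrow> ('g \<times> 'a) set topology" where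
  "extended_quotient G \<phi> X =
     quotient_space (inertia_space G \<phi> X) (orbit G (inertia_action G \<phi>))"

text \<open>The size \<open>n\<close> of the matrices is the cardinality of the index type \<open>'n\<close>.\<close>

definition conj_transpose :: "complex^'n^'n \<Rightarrow> complex^'n^'n" where
  "conj_transpose A = (\<chi> i j. cnj (A $ j $ i))"

definition SU :: "(complex^'n^'n) monoid" where
  "SU = \<lparr>carrier = {A. A ** conj_transpose A = mat 1 \<and> conj_transpose A ** A = mat 1 \<and> det A = 1},
         mult = (**), one = mat 1\<rparr>"

definition torus :: "(complex^'n^'n) set" where
  "torus = {A \<in> carrier SU. \<forall>i j. i \<noteq> j \<longrightarrow> A $ i $ j = 0}"

text \<open>The scalar matrices with \<open>k\<close>-th root of unity on the diagonal; contained in \<open>SU\<close> when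
  \<open>k\<close> divides \<open>n\<close>.\<close>

definition center_roots :: "nat \<Rightarrow> (complex^'n^'n) set" where
  "center_roots k = {mat z | z. z ^ k = 1}"

definition torus_mod :: "nat \<Rightarrow> (complex^'n^'n) set topology" where
  "torus_mod k = quotient_space (top_of_set torus) (\<lambda>t. center_roots k #>\<^bsub>SU\<^esub> t)"

abbreviation Weyl :: "('n \<Rightarrow> 'n) monoid" where
  "Weyl \<equiv> BijGroup UNIV"

text \<open>The left action moving the \<open>i\<close>-th diagonal entry to position \<open>\<sigma> i\<close>, i.e. conjugation by the
  permutation matrix of \<open>\<sigma>\<close>.\<close>

definition permute_matrix :: "('n \<Rightarrow> 'n) \<Rightarrow> complex^'n^'n \<Rightarrow> complex^'n^'n" where
  "permute_matrix \<sigma> A = (\<chi> i j. A $ inv_into UNIV \<sigma> i $ inv_into UNIV \<sigma> j)"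

definition Weyl_action :: "('n \<Rightarrow> 'n) \<Rightarrow> (complex^'n^'n) set \<Rightarrow> (complex^'n^'n) set" where
  "Weyl_action \<sigma> S = permute_matrix \<sigma> ` S"

definition partitions :: "nat \<Rightarrow> nat multiset set" where
  "partitions n = {\<mu>. (\<forall>p \<in># \<mu>. p > 0) \<and> sum_mset \<mu> = n}"

definition parts_gcd :: "nat multiset \<Rightarrow> nat" where
  "parts_gcd \<mu> = Gcd (set_mset \<mu>)"

definition distinct_parts :: "nat multiset \<Rightarrow> nat" where
  "distinct_parts \<mu> = card (set_mset \<mu>)"

definition common_gcd :: "nat \<Rightarrow> nat \<Rightarrow> nat multiset \<Rightarrow> nat" where
  "common_gcd n k \<mu> = Gcd {parts_gcd \<mu>, n div parts_gcd \<mu>, k, n div k}"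

text \<open>All divisions in \<open>common_gcd\<close> and \<open>Y_card\<close> are exact when \<open>k\<close> divides \<open>n\<close> and
  \<open>\<mu>\<close> is a partition of \<open>n\<close>.\<close>

definition Y_card :: "nat \<Rightarrow> nat \<Rightarrow> nat multiset \<Rightarrow> nat" where
  "Y_card n k \<mu> =
     parts_gcd \<mu> div common_gcd n k \<mu> * (\<Sum>s<common_gcd n k \<mu>. gcd (common_gcd n k \<mu>) s)"

definition power_circle :: "nat \<Rightarrow> (nat \<Rightarrow> complex) topology" where
  "power_circle m = product_topology (\<lambda>_. top_of_set (sphere 0 1)) {..<m}"

end

theory Submission
  imports Defs "HOL-Computational_Algebra.Fundamental_Theorem_Algebra"
begin

text \<open>
  A point of the inertia space lifts to a triple \<open>(g, \<zeta>, t)\<close> with \<open>g\<close> a permutation, \<open>\<zeta>\<close> a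
  \<open>k\<close>-th root of unity of order \<open>d\<close> and \<open>t\<close> in the torus such that \<open>g t = \<zeta> t\<close>. On a cycle \<open>C\<close> of
  \<open>g\<close> the number \<open>u\<^sub>C = t\<^sub>i ^ d\<close> does not depend on \<open>i \<in> C\<close>, and the orbit of the triple under the
  centraliser is determined by \<open>\<zeta>\<close>, the cycle type \<open>\<mu>\<close> and, for every part \<open>m\<close>, the multiset of
  the \<open>u\<^sub>C\<close> with \<open>card C = m\<close>. This multiset is encoded by the coefficients of the monic polynomial
  \<open>P\<^sub>m\<close> with these roots; \<open>k\<close>-th roots of unity act by rotating all the \<open>u\<^sub>C\<close>, and \<open>det t = 1\<close> fixes a
  monomial in the products \<open>p\<^sub>m\<close> of the \<open>u\<^sub>C\<close>.

  Damping the middle coefficients of \<open>P\<^sub>m\<close> moves it to \<open>X ^ r \<plusminus> p\<^sub>m\<close> while all roots stay on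
  the unit circle. This deforms the extended quotient, compatibly with the rotations, to the quotients of the spaces
  \<open>{p. \<Prod>m. p\<^sub>m ^ (m / d) = \<epsilon>}\<close> by the cyclic groups of order \<open>k / d\<close>. Euclid's algorithm on the
  exponents shows that such a quotient is a finite disjoint union of tori, and counting the components over all
  \<open>\<zeta>\<close> gives the cardinality of \<open>Y\<close>, in which \<open>k\<close> and \<open>n / k\<close> enter symmetrically.
\<close>

section \<open>Roots of unity\<close>

text \<open>Coefficients are used instead of multisets of points because they make everything
  Hausdorff and continuous: the compact space of triples maps onto the coefficient space by a
  quotient map for free, and the deformation becomes multiplication of each coefficient by a real
  factor. A rotation also scales each coefficient, so the two commute. The constant coefficient
  carries \<open>p\<^sub>m\<close>, hence the determinant condition, and is never changed. After
  damping, the rotation by \<open>\<theta>\<close> acts on \<open>p\<^sub>m\<close> by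
  \<open>\<theta> ^ r\<close>, so the weights on the torus are the multiplicities of the parts.

  For fixed \<open>\<zeta>\<close> of order \<open>d\<close>, let \<open>g\<close> be the gcd of the
  parts and \<open>h = n / g\<close>. Euclid's algorithm preserves the gcd \<open>g / d\<close> of
  the exponents and the sum \<open>n / d\<close> of the exponents times the weights, so the number
  of components depends only on \<open>g\<close>, \<open>h\<close>, \<open>k\<close> and
  \<open>d\<close>. The symmetry between \<open>k\<close> and \<open>n / k\<close> appears after
  summation over \<open>\<zeta>\<close> and rests on the identity
  \<open>gcd g k * gcd k h = k * a\<close>.\<close>

definition root_ord :: "complex \<Rightarrow> nat" where
  "root_ord z = (LEAST d. d > 0 \<and> z ^ d = 1)"

text \<open>Outside the roots of unity \<open>root_ord\<close> is an unspecified
  \<open>LEAST\<close>; the witness \<open>m\<close>, here and in later lemmas, excludes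
  this.\<close>

lemma root_ord_pos:
  assumes "m > 0" "z ^ m = 1"
  shows "root_ord z > 0" "z ^ root_ord z = 1"
  using LeastI[of "\<lambda>d. d > 0 \<and> z ^ d = 1" m] assms by (auto simp: root_ord_def)

lemma power_eq_1_iff_root_ord_dvd:
  assumes "m > 0" "z ^ m = 1"
  shows "z ^ l = 1 \<longleftrightarrow> root_ord z dvd l"
proof
  note pos = root_ord_pos[OF assms]
  assume l: "z ^ l = 1"
  have "z ^ (l mod root_ord z) = z ^ (root_ord z * (l div root_ord z) + l mod root_ord z)"
    by (simp only: power_add power_mult pos power_one mult_1)
  then have "z ^ (l mod root_ord z) = 1" using l by simp
  moreover have "l mod root_ord z < root_ord z" using pos by simp
  moreover have "\<not> (l mod root_ord z > 0 \<and> z ^ (l mod root_ord z) = 1)"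
    if "l mod root_ord z < root_ord z"
    using not_less_Least[of "l mod root_ord z" "\<lambda>d. d > 0 \<and> z ^ d = 1"] that
    unfolding root_ord_def[symmetric] by blast
  ultimately have "l mod root_ord z = 0" by simp
  then show "root_ord z dvd l" by auto
next
  assume "root_ord z dvd l"
  then obtain j where "l = root_ord z * j" ..
  then show "z ^ l = 1" by (simp add: power_mult root_ord_pos(2)[OF assms])
qed

text \<open>The first \<open>root_ord z\<close> powers of \<open>z\<close> are distinct, and there
  are just as many candidates for \<open>w\<close>, so every candidate is hit. Later this aligns
  base points on cycles.\<close>

lemma ex_root_ord_power:
  assumes m: "m > 0" "z ^ m = 1" and w: "w ^ root_ord z = 1"
  obtains j where "w = z ^ j"
proof -
  let ?d = "root_ord z"
  note pos = root_ord_pos[OF m]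
  have z0: "z \<noteq> 0" using m by (auto simp: power_0_left)
  have inj: "inj_on (\<lambda>j. z ^ j) {..<?d}"
  proof (rule linorder_inj_onI')
    fix i j assume ij: "i \<in> {..<?d}" "j \<in> {..<?d}" "i < j"
    have "z ^ j = z ^ i * z ^ (j - i)" using ij by (simp flip: power_add)
    moreover have "z ^ (j - i) \<noteq> 1"
      using ij power_eq_1_iff_root_ord_dvd[OF m] by (auto dest: dvd_imp_le)
    ultimately show "z ^ i \<noteq> z ^ j" using z0 by auto
  qed
  have sub: "(\<lambda>j. z ^ j) ` {..<?d} \<subseteq> {u. u ^ ?d = 1}"
    by (auto simp: power_mult[symmetric] mult.commute[of _ ?d]) (simp add: power_mult pos)
  have "(\<lambda>j. z ^ j) ` {..<?d} = {u. u ^ ?d = 1}"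
    using pos by (intro card_subset_eq finite_roots_unity sub) (auto simp: card_image[OF inj] card_roots_unity_eq)
  then show ?thesis using w that by blast
qed

text \<open>Any root \<open>u\<close> of \<open>w\<close> with exponent \<open>gcd e r\<close>
  satisfies \<open>u ^ e = 1\<close>, so exponents of \<open>u\<close> only matter modulo
  \<open>e\<close>. A Bezout coefficient \<open>x\<close> makes \<open>r * x\<close> congruent to
  \<open>gcd e r\<close>, and \<open>u ^ x\<close> is the required root.\<close>

lemma ex_power_in_roots_unity:
  fixes w :: complex
  assumes e: "e > 0" and w: "w ^ (e div gcd e r) = 1"
  obtains v where "v ^ e = 1" "v ^ r = w"
proof (cases "r = 0")
  case True
  then show ?thesis using w e that[of 1] by (auto simp: power_0_left)
next
  case False
  let ?g = "gcd e r"
  have g: "?g > 0" using e by simp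
  obtain x y where xy: "r * x = e * y + gcd r e" using bezout_nat[OF False] by blast
  obtain u where u: "u ^ ?g = w" by (metis nth_root_exists[OF g, of w])
  have "u ^ e = w ^ (e div ?g)" by (simp flip: u power_mult)
  then have ue: "u ^ e = 1" using w by simp
  have "(u ^ x) ^ r = u ^ (r * x)" by (simp add: mult.commute flip: power_mult)
  also have "\<dots> = w" by (simp add: xy power_add power_mult ue u gcd.commute)
  finally have "(u ^ x) ^ r = w" .
  moreover have "(u ^ x) ^ e = 1" by (metis mult.commute power_mult power_one ue)
  ultimately show ?thesis using that by blast
qed

lemma sum_gcd_periodic:
  assumes "a dvd (G::nat)"
  shows "(\<Sum>s<G. gcd a s) = G div a * (\<Sum>s<a. gcd a s)"
proof (cases "a = 0")
  case False
  obtain m where m: "G = m * a" using assms by (metis dvd_def mult.commute)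
  have "(\<Sum>s<G. gcd a s) = (\<Sum>i<m. \<Sum>s=i*a..<i*a+a. gcd a s)"
    by (simp add: m sum.nat_group)
  also have "\<dots> = (\<Sum>i<m. \<Sum>s<a. gcd a s)"
  proof (rule sum.cong[OF refl])
    fix i
    have "(\<Sum>s=i*a..<i*a+a. gcd a s) = (\<Sum>s=0..<a. gcd a (s + i*a))"
      using sum.shift_bounds_nat_ivl[of "gcd a" 0 "i*a" a] by (simp add: add.commute)
    also have "\<dots> = (\<Sum>s<a. gcd a s)"
    proof -
      have "gcd a (s + i * a) = gcd a s" for s
        by (metis gcd_add_mult add.commute)
      then show ?thesis by (simp add: atLeast0LessThan)
    qed
    finally show "(\<Sum>s=i*a..<i*a+a. gcd a s) = (\<Sum>s<a. gcd a s)" .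
  qed
  finally show ?thesis using False by (simp add: m)
qed (use assms in auto)

lemma root_ord_cis:
  assumes "G > 0"
  shows "root_ord (cis (2 * pi * real s / real G)) = G div gcd s G"
proof -
  let ?z = "cis (2 * pi * real s / real G)"
  have *: "?z ^ l = 1 \<longleftrightarrow> G div gcd s G dvd l" for l
  proof -
    have "?z ^ l = cis (2 * pi * real (s * l) / real G)"
      by (subst Complex.DeMoivre) (simp add: mult_ac)
    also have "\<dots> = 1 \<longleftrightarrow> G dvd s * l"
    proof
      assume "G dvd s * l"
      then obtain j where "s * l = G * j" ..
      then show "cis (2 * pi * real (s * l) / real G) = 1"
        using assms cis_multiple_2pi[of "real j"] by (simp add: mult_ac)
    next
      assume "cis (2 * pi * real (s * l) / real G) = 1"
      then have "cos (2 * pi * real (s * l) / real G) = 1"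
        by (metis cis.simps(1) one_complex.simps(1))
      then obtain x :: int where "2 * pi * real (s * l) / real G = real_of_int x * 2 * pi"
        using cos_one_2pi_int by auto
      then have "real (s * l) = real_of_int x * real G" using assms by (simp add: field_simps)
      then have "int (s * l) = x * int G" by (metis of_int_eq_iff of_int_mult of_int_of_nat_eq)
      then have "int G dvd int (s * l)" by simp
      then show "G dvd s * l" by (simp only: int_dvd_int_iff)
    qed
    also have "\<dots> \<longleftrightarrow> G div gcd s G dvd l"
    proof -
      let ?g = "gcd s G"
      have g: "?g > 0" using assms by simp
      have "G dvd s * l \<longleftrightarrow> (G div ?g) * ?g dvd (s div ?g) * l * ?g"
        by (simp add: mult_ac)
      also have "\<dots> \<longleftrightarrow> G div ?g dvd (s div ?g) * l" using g by (subst dvd_times_right_cancel_iff) auto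
      also have "\<dots> \<longleftrightarrow> G div ?g dvd l"
        using div_gcd_coprime[of s G] assms by (simp add: coprime_commute coprime_dvd_mult_right_iff)
      finally show ?thesis .
    qed
    finally show ?thesis .
  qed
  have pos: "G div gcd s G > 0" using assms by (simp add: div_greater_zero_iff)
  have "?z ^ (G div gcd s G) = 1" by (simp only: * dvd_refl)
  note r = power_eq_1_iff_root_ord_dvd[OF pos this]
  show ?thesis
  proof (rule dvd_antisym)
    show "root_ord ?z dvd G div gcd s G" by (simp only: r[symmetric] * dvd_refl)
    show "G div gcd s G dvd root_ord ?z" by (subst *[symmetric], subst r, rule dvd_refl)
  qed
qed

text \<open>Multiplying out with \<open>g * h = k * l\<close> gives
  \<open>gcd g k * gcd k h = k * a\<close>. If \<open>\<zeta>\<close> has angle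
  \<open>2 pi s / gcd g k\<close>, its order is \<open>gcd g k div c\<close> with
  \<open>c = gcd s (gcd g k)\<close>, and the identity collapses the summand to
  \<open>g div gcd g k * gcd a s\<close>, which is periodic in \<open>s\<close> modulo
  \<open>a\<close>. Since \<open>a\<close> is symmetric in \<open>k\<close> and \<open>l\<close>,
  the sum is too.\<close>

lemma sum_component_count:
  fixes g h k :: nat
  assumes pos: "g > 0" "h > 0" "k > 0" and k: "k dvd g * h"
  defines "a \<equiv> Gcd {g, h, k, g * h div k}"
  shows "(\<Sum>z | z ^ gcd g k = 1. (g div root_ord z) div ((k div root_ord z) div gcd (k div root_ord z) h))
    = g div a * (\<Sum>s<a. gcd a s)"
proof -
  let ?G = "gcd g k" and ?H = "gcd k h"
  have G: "?G > 0" using pos by simp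
  obtain l where l: "g * h = k * l" using k ..
  have l': "g * h div k = l" using l pos by simp
  have a: "a = gcd g (gcd h (gcd k l))" by (simp add: a_def l')
  have GH: "?G * ?H = k * a"
  proof -
    have "?G * ?H = gcd (gcd (g * k) (g * h)) (gcd (k * k) (k * h))"
      by (simp add: gcd_mult_distrib_nat mult.commute gcd.assoc gcd.left_commute)
    also have "\<dots> = k * a"
      by (simp add: l a gcd_mult_distrib_nat mult.commute gcd.assoc gcd.left_commute gcd.commute)
    finally show ?thesis .
  qed
  have aG: "a dvd ?G" unfolding a by (meson gcd_dvd1 gcd_dvd2 dvd_trans gcd_greatest)
  have apos: "a > 0" using aG G by (metis dvd_0_left_iff gr0I less_irrefl)
  have "(\<Sum>z | z ^ ?G = 1. (g div root_ord z) div ((k div root_ord z) div gcd (k div root_ord z) h))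
     = (\<Sum>s<?G. (g div (?G div gcd s ?G)) div ((k div (?G div gcd s ?G)) div gcd (k div (?G div gcd s ?G)) h))"
    by (subst sum.reindex_bij_betw[OF Complex.bij_betw_roots_unity[OF G], symmetric])
       (simp add: root_ord_cis[OF G])
  also have "\<dots> = (\<Sum>s<?G. g div ?G * gcd a s)"
  proof (rule sum.cong[OF refl])
    fix s
    define c where "c = gcd s ?G"
    define d where "d = ?G div c"
    have "c dvd ?G" unfolding c_def by (rule gcd_dvd2)
    then have cd: "?G = c * d" unfolding d_def by (metis dvd_mult_div_cancel)
    have cdpos: "c > 0" "d > 0" using G cd by auto
    obtain g' where g': "g = ?G * g'" by (metis dvdE gcd_dvd1)
    obtain k' where k': "k = ?G * k'" by (metis dvdE gcd_dvd2)
    have k'pos: "k' > 0" using k' pos by (metis gr0I mult_0_right less_irrefl)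
    have kd: "k div d = c * k'" by (subst k') (use cd cdpos in simp)
    have gd: "g div d = c * g'" by (subst g') (use cd cdpos in simp)
    have "?G * ?H = ?G * (k' * a)" using GH k' by (metis mult.assoc)
    then have H: "?H = k' * a" using G by (metis nat_mult_eq_cancel1)
    \<comment> \<open>Since \<open>c * k'\<close> divides \<open>k\<close>, the known value
      \<open>k' * a\<close> of \<open>gcd k h\<close> can be brought in.\<close>
    have "gcd (c * k') h = gcd (gcd (c * k') k) h"
    proof -
      have "c * k' dvd k" by (metis k' cd dvd_triv_right mult.commute mult.left_commute)
      then show ?thesis by (simp add: gcd_nat.absorb1)
    qed
    also have "\<dots> = gcd (c * k') (k' * a)" by (simp add: H gcd.assoc)
    also have "\<dots> = k' * gcd c a" by (simp add: gcd_mult_distrib_nat mult.commute)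
    finally have gc: "gcd (k div d) h = k' * gcd c a" by (simp add: kd)
    have "gcd c a = gcd a s" using aG unfolding c_def
      by (metis gcd.assoc gcd.commute gcd_nat.absorb1)
    moreover obtain c' where c': "c = gcd c a * c'" by (metis dvdE gcd_dvd1)
    moreover have "gcd c a > 0" using cdpos by simp
    moreover have "c' > 0" using cdpos c' by (metis gr0I mult_0_right less_irrefl)
    ultimately have "(g div d) div ((k div d) div gcd (k div d) h) = g' * gcd a s"
    proof -
      have "(k div d) div gcd (k div d) h = c'"
      proof -
        have "c * k' = c' * (k' * gcd c a)" by (subst c') (simp only: mult_ac)
        moreover have "k' * gcd c a \<noteq> 0" using k'pos \<open>gcd c a > 0\<close> by simp
        ultimately show ?thesis unfolding gc unfolding kd by (metis nonzero_mult_div_cancel_right)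
      qed
      moreover have "c * g' = (g' * gcd c a) * c'" by (subst c') (simp only: mult_ac)
      moreover have "c * g' div c' = g' * gcd c a"
        using calculation(2) \<open>c' > 0\<close> by (simp only: nonzero_mult_div_cancel_right neq0_conv)
      ultimately show ?thesis using \<open>gcd c a = gcd a s\<close> by (simp only: gd)
    qed
    moreover have "g div ?G = g'" using g' G by (metis nonzero_mult_div_cancel_left less_irrefl)
    ultimately show "(g div (?G div gcd s ?G)) div ((k div (?G div gcd s ?G)) div gcd (k div (?G div gcd s ?G)) h)
      = g div ?G * gcd a s"
      unfolding d_def c_def by simp
  qed
  also have "\<dots> = g div ?G * (?G div a) * (\<Sum>s<a. gcd a s)"
    by (simp add: sum_gcd_periodic[OF aG] flip: sum_distrib_left)
  also have "g div ?G * (?G div a) = g div a"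
  proof -
    obtain x where x: "?G = a * x" using aG by (metis dvdE)
    obtain y where y: "g = ?G * y" by (metis dvdE gcd_dvd1)
    have "g div ?G = y" by (subst y) (use G in simp)
    moreover have "?G div a = x" by (subst x) (use apos in simp)
    moreover have "g div a = x * y"
      by (subst y, subst x) (use apos in \<open>simp add: mult.assoc\<close>)
    ultimately show ?thesis by simp
  qed
  finally show ?thesis .
qed

section \<open>Cyclic groups acting on tori\<close>

lemma continuous_map_field_mult [continuous_intros]:
  fixes f :: "'a \<Rightarrow> 'b::real_normed_field"
  shows "\<lbrakk>continuous_map X euclidean f; continuous_map X euclidean g\<rbrakk>
    \<Longrightarrow> continuous_map X euclidean (\<lambda>x. f x * g x)"
  by (simp add: continuous_map_atin tendsto_mult)

lemma continuous_map_field_power [continuous_intros]: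
  fixes f :: "'a \<Rightarrow> 'b::real_normed_field"
  shows "continuous_map X euclidean f \<Longrightarrow> continuous_map X euclidean (\<lambda>x. f x ^ n)"
  by (simp add: continuous_map_atin tendsto_power)

lemma continuous_map_field_prod [continuous_intros]:
  fixes f :: "'a \<Rightarrow> 'i \<Rightarrow> 'b::real_normed_field"
  shows "(\<And>i. i \<in> I \<Longrightarrow> continuous_map X euclidean (\<lambda>x. f x i))
    \<Longrightarrow> continuous_map X euclidean (\<lambda>x. \<Prod>i\<in>I. f x i)"
  by (simp add: continuous_map_atin tendsto_prod)

text \<open>A finite set in a metric space is discrete, so finitely many values make a continuous
  map locally constant. In this way \<open>\<zeta>\<close> and the index of a component become
  continuous labels.\<close>

lemma continuous_map_discrete_finite_range:
  assumes "continuous_map X euclidean (f :: 'a \<Rightarrow> 'b::metric_space)" "finite S" "f ` topspace X \<subseteq> S"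
  shows "continuous_map X (discrete_topology S) f"
proof -
  have "continuous_map X (top_of_set S) f"
    using assms by (auto simp: continuous_map_in_subtopology)
  moreover have "top_of_set S = discrete_topology S"
    using assms(2) by (intro subtopology_eq_discrete_topology_finite) (auto simp: t1_space_euclidean)
  ultimately show ?thesis by simp
qed

abbreviation circle :: "complex set" where "circle \<equiv> sphere 0 1"

abbreviation circle_power :: "'i set \<Rightarrow> ('i \<Rightarrow> complex) topology" where
  "circle_power I \<equiv> product_topology (\<lambda>_. top_of_set circle) I"

lemma norm_eq_1_if_norm_power:
  assumes "norm z ^ m = 1" "m > 0"
  shows "norm z = 1"
  using assms by (metis norm_ge_zero power_eq_imp_eq_base power_one zero_le_one)

lemma norm_eq_1_if_power:
  fixes z :: complex
  assumes "z ^ m = 1" "m > 0"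
  shows "norm z = 1"
  using assms by (metis norm_eq_1_if_norm_power norm_one norm_power)

lemma circle_power_root:
  assumes "w \<in> circle" "m > 0"
  obtains z where "z \<in> circle" "z ^ m = w"
proof -
  obtain z where z: "z ^ m = w" using nth_root_exists[OF assms(2)] by blast
  have "norm z ^ m = 1" using assms(1) z by (metis dist_0_norm mem_sphere norm_power)
  then have "norm z = 1" using assms(2) by (rule norm_eq_1_if_norm_power)
  then show ?thesis using z that by simp
qed

lemma continuous_map_circle_power_proj:
  "i \<in> I \<Longrightarrow> continuous_map (circle_power I) euclidean (\<lambda>p. p i)"
  using continuous_map_into_fulltopology[OF continuous_map_product_projection[of i I "\<lambda>_. top_of_set circle"]]
  by simp

definition mono_eval :: "'i set \<Rightarrow> ('i \<Rightarrow> nat) \<Rightarrow> ('i \<Rightarrow> complex) \<Rightarrow> complex" where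
  "mono_eval I c p = (\<Prod>i\<in>I. p i ^ c i)"

lemma continuous_map_mono_eval: "continuous_map (circle_power I) euclidean (mono_eval I c)"
  unfolding mono_eval_def
  by (intro continuous_intros continuous_map_circle_power_proj)

lemma mono_eval_circle: "(\<And>i. i \<in> I \<Longrightarrow> p i \<in> circle) \<Longrightarrow> mono_eval I c p \<in> circle"
  by (simp add: mono_eval_def prod_norm[symmetric] norm_power)

lemma mono_eval_insert:
  "finite I \<Longrightarrow> z \<notin> I \<Longrightarrow> mono_eval (insert z I) c p = p z ^ c z * mono_eval I c p"
  by (simp add: mono_eval_def)

lemma mono_eval_cong:
  "(\<And>i. i \<in> I \<Longrightarrow> c i = c' i) \<Longrightarrow> (\<And>i. i \<in> I \<Longrightarrow> p i = p' i) \<Longrightarrow> mono_eval I c p = mono_eval I c' p'"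
  by (simp add: mono_eval_def)

definition rotated :: "'i set \<Rightarrow> nat \<Rightarrow> ('i \<Rightarrow> nat) \<Rightarrow> ('i \<Rightarrow> complex) \<Rightarrow> ('i \<Rightarrow> complex) \<Rightarrow> bool" where
  "rotated I K r p p' \<longleftrightarrow> (\<exists>\<theta>. \<theta> ^ K = 1 \<and> (\<forall>i\<in>I. p' i = \<theta> ^ r i * p i))"

text \<open>The monomials with exponents \<open>e j\<close>, \<open>j \<in> I\<close>, separate the orbits. The number \<open>d\<close> is the
  order of the stabiliser, and \<open>x\<close> are Bezout coefficients expressing \<open>d\<close> by the weights.\<close>

definition orbit_monomials ::
  "'i set \<Rightarrow> nat \<Rightarrow> ('i \<Rightarrow> nat) \<Rightarrow> ('i \<Rightarrow> 'i \<Rightarrow> nat) \<Rightarrow> nat \<Rightarrow> ('i \<Rightarrow> nat) \<Rightarrow> bool" where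
  "orbit_monomials I K r e d x \<longleftrightarrow>
     d dvd K \<and> (\<forall>i\<in>I. d dvd r i) \<and> (\<forall>\<theta>::complex. \<theta> ^ K = 1 \<longrightarrow> \<theta> ^ (\<Sum>i\<in>I. x i * r i) = \<theta> ^ d) \<and>
     (\<forall>p p'. (\<forall>i\<in>I. p i \<in> circle \<and> p' i \<in> circle) \<longrightarrow>
       (rotated I K r p p' \<longleftrightarrow> (\<forall>j\<in>I. mono_eval I (e j) p' = mono_eval I (e j) p)))"

text \<open>Without coordinates the stabiliser is the whole group, hence \<open>d = K\<close>; the
  empty Bezout sum fits because \<open>\<theta> ^ 0 = \<theta> ^ K\<close>.\<close>

lemma orbit_monomials_empty: "orbit_monomials {} K r e K x"
  by (auto simp: orbit_monomials_def rotated_def intro: exI[of _ 1])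

lemma mono_eval_rotated:
  assumes "\<And>i. i \<in> I \<Longrightarrow> p' i = \<theta> ^ r i * p i"
  shows "mono_eval I c p' = \<theta> ^ (\<Sum>i\<in>I. c i * r i) * mono_eval I c p"
proof -
  have "mono_eval I c p' = (\<Prod>i\<in>I. \<theta> ^ (c i * r i) * p i ^ c i)"
    unfolding mono_eval_def using assms
    by (intro prod.cong) (auto simp: power_mult_distrib mult.commute simp flip: power_mult)
  then show ?thesis by (simp add: prod.distrib mono_eval_def power_sum)
qed

text \<open>Once the coordinates in \<open>I\<close> agree up to \<open>\<theta>\<close>, the
  freedom left is the stabiliser of order \<open>d\<close>, which acts on the coordinate
  \<open>z\<close> through the roots of unity of order dividing \<open>d div gcd d (r z)\<close>. So
  only that power of \<open>p z\<close> matters, and \<open>\<theta>\<close> changes it by a power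
  of \<open>\<theta> ^ d\<close>. A monomial in the old coordinates cancels this change, because
  \<open>x\<close> produces \<open>\<theta> ^ d\<close>. The factor \<open>K - 1\<close> plays the
  role of \<open>- 1\<close> modulo \<open>K\<close> and keeps the exponents natural.\<close>

lemma orbit_monomials_insert:
  fixes r :: "'i \<Rightarrow> nat"
  assumes om: "orbit_monomials I K r e d x" and I: "finite I" "z \<notin> I" and K: "K > 0"
  defines "rw \<equiv> (\<lambda>i. (K - 1) * x i * (r z div gcd d (r z)))(z := d div gcd d (r z))"
  shows "\<exists>x'. orbit_monomials (insert z I) K r ((\<lambda>j. (e j)(z := 0))(z := rw)) (gcd d (r z)) x'"
proof -
  let ?\<rho> = "r z" and ?g = "gcd d (r z)" and ?e = "(\<lambda>j. (e j)(z := 0))(z := rw)"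
  have dK: "d dvd K" and dr: "\<And>i. i \<in> I \<Longrightarrow> d dvd r i"
    and x: "\<And>\<theta>::complex. \<theta> ^ K = 1 \<Longrightarrow> \<theta> ^ (\<Sum>i\<in>I. x i * r i) = \<theta> ^ d"
    and sep: "\<And>p p'. (\<forall>i\<in>I. p i \<in> circle \<and> p' i \<in> circle) \<Longrightarrow>
       rotated I K r p p' \<longleftrightarrow> (\<forall>j\<in>I. mono_eval I (e j) p' = mono_eval I (e j) p)"
    using om unfolding orbit_monomials_def by blast+
  have d: "d > 0" using dK K by (metis dvd_0_left_iff gr0I less_irrefl)
  obtain a b where ab: "d * a = ?\<rho> * b + ?g" using bezout_nat d by blast
  \<comment> \<open>By Bezout the new order is \<open>d * a - r z * b\<close>; the negative
    coefficient is again written with \<open>K - 1\<close>.\<close>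
  define x' where "x' = (\<lambda>i. a * x i)(z := b * (K - 1))"
  have x': "\<theta> ^ (\<Sum>i\<in>insert z I. x' i * r i) = \<theta> ^ ?g" if \<theta>: "\<theta> ^ K = 1" for \<theta> :: complex
  proof -
    have "(\<Sum>i\<in>I. x' i * r i) = (\<Sum>i\<in>I. x i * r i) * a"
      using I unfolding sum_distrib_right by (intro sum.cong) (auto simp: x'_def)
    then have "\<theta> ^ (\<Sum>i\<in>insert z I. x' i * r i) = \<theta> ^ (b * (K - 1) * ?\<rho> + (\<Sum>i\<in>I. x i * r i) * a)"
      using I by (simp add: x'_def)
    also have "\<dots> = \<theta> ^ (b * (K - 1) * ?\<rho>) * \<theta> ^ (d * a)"
      using x[OF \<theta>] by (simp add: power_add power_mult)
    also have "\<dots> = \<theta> ^ (b * (K - 1) * ?\<rho> + (?\<rho> * b + ?g))" by (simp only: power_add ab)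
    also have "b * (K - 1) * ?\<rho> + (?\<rho> * b + ?g) = K * (b * ?\<rho>) + ?g"
      using K by (cases K) (simp_all add: algebra_simps)
    also have "\<theta> ^ \<dots> = \<theta> ^ ?g" by (simp add: power_add power_mult \<theta>)
    finally show ?thesis .
  qed
  let ?ev = "mono_eval (insert z I)"
  have sep': "rotated (insert z I) K r p p' \<longleftrightarrow>
      (\<forall>j\<in>insert z I. ?ev (?e j) p' = ?ev (?e j) p)"
    if circ: "\<forall>i\<in>insert z I. p i \<in> circle \<and> p' i \<in> circle" for p p'
  proof -
    have old: "?ev (?e j) q = mono_eval I (e j) q" if "j \<in> I" for j q
      using I that by (auto simp: mono_eval_insert intro!: mono_eval_cong)
    have new: "?ev (?e z) q = q z ^ (d div ?g) * mono_eval I rw q" for q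
      using I by (simp add: mono_eval_insert rw_def)
    have nz: "mono_eval I c q \<noteq> 0" if "\<forall>i\<in>I. q i \<in> circle" for c q
      using mono_eval_circle[of I q c] that by (metis dist_self mem_sphere zero_neq_one)
    have key: "?ev (?e z) p' = ?ev (?e z) p \<longleftrightarrow>
        p' z ^ (d div ?g) = (\<theta> ^ ?\<rho> * p z) ^ (d div ?g)"
      if \<theta>: "\<theta> ^ K = 1" and rot: "\<And>i. i \<in> I \<Longrightarrow> p' i = \<theta> ^ r i * p i" for \<theta>
    proof -
      let ?R = "?\<rho> div ?g"
      have "(\<Sum>i\<in>I. rw i * r i) = (\<Sum>i\<in>I. x i * r i) * ((K - 1) * ?R)"
        using I unfolding sum_distrib_right by (intro sum.cong) (auto simp: rw_def)
      then have "mono_eval I rw p' = (\<theta> ^ d) ^ ((K - 1) * ?R) * mono_eval I rw p"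
        using mono_eval_rotated[OF rot, where c = rw] x[OF \<theta>] by (simp add: power_mult)
      moreover have "(\<theta> ^ d) ^ ((K - 1) * ?R) * (\<theta> ^ d) ^ ?R = 1"
      proof -
        have "d * ((K - 1) * ?R) + d * ?R = K * (d * ?R)" using K by (cases K) (simp_all add: algebra_simps)
        then have "(\<theta> ^ d) ^ ((K - 1) * ?R) * (\<theta> ^ d) ^ ?R = \<theta> ^ (K * (d * ?R))"
          by (simp flip: power_mult power_add)
        then show ?thesis by (simp add: power_mult \<theta>)
      qed
      moreover have "(\<theta> ^ d) ^ ?R = (\<theta> ^ ?\<rho>) ^ (d div ?g)"
      proof -
        have "d * ?R = ?\<rho> * (d div ?g)" by (simp add: div_mult_swap dvd_div_mult mult.commute)
        then show ?thesis by (simp flip: power_mult)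
      qed
      moreover have "mono_eval I rw p \<noteq> 0" using nz circ by blast
      ultimately have *: "mono_eval I rw p' * (\<theta> ^ ?\<rho>) ^ (d div ?g) = mono_eval I rw p"
        "(\<theta> ^ ?\<rho>) ^ (d div ?g) \<noteq> 0" "mono_eval I rw p' \<noteq> 0"
        using \<theta> K by (auto simp: mult_ac power_0_left)
      show ?thesis
      proof -
        have "p z ^ (d div ?g) * mono_eval I rw p = (\<theta> ^ ?\<rho> * p z) ^ (d div ?g) * mono_eval I rw p'"
          by (subst *(1)[symmetric]) (simp add: power_mult_distrib mult_ac)
        then show ?thesis unfolding new using *(3) by (metis mult_right_cancel)
      qed
    qed
    show ?thesis
    proof
      assume "rotated (insert z I) K r p p'"
      then obtain \<theta> where \<theta>: "\<theta> ^ K = 1" "\<And>i. i \<in> insert z I \<Longrightarrow> p' i = \<theta> ^ r i * p i"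
        by (auto simp: rotated_def)
      then have "rotated I K r p p'" by (auto simp: rotated_def)
      then have "\<forall>j\<in>I. mono_eval I (e j) p' = mono_eval I (e j) p" using sep circ by blast
      moreover have "?ev (?e z) p' = ?ev (?e z) p"
        using key[OF \<theta>(1)] \<theta>(2) by simp
      ultimately show "\<forall>j\<in>insert z I. ?ev (?e j) p' = ?ev (?e j) p"
        using old by (metis insertE)
    next
      assume eq: "\<forall>j\<in>insert z I. ?ev (?e j) p' = ?ev (?e j) p"
      then have "\<forall>j\<in>I. mono_eval I (e j) p' = mono_eval I (e j) p" using old by (metis insertI2)
      then have "rotated I K r p p'" using sep circ by blast
      then obtain \<theta> where \<theta>: "\<theta> ^ K = 1" "\<And>i. i \<in> I \<Longrightarrow> p' i = \<theta> ^ r i * p i"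
        by (auto simp: rotated_def)
      define w where "w = p' z / (\<theta> ^ ?\<rho> * p z)"
      have nz0: "\<theta> ^ ?\<rho> * p z \<noteq> 0" using \<theta>(1) K circ by (auto simp: power_0_left)
      have "p' z ^ (d div ?g) = (\<theta> ^ ?\<rho> * p z) ^ (d div ?g)" using key[OF \<theta>] eq by blast
      then have "w ^ (d div ?g) = 1" unfolding w_def using nz0 by (simp add: power_divide)
      then obtain v where v: "v ^ d = 1" "v ^ ?\<rho> = w" using ex_power_in_roots_unity[OF d] by blast
      have one: "v ^ l = 1" if "d dvd l" for l using v(1) that by (metis dvdE power_mult power_one)
      have "(\<theta> * v) ^ K = 1" by (simp add: power_mult_distrib \<theta>(1) one[OF dK])
      moreover have "p' i = (\<theta> * v) ^ r i * p i" if "i \<in> insert z I" for i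
      proof (cases "i = z")
        case True
        have "p' z = w * (\<theta> ^ ?\<rho> * p z)" using w_def nonzero_divide_eq_eq[OF nz0] by metis
        then show ?thesis using True by (simp add: power_mult_distrib v)
      next
        case False
        then show ?thesis using that \<theta>(2) one[OF dr] by (simp add: power_mult_distrib)
      qed
      ultimately show "rotated (insert z I) K r p p'" unfolding rotated_def by blast
    qed
  qed
  have "?g dvd K" using dK by (metis dvd_trans gcd_dvd1)
  moreover have "\<forall>i\<in>insert z I. ?g dvd r i" using dr by (auto intro: dvd_trans[OF gcd_dvd1])
  ultimately show ?thesis
    unfolding orbit_monomials_def using x' sep' by blast
qed

text \<open>The coordinate \<open>i0\<close> is inserted first, so its monomial is a pure power.
  Every later monomial contains its own coordinate to a positive power and otherwise only earlier
  ones. This triangular shape lets arbitrary values on the circle be attained by extracting one root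
  after another, with \<open>p i0\<close> prescribed.\<close>

lemma ex_orbit_monomials:
  fixes r :: "'i \<Rightarrow> nat"
  assumes "finite J" "i0 \<notin> J" "K > 0"
  shows "\<exists>e d x. orbit_monomials (insert i0 J) K r e d x \<and>
    (\<forall>p. mono_eval (insert i0 J) (e i0) p = p i0 ^ (K div gcd K (r i0))) \<and>
    (\<forall>y\<in>circle. \<forall>v. (\<forall>j\<in>J. v j \<in> circle) \<longrightarrow>
       (\<exists>p. p i0 = y \<and> (\<forall>j\<in>J. p j \<in> circle \<and> mono_eval (insert i0 J) (e j) p = v j)))"
  using assms(1,2)
proof (induction J)
  case empty
  \<comment> \<open>Here \<open>0\<close> and \<open>undefined\<close> stand for the coefficients
    and exponents of the empty index set; on \<open>{i0}\<close> only the exponent at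
    \<open>i0\<close> is evaluated.\<close>
  define c where "c = (\<lambda>i. (K - 1) * 0 * (r i0 div gcd K (r i0)))(i0 := K div gcd K (r i0))"
  define e where "e = (\<lambda>j. (undefined j)(i0 := 0))(i0 := c)"
  have "\<exists>x'. orbit_monomials {i0} K r e (gcd K (r i0)) x'"
    unfolding e_def c_def by (rule orbit_monomials_insert[OF orbit_monomials_empty finite.emptyI _ assms(3)]) simp
  moreover have "mono_eval {i0} (e i0) p = p i0 ^ (K div gcd K (r i0))" for p
    by (simp add: mono_eval_def e_def c_def)
  moreover have "\<exists>p. p i0 = y \<and> (\<forall>j\<in>{}. p j \<in> circle \<and> mono_eval {i0} (e j) p = v j)" for y v
    by (intro exI[of _ "\<lambda>_. y"]) simp
  ultimately show ?case by blast
next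
  case (insert z J)
  then obtain e d x where om: "orbit_monomials (insert i0 J) K r e d x"
    and e0: "\<And>p. mono_eval (insert i0 J) (e i0) p = p i0 ^ (K div gcd K (r i0))"
    and surj: "\<And>y v. y \<in> circle \<Longrightarrow> (\<forall>j\<in>J. v j \<in> circle) \<Longrightarrow>
       (\<exists>p. p i0 = y \<and> (\<forall>j\<in>J. p j \<in> circle \<and> mono_eval (insert i0 J) (e j) p = v j))"
    by blast
  let ?I = "insert i0 J" and ?g = "gcd d (r z)"
  have I: "finite ?I" "z \<notin> ?I" using insert by auto
  define rw where "rw = (\<lambda>i. (K - 1) * x i * (r z div ?g))(z := d div ?g)"
  define e' where "e' = (\<lambda>j. (e j)(z := 0))(z := rw)"
  have om': "\<exists>x'. orbit_monomials (insert z ?I) K r e' ?g x'"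
    unfolding e'_def rw_def by (rule orbit_monomials_insert[OF om I assms(3)])
  let ?ev = "mono_eval (insert z ?I)"
  have old: "?ev (e' j) q = mono_eval ?I (e j) q" if "j \<in> ?I" for j q
    using I that unfolding e'_def by (subst mono_eval_insert) (auto intro!: mono_eval_cong)
  have new: "?ev (e' z) q = q z ^ (d div ?g) * mono_eval ?I rw q" for q
    using I unfolding e'_def by (subst mono_eval_insert) (auto simp: rw_def)
  have d: "d > 0" using om assms(3) unfolding orbit_monomials_def by (metis dvd_0_left_iff gr0I less_irrefl)
  have dg: "d div ?g > 0" using d by (simp add: div_greater_zero_iff)
  have ins: "insert i0 (insert z J) = insert z ?I" by blast
  have "\<exists>p. p i0 = y \<and> (\<forall>j\<in>insert z J. p j \<in> circle \<and> ?ev (e' j) p = v j)"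
    if y: "y \<in> circle" and v: "\<forall>j\<in>insert z J. v j \<in> circle" for y v
  proof -
    obtain p where p: "p i0 = y" "\<And>j. j \<in> J \<Longrightarrow> p j \<in> circle" "\<And>j. j \<in> J \<Longrightarrow> mono_eval ?I (e j) p = v j"
      using surj[OF y] v by (metis insertI2)
    have M: "mono_eval ?I rw p \<in> circle" using p y by (intro mono_eval_circle) auto
    then have "v z / mono_eval ?I rw p \<in> circle" using v by (simp add: norm_divide)
    then obtain u where u: "u \<in> circle" "u ^ (d div ?g) = v z / mono_eval ?I rw p"
      using circle_power_root dg by blast
    define p' where "p' = p(z := u)"
    have same: "mono_eval ?I c p' = mono_eval ?I c p" for c
      using I by (intro mono_eval_cong) (auto simp: p'_def)
    have "mono_eval ?I rw p \<noteq> 0" using M by auto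
    then have "?ev (e' z) p' = v z"
      unfolding new same using u(2) by (simp add: p'_def)
    moreover have "?ev (e' j) p' = v j" if "j \<in> J" for j
      using old[of j p'] that p(3)[OF that] by (simp add: same)
    ultimately show ?thesis
      using p u I by (intro exI[of _ p']) (auto simp: p'_def)
  qed
  moreover have "?ev (e' i0) p = p i0 ^ (K div gcd K (r i0))" for p
    using old[of i0] e0 by simp
  ultimately show ?case unfolding ins using om' by blast
qed

text \<open>The last two clauses say that \<open>F\<close> induces a bijection from the orbit space
  onto \<open>N\<close> copies of a torus of dimension one less. Compactness later turns such data
  into a quotient map.\<close>

definition torus_orbit_map ::
  "'i set \<Rightarrow> ('i \<Rightarrow> nat) \<Rightarrow> ('i \<Rightarrow> nat) \<Rightarrow> nat \<Rightarrow> complex \<Rightarrow> nat \<Rightarrow> (('i \<Rightarrow> complex) \<Rightarrow> (nat \<Rightarrow> complex) \<times> nat) \<Rightarrow> bool" where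
  "torus_orbit_map I a r K \<epsilon> N F \<longleftrightarrow>
    (let S = {p \<in> topspace (circle_power I). mono_eval I a p = \<epsilon>};
         Y = prod_topology (power_circle (card I - 1)) (discrete_topology {..<N}) in
     continuous_map (subtopology (circle_power I) S) Y F \<and> F ` S = topspace Y \<and>
     (\<forall>p\<in>S. \<forall>p'\<in>S. F p = F p' \<longleftrightarrow> rotated I K r p p'))"

text \<open>The constraint reads \<open>p i0 ^ a i0 = \<epsilon>\<close>, and
  \<open>p i0 ^ K'\<close> with \<open>K' = K div gcd K (r i0)\<close> is constant on orbits. Since
  \<open>K\<close> divides \<open>a i0 * r i0\<close> and \<open>K'\<close> is coprime to the
  reduced weight, \<open>K'\<close> divides \<open>a i0\<close>. The invariant is therefore one of
  the \<open>N = a i0 div K'\<close> roots of \<open>\<epsilon>\<close> and numbers the components;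
  the remaining monomials are free torus coordinates.\<close>

lemma torus_orbit_map_single:
  fixes r :: "'i \<Rightarrow> nat"
  assumes I: "finite I" "i0 \<in> I" and a: "a i0 > 0" "\<And>i. i \<in> I \<Longrightarrow> i \<noteq> i0 \<Longrightarrow> a i = 0"
    and K: "K > 0" "K dvd a i0 * r i0" and eps: "\<epsilon> \<in> circle"
  shows "\<exists>F. torus_orbit_map I a r K \<epsilon> (a i0 div (K div gcd K (r i0))) F"
proof -
  define J where "J = I - {i0}"
  have J: "finite J" "i0 \<notin> J" "I = insert i0 J" using I by (auto simp: J_def)
  define K' where "K' = K div gcd K (r i0)"
  define N where "N = a i0 div K'"
  have K': "K' > 0" using K(1) by (simp add: K'_def div_greater_zero_iff)
  have "K' * gcd K (r i0) = K" "a i0 * (r i0 div gcd K (r i0)) * gcd K (r i0) = a i0 * r i0"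
    unfolding K'_def by (simp_all only: dvd_div_mult_self gcd_dvd1 gcd_dvd2 mult.assoc)
  then have "K' * gcd K (r i0) dvd a i0 * (r i0 div gcd K (r i0)) * gcd K (r i0)"
    using K(2) by (simp only:)
  moreover have "gcd K (r i0) \<noteq> 0" using K(1) by simp
  ultimately have "K' dvd a i0 * (r i0 div gcd K (r i0))"
    using dvd_times_right_cancel_iff[of "gcd K (r i0)" K'] by blast
  moreover have "coprime K' (r i0 div gcd K (r i0))"
    unfolding K'_def using K(1) by (intro div_gcd_coprime) simp
  ultimately have "K' dvd a i0" by (simp add: coprime_dvd_mult_left_iff)
  then have KN: "a i0 = K' * N" by (simp add: N_def)
  then have N: "N > 0" using a(1) by (auto intro: gr0I)
  have "\<exists>e d x. orbit_monomials I K r e d x \<and> (\<forall>p. mono_eval I (e i0) p = p i0 ^ K') \<and>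
    (\<forall>y\<in>circle. \<forall>v. (\<forall>j\<in>J. v j \<in> circle) \<longrightarrow>
       (\<exists>p. p i0 = y \<and> (\<forall>j\<in>J. p j \<in> circle \<and> mono_eval I (e j) p = v j)))"
    using ex_orbit_monomials[OF J(1,2) K(1), of r] unfolding J(3)[symmetric] K'_def[symmetric] .
  then obtain e d x where om: "orbit_monomials I K r e d x"
    and e0: "\<And>p. mono_eval I (e i0) p = p i0 ^ K'"
    and surj: "\<And>y v. y \<in> circle \<Longrightarrow> \<forall>j\<in>J. v j \<in> circle \<Longrightarrow>
       \<exists>p. p i0 = y \<and> (\<forall>j\<in>J. p j \<in> circle \<and> mono_eval I (e j) p = v j)"
    by (elim exE conjE) (rule that, assumption, erule spec, blast)
  have "\<epsilon> \<noteq> 0" using eps by auto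
  then have cardw: "card {w. w ^ N = \<epsilon>} = N" "finite {w. w ^ N = \<epsilon>}"
    using N by (auto simp: card_nth_roots finite_nth_roots)
  then obtain idx where idx: "bij_betw idx {w. w ^ N = \<epsilon>} {..<N}"
    using finite_same_card_bij[of "{w. w ^ N = \<epsilon>}" "{..<N}"] by auto
  have cardJ: "card J = card I - 1" using J by simp
  let ?B = "{..<card I - 1}"
  obtain \<beta> where \<beta>: "bij_betw \<beta> ?B J"
    using finite_same_card_bij[of "?B" J] J(1) cardJ by (metis card_lessThan finite_lessThan)
  let ?Y = "prod_topology (power_circle (card I - 1)) (discrete_topology {..<N})"
  define F where "F = (\<lambda>p. (\<lambda>j\<in>?B. mono_eval I (e (\<beta> j)) p, idx (p i0 ^ K')))"
  define S where "S = {p \<in> topspace (circle_power I). mono_eval I a p = \<epsilon>}"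
  have Spt: "p i \<in> circle" if "p \<in> S" "i \<in> I" for p i using that by (auto simp: S_def PiE_iff)
  have evala: "mono_eval I a p = (p i0 ^ K') ^ N" for p
  proof -
    have "mono_eval J a p = 1" using a(2) by (auto simp: mono_eval_def J_def intro!: prod.neutral)
    then show ?thesis by (subst J(3)) (simp add: mono_eval_insert J KN power_mult)
  qed
  have Sidx: "p i0 ^ K' \<in> {w. w ^ N = \<epsilon>}" if "p \<in> S" for p
    using that evala by (simp add: S_def)
  let ?X = "subtopology (circle_power I) S"
  have cont: "continuous_map ?X euclidean (mono_eval I c)" for c
    by (intro continuous_map_from_subtopology continuous_map_mono_eval)
  have "continuous_map ?X (power_circle (card I - 1))
      (\<lambda>p. \<lambda>j\<in>?B. mono_eval I (e (\<beta> j)) p)"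
    unfolding power_circle_def continuous_map_componentwise
    using cont Spt by (auto simp: continuous_map_in_subtopology intro!: mono_eval_circle[simplified])
  moreover have "continuous_map ?X (discrete_topology {..<N}) (\<lambda>p. idx (p i0 ^ K'))"
  proof -
    have "continuous_map ?X (discrete_topology {w. w ^ N = \<epsilon>}) (\<lambda>p. p i0 ^ K')"
    proof (rule continuous_map_discrete_finite_range)
      have "mono_eval I (e i0) = (\<lambda>p. p i0 ^ K')" by (rule ext) (rule e0)
      then show "continuous_map ?X euclidean (\<lambda>p. p i0 ^ K')"
        using cont[of "e i0"] by simp
    qed (use Sidx cardw in auto)
    moreover have "continuous_map (discrete_topology {w. w ^ N = \<epsilon>}) (discrete_topology {..<N}) idx"
      using idx by (auto simp: bij_betw_def)
    ultimately show ?thesis by (rule continuous_map_compose[unfolded o_def])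
  qed
  ultimately have Fc: "continuous_map ?X
      ?Y F"
    unfolding F_def by (simp add: continuous_map_pairwise o_def)
  have Fs: "v \<in> F ` S" if v: "v \<in> topspace ?Y" for v
  proof -
    obtain u s where us: "v = (u, s)" "u \<in> ?B \<rightarrow>\<^sub>E circle" "s < N"
      using v by (auto simp: power_circle_def)
    have "s \<in> idx ` {w. w ^ N = \<epsilon>}" using bij_betw_imp_surj_on[OF idx] us(3) by simp
    then obtain w where w: "w ^ N = \<epsilon>" "idx w = s" by blast
    have "norm w ^ N = 1" using w(1) eps by (metis dist_0_norm mem_sphere norm_power)
    then have "norm w = 1" using N by (rule norm_eq_1_if_norm_power)
    then have "w \<in> circle" by simp
    then obtain y where y: "y \<in> circle" "y ^ K' = w" using circle_power_root K' by blast
    let ?inv = "inv_into ?B \<beta>"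
    have "\<forall>j\<in>J. u (?inv j) \<in> circle"
      using us(2) bij_betw_inv_into[OF \<beta>] by (auto simp: bij_betw_def PiE_iff)
    from surj[OF y(1) this] obtain p where p: "p i0 = y"
      "\<And>j. j \<in> J \<Longrightarrow> p j \<in> circle" "\<And>j. j \<in> J \<Longrightarrow> mono_eval I (e j) p = u (?inv j)"
      by blast
    define q where "q = restrict p I"
    have same: "mono_eval I c q = mono_eval I c p" for c by (simp add: q_def mono_eval_def)
    have qi: "q i0 = y" using p I by (simp add: q_def)
    have "p j \<in> circle" if "j \<in> I" for j
      using that p(1,2) y(1) by (cases "j = i0") (auto simp: J_def)
    then have "q \<in> topspace (circle_power I)" by (auto simp: q_def)
    moreover have "mono_eval I a q = \<epsilon>" using evala[of q] by (simp add: qi y w)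
    ultimately have "q \<in> S" by (simp add: S_def)
    moreover have "F q = v"
    proof -
      have "(\<lambda>j\<in>?B. mono_eval I (e (\<beta> j)) q) = u"
      proof (rule PiE_ext[OF _ us(2)])
        have "\<beta> j \<in> J" if "j < card I - 1" for j using \<beta> that by (auto simp: bij_betw_def)
        then show "(\<lambda>j\<in>?B. mono_eval I (e (\<beta> j)) q) \<in> ?B \<rightarrow>\<^sub>E circle"
          using \<open>q \<in> S\<close> Spt by (intro restrict_PiE_iff[THEN iffD2] ballI mono_eval_circle) auto
        fix j assume j: "j \<in> ?B"
        then have "\<beta> j \<in> J" using \<beta> by (auto simp: bij_betw_def)
        then show "(\<lambda>j\<in>?B. mono_eval I (e (\<beta> j)) q) j = u j"
          using j p(3)[of "\<beta> j"] \<beta> by (simp add: same bij_betw_def)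
      qed
      then show ?thesis by (simp add: F_def qi y w us(1))
    qed
    ultimately show ?thesis by blast
  qed
  have "F ` S = topspace ?Y"
  proof (intro equalityI subsetI)
    fix v assume "v \<in> F ` S"
    then show "v \<in> topspace ?Y"
      using continuous_map_image_subset_topspace[OF Fc] by (auto simp: S_def)
  qed (rule Fs)
  moreover have "F p = F p' \<longleftrightarrow> rotated I K r p p'" if p: "p \<in> S" "p' \<in> S" for p p'
  proof -
    have "rotated I K r p p' \<longleftrightarrow> (\<forall>j\<in>I. mono_eval I (e j) p' = mono_eval I (e j) p)"
      using om Spt p unfolding orbit_monomials_def by blast
    also have "\<dots> \<longleftrightarrow> p' i0 ^ K' = p i0 ^ K' \<and> (\<forall>j\<in>J. mono_eval I (e j) p' = mono_eval I (e j) p)"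
      using J(3) by (metis (no_types, opaque_lifting) e0 insert_iff)
    also have "p' i0 ^ K' = p i0 ^ K' \<longleftrightarrow> idx (p' i0 ^ K') = idx (p i0 ^ K')"
      using inj_on_eq_iff[OF bij_betw_imp_inj_on[OF idx] Sidx[OF p(2)] Sidx[OF p(1)]] by blast
    also have "(\<forall>j\<in>J. mono_eval I (e j) p' = mono_eval I (e j) p) \<longleftrightarrow>
        (\<forall>j\<in>?B. mono_eval I (e (\<beta> j)) p' = mono_eval I (e (\<beta> j)) p)"
      using bij_betw_imp_surj_on[OF \<beta>] by blast
    also have "\<dots> \<longleftrightarrow> (\<lambda>j\<in>?B. mono_eval I (e (\<beta> j)) p) = (\<lambda>j\<in>?B. mono_eval I (e (\<beta> j)) p')"
      by (auto simp: fun_eq_iff restrict_def)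
    finally show ?thesis by (auto simp: F_def)
  qed
  ultimately show ?thesis
    unfolding torus_orbit_map_def Let_def S_def[symmetric] K'_def[symmetric] N_def[symmetric]
    using Fc by blast
qed

text \<open>Replacing \<open>p j\<close> by \<open>p i * p j\<close> is an automorphism of the
  torus; its inverse uses that conjugation inverts on the circle. The constraint transforms by
  \<open>p i ^ a i * p j ^ a j = p i ^ (a i - a j) * (p i * p j) ^ a j\<close>, and the new
  coordinate has weight \<open>r i + r j\<close>. This is one subtraction in Euclid's
  algorithm.\<close>

lemma torus_orbit_map_shear:
  assumes I: "finite I" "i \<in> I" "j \<in> I" "i \<noteq> j" and a: "a j \<le> a i"
    and F: "torus_orbit_map I (a(i := a i - a j)) (r(j := r i + r j)) K \<epsilon> N F"
  shows "torus_orbit_map I a r K \<epsilon> N (\<lambda>p. F (p(j := p i * p j)))"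
proof -
  define \<phi> where "\<phi> = (\<lambda>p::'a \<Rightarrow> complex. p(j := p i * p j))"
  define \<psi> where "\<psi> = (\<lambda>p::'a \<Rightarrow> complex. p(j := cnj (p i) * p j))"
  define a' where "a' = a(i := a i - a j)"
  define r' where "r' = r(j := r i + r j)"
  define S where "S = {p \<in> topspace (circle_power I). mono_eval I a p = \<epsilon>}"
  define S' where "S' = {p \<in> topspace (circle_power I). mono_eval I a' p = \<epsilon>}"
  define Y where "Y = prod_topology (power_circle (card I - 1)) (discrete_topology {..<N})"
  have F: "continuous_map (subtopology (circle_power I) S') Y F" "F ` S' = topspace Y"
     "\<And>p p'. p \<in> S' \<Longrightarrow> p' \<in> S' \<Longrightarrow> F p = F p' \<longleftrightarrow> rotated I K r' p p'"
    using F unfolding torus_orbit_map_def Let_def a'_def[symmetric] r'_def[symmetric] S'_def[symmetric] Y_def[symmetric]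
    by blast+
  have eval: "mono_eval I a' (\<phi> p) = mono_eval I a p" for p
  proof -
    define L where "L = I - {i, j}"
    have L: "I = insert i (insert j L)" "finite L" "i \<notin> insert j L" "j \<notin> L" using I by (auto simp: L_def)
    have "mono_eval L a' (\<phi> p) = mono_eval L a p"
      using L by (intro mono_eval_cong) (auto simp: a'_def \<phi>_def)
    moreover have "p i ^ (a i - a j) * (p i * p j) ^ a j = p i ^ a i * p j ^ a j"
      using a by (simp add: power_mult_distrib power_add[symmetric] mult.assoc[symmetric])
    ultimately show ?thesis
      using L I(4) by (simp add: mono_eval_insert a'_def \<phi>_def mult.assoc[symmetric])
  qed
  have circ: "cnj z * z = 1" if "z \<in> circle" for z
    using that by (metis complex_norm_square dist_0_norm mem_sphere mult.commute of_real_1 power_one)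
  have tops: "\<phi> p \<in> topspace (circle_power I)" "\<psi> p \<in> topspace (circle_power I)"
    "\<phi> (\<psi> p) = p" if "p \<in> topspace (circle_power I)" for p
    using that I circ[of "p i"] by (auto simp: \<phi>_def \<psi>_def PiE_iff norm_mult extensional_def
      mult.assoc[symmetric] mult.commute[of "p i"] fun_eq_iff)
  have \<phi>S: "\<phi> ` S = S'"
  proof (intro equalityI subsetI)
    fix p assume "p \<in> S'"
    then have "\<phi> (\<psi> p) = p" "\<psi> p \<in> S" using tops eval[of "\<psi> p"] by (auto simp: S_def S'_def)
    then show "p \<in> \<phi> ` S" by (metis imageI)
  qed (use tops eval in \<open>auto simp: S_def S'_def\<close>)
  have "continuous_map (subtopology (circle_power I) S) (subtopology (circle_power I) S') \<phi>"
  proof -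
    have "continuous_map (subtopology (circle_power I) S) (top_of_set circle) (\<lambda>p. \<phi> p l)" if l: "l \<in> I" for l
    proof -
      have "continuous_map (subtopology (circle_power I) S) euclidean (\<lambda>p. \<phi> p l)"
        using I l by (cases "l = j") (auto simp: \<phi>_def intro!: continuous_intros
            continuous_map_from_subtopology continuous_map_circle_power_proj)
      moreover have "\<phi> p l \<in> circle" if "p \<in> S" for p
      proof -
        have "\<phi> p \<in> topspace (circle_power I)" using tops that by (auto simp: S_def)
        then show ?thesis using l by (auto simp: PiE_iff)
      qed
      ultimately show ?thesis by (auto simp: continuous_map_in_subtopology)
    qed
    moreover have "\<phi> ` S \<subseteq> extensional I" using tops by (auto simp: S_def PiE_def)
    ultimately show ?thesis
      using \<phi>S by (auto simp: continuous_map_in_subtopology continuous_map_componentwise)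
  qed
  then have "continuous_map (subtopology (circle_power I) S) Y (F \<circ> \<phi>)"
    using F(1) by (rule continuous_map_compose)
  moreover have "(F \<circ> \<phi>) ` S = topspace Y" by (metis F(2) \<phi>S image_comp)
  moreover have "(F \<circ> \<phi>) p = (F \<circ> \<phi>) p' \<longleftrightarrow> rotated I K r p p'" if p: "p \<in> S" "p' \<in> S" for p p'
  proof -
    have nz: "p l \<noteq> 0" if "l \<in> I" for l using p(1) that by (auto simp: S_def PiE_iff)
    have "rotated I K r' (\<phi> p) (\<phi> p') \<longleftrightarrow> rotated I K r p p'"
    proof -
      have "(\<forall>l\<in>I. \<phi> p' l = \<theta> ^ r' l * \<phi> p l) \<longleftrightarrow> (\<forall>l\<in>I. p' l = \<theta> ^ r l * p l)" if "\<theta> ^ K = 1" for \<theta>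
      proof -
        have "(\<forall>l\<in>I. \<phi> p' l = \<theta> ^ r' l * \<phi> p l) \<longleftrightarrow>
            (\<forall>l\<in>I - {j}. p' l = \<theta> ^ r l * p l) \<and> p' i * p' j = \<theta> ^ (r i + r j) * (p i * p j)"
          using I by (auto simp: \<phi>_def r'_def)
        also have "\<dots> \<longleftrightarrow> (\<forall>l\<in>I - {j}. p' l = \<theta> ^ r l * p l) \<and> p' i * p' j = p' i * (\<theta> ^ r j * p j)"
          using I by (auto simp: power_add)
        also have "\<dots> \<longleftrightarrow> (\<forall>l\<in>I - {j}. p' l = \<theta> ^ r l * p l) \<and> p' j = \<theta> ^ r j * p j"
        proof -
          have "p' i \<noteq> 0" using p(2) I by (auto simp: S_def PiE_iff)
          then show ?thesis by simp
        qed
        also have "\<dots> \<longleftrightarrow> (\<forall>l\<in>I. p' l = \<theta> ^ r l * p l)" using I by auto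
        finally show ?thesis .
      qed
      then show ?thesis unfolding rotated_def by blast
    qed
    moreover have "\<phi> p \<in> S'" "\<phi> p' \<in> S'" using p \<phi>S by auto
    ultimately show ?thesis using F(3) by simp
  qed
  ultimately show ?thesis
    unfolding torus_orbit_map_def Let_def S_def[symmetric] Y_def[symmetric] \<phi>_def[symmetric]
    by (auto simp: o_def \<phi>_def)
qed

text \<open>A shear preserves the gcd of the exponents and the sum of \<open>a i * r i\<close>,
  while the sum of the exponents drops. At the end a single positive exponent is left, which must be
  the gcd, and the preserved sum then forces its weight to be \<open>h\<close>. Hence the number of
  components can be written down in advance.\<close>

theorem ex_torus_orbit_map:
  fixes a r :: "'i \<Rightarrow> nat"
  assumes "finite I" "\<exists>i\<in>I. a i > 0" "K > 0" "(\<Sum>i\<in>I. a i * r i) = Gcd (a ` I) * h"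
    "K dvd Gcd (a ` I) * h" "\<epsilon> \<in> circle"
  shows "\<exists>F. torus_orbit_map I a r K \<epsilon> (Gcd (a ` I) div (K div gcd K h)) F"
  using assms(2,4,5)
proof (induction "\<Sum>i\<in>I. a i" arbitrary: a r rule: less_induct)
  case less
  obtain i where i: "i \<in> I" "a i > 0" using less.prems by blast
  show ?case
  proof (cases "\<exists>j\<in>I. j \<noteq> i \<and> a j > 0")
    case False
    then have z: "\<And>j. j \<in> I \<Longrightarrow> j \<noteq> i \<Longrightarrow> a j = 0" by auto
    have "Gcd (a ` I) = a i"
    proof (rule dvd_antisym)
      show "Gcd (a ` I) dvd a i" using i by (auto intro: Gcd_dvd)
      have "a i dvd a j" if "j \<in> I" for j using z[OF that] by (cases "j = i") auto
      then show "a i dvd Gcd (a ` I)" by (auto intro: Gcd_greatest)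
    qed
    moreover have "(\<Sum>j\<in>I. a j * r j) = a i * r i"
      using assms(1) i z by (subst sum.remove[of _ i]) auto
    ultimately have "Gcd (a ` I) = a i" "h = r i" using less.prems(2) i by auto
    then show ?thesis
      using torus_orbit_map_single[of I i a K r \<epsilon>] assms i z less.prems by auto
  next
    case True
    then obtain j where j: "j \<in> I" "j \<noteq> i" "a j > 0" by blast
    have step: ?thesis if ij: "i \<in> I" "j \<in> I" "i \<noteq> j" "a j \<le> a i" "a j > 0" for i j
    proof -
      define a' where "a' = a(i := a i - a j)"
      define r' where "r' = r(j := r i + r j)"
      define L where "L = I - {i, j}"
      have L: "I = insert i (insert j L)" "finite L" "i \<notin> insert j L" "j \<notin> L"
        using ij assms(1) by (auto simp: L_def)
      have rest: "(\<Sum>l\<in>L. a' l) = (\<Sum>l\<in>L. a l)" "(\<Sum>l\<in>L. a' l * r' l) = (\<Sum>l\<in>L. a l * r l)"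
        using L by (auto intro!: sum.cong simp: a'_def r'_def)
      have "(\<Sum>l\<in>I. a' l) = (a i - a j) + (a j + (\<Sum>l\<in>L. a l))"
        using L rest ij by (simp add: a'_def)
      moreover have "(\<Sum>l\<in>I. a l) = a i + (a j + (\<Sum>l\<in>L. a l))" using L ij by simp
      ultimately have lt: "(\<Sum>l\<in>I. a' l) < (\<Sum>l\<in>I. a l)" using ij by linarith
      have "(\<Sum>l\<in>I. a' l * r' l) = (a i - a j) * r i + (a j * (r i + r j) + (\<Sum>l\<in>L. a l * r l))"
        using L rest ij by (simp add: a'_def r'_def)
      also have "\<dots> = a i * r i + (a j * r j + (\<Sum>l\<in>L. a l * r l))"
      proof -
        have "(a i - a j) * r i + a j * r i = a i * r i"
          using ij(4) by (metis add_mult_distrib le_add_diff_inverse2)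
        then show ?thesis by (simp add: add_mult_distrib2)
      qed
      also have "\<dots> = (\<Sum>l\<in>I. a l * r l)"
        using L ij by simp
      finally have ar: "(\<Sum>l\<in>I. a' l * r' l) = (\<Sum>l\<in>I. a l * r l)" .
      have G: "Gcd (a' ` I) = Gcd (a ` I)"
      proof (rule dvd_antisym)
        have "Gcd (a' ` I) dvd a l" if "l \<in> I" for l
        proof -
          have *: "Gcd (a' ` I) dvd a' l" if "l \<in> I" for l using that by (auto intro: Gcd_dvd)
          have "Gcd (a' ` I) dvd a' i + a' j" using * ij by (intro dvd_add) auto
          moreover have "a' i + a' j = a i" using ij by (simp add: a'_def)
          ultimately show ?thesis using *[OF that] by (cases "l = i") (auto simp: a'_def)
        qed
        then show "Gcd (a' ` I) dvd Gcd (a ` I)" by (auto intro: Gcd_greatest)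
        have "Gcd (a ` I) dvd a' l" if "l \<in> I" for l
          using that ij by (auto simp: a'_def intro!: dvd_diff_nat Gcd_dvd)
        then show "Gcd (a ` I) dvd Gcd (a' ` I)" by (auto intro: Gcd_greatest)
      qed
      have "\<exists>l\<in>I. a' l > 0" using ij by (intro bexI[of _ j]) (auto simp: a'_def)
      then have "\<exists>F. torus_orbit_map I a' r' K \<epsilon> (Gcd (a' ` I) div (K div gcd K h)) F"
        using less.hyps[OF lt] ar G less.prems by simp
      then show ?thesis
        unfolding G using torus_orbit_map_shear[OF assms(1) ij(1-4)] unfolding a'_def r'_def by blast
    qed
    show ?thesis
    proof (cases "a j \<le> a i")
      case True then show ?thesis using step i j by blast
    next
      case False then show ?thesis using step[of j i] i j by auto
    qed
  qed
qed

section \<open>Homotopy equivalent quotients\<close>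

text \<open>Continuity is checked one label at a time. The slice of \<open>S\<close> may vary with
  the label, as it does for the twisted fixed points.\<close>

lemma continuous_map_discrete_prod:
  assumes "\<And>a. a \<in> A \<Longrightarrow> continuous_map (subtopology X {x. (a, x) \<in> S}) Y (\<lambda>x. f (a, x))"
  shows "continuous_map (subtopology (prod_topology (discrete_topology A) X) S) Y f"
  unfolding continuous_map_def
proof (intro conjI allI impI)
  have "f (a, x) \<in> topspace Y" if "a \<in> A" "x \<in> topspace X" "(a, x) \<in> S" for a x
    using continuous_map_image_subset_topspace[OF assms[OF that(1)]] that by auto
  then show "f \<in> topspace (subtopology (prod_topology (discrete_topology A) X) S) \<rightarrow> topspace Y"
    by auto
  fix U assume U: "openin Y U"
  have "\<exists>T. openin X T \<and> {x \<in> topspace X. (a, x) \<in> S \<and> f (a, x) \<in> U} = T \<inter> {x. (a, x) \<in> S}" if "a \<in> A" for a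
  proof -
    have "openin (subtopology X {x. (a, x) \<in> S})
        {x \<in> topspace (subtopology X {x. (a, x) \<in> S}). f (a, x) \<in> U}"
      using openin_continuous_map_preimage[OF assms[OF that] U] .
    moreover have "{x \<in> topspace (subtopology X {x. (a, x) \<in> S}). f (a, x) \<in> U}
        = {x \<in> topspace X. (a, x) \<in> S \<and> f (a, x) \<in> U}" by auto
    ultimately show ?thesis unfolding openin_subtopology by metis
  qed
  then have "\<forall>a\<in>A. \<exists>T. openin X T \<and> {x \<in> topspace X. (a, x) \<in> S \<and> f (a, x) \<in> U} = T \<inter> {x. (a, x) \<in> S}"
    by blast
  then obtain T where T': "\<forall>a\<in>A. openin X (T a) \<and> {x \<in> topspace X. (a, x) \<in> S \<and> f (a, x) \<in> U} = T a \<inter> {x. (a, x) \<in> S}"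
    by (rule bchoice[THEN exE])
  then have T: "\<And>a. a \<in> A \<Longrightarrow> openin X (T a)"
     "\<And>a. a \<in> A \<Longrightarrow> {x \<in> topspace X. (a, x) \<in> S \<and> f (a, x) \<in> U} = T a \<inter> {x. (a, x) \<in> S}"
    by (simp, blast)
  let ?W = "\<Union>a\<in>A. {a} \<times> T a"
  have "openin (prod_topology (discrete_topology A) X) ?W"
    using T(1) by (intro openin_Union) (auto simp: openin_prod_Times_iff)
  moreover have "{z \<in> topspace (subtopology (prod_topology (discrete_topology A) X) S). f z \<in> U} = ?W \<inter> S"
    (is "?L = _")
  proof (intro equalityI subsetI)
    fix z assume "z \<in> ?L"
    then obtain a x where "z = (a, x)" "a \<in> A" "x \<in> topspace X" "(a, x) \<in> S" "f (a, x) \<in> U" by auto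
    then show "z \<in> ?W \<inter> S" using T(2)[of a] by auto
  next
    fix z assume "z \<in> ?W \<inter> S"
    then obtain a x where z: "z = (a, x)" "a \<in> A" "x \<in> T a" "(a, x) \<in> S" by auto
    then have "x \<in> {x \<in> topspace X. (a, x) \<in> S \<and> f (a, x) \<in> U}" using T(2)[of a] by auto
    then show "z \<in> ?L" using z by auto
  qed
  ultimately show "openin (subtopology (prod_topology (discrete_topology A) X) S)
      {z \<in> topspace (subtopology (prod_topology (discrete_topology A) X) S). f z \<in> U}"
    unfolding openin_subtopology by blast
qed

lemma Hausdorff_space_sum_topology:
  assumes "\<And>i. i \<in> I \<Longrightarrow> Hausdorff_space (X i)"
  shows "Hausdorff_space (sum_topology X I)"
  unfolding Hausdorff_space_def
proof (intro allI impI)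
  fix z w assume zw: "z \<in> topspace (sum_topology X I) \<and> w \<in> topspace (sum_topology X I) \<and> z \<noteq> w"
  obtain i x where z: "z = (i, x)" by (cases z)
  obtain j y where w: "w = (j, y)" by (cases w)
  have ij: "z = (i, x)" "w = (j, y)" "i \<in> I" "j \<in> I" "x \<in> topspace (X i)" "y \<in> topspace (X j)"
    using zw z w by auto
  have op: "openin (sum_topology X I) ({i} \<times> U)" if "i \<in> I" "openin (X i) U" for i U
  proof -
    have "{x. (j, x) \<in> {i} \<times> U} = (if j = i then U else {})" for j by auto
    then show ?thesis using that openin_subset[OF that(2)] by (simp add: openin_sum_topology) auto
  qed
  show "\<exists>U V. openin (sum_topology X I) U \<and> openin (sum_topology X I) V \<and> z \<in> U \<and> w \<in> V \<and> disjnt U V"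
  proof (cases "i = j")
    case True
    then obtain U V where "openin (X i) U" "openin (X i) V" "x \<in> U" "y \<in> V" "disjnt U V"
      using assms ij zw unfolding Hausdorff_space_def by metis
    then show ?thesis
      using op ij True by (intro exI[of _ "{i} \<times> U"] exI[of _ "{i} \<times> V"]) (auto simp: disjnt_def)
  next
    case False
    then show ?thesis
      using op ij by (intro exI[of _ "{i} \<times> topspace (X i)"] exI[of _ "{j} \<times> topspace (X j)"]) (auto simp: disjnt_def)
  qed
qed

text \<open>Both spaces are quotients of \<open>L\<close>. Points glued by \<open>q\<close> stay
  glued after \<open>H 0\<close>, so \<open>f\<close> descends to \<open>E\<close>; conversely
  \<open>q\<close> after \<open>H 0\<close> descends to \<open>M\<close>. One composite is the
  identity because \<open>f\<close> does not notice \<open>H 0\<close>. The other is induced by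
  \<open>H 0\<close>, and the descended homotopy joins it to the identity.\<close>

lemma homotopy_equivalent_quotients:
  assumes q: "quotient_map L E q" and f: "quotient_map L M f"
    and H: "continuous_map (prod_topology (top_of_set {0..1::real}) L) L (\<lambda>(s, x). H s x)"
    and H1: "\<And>x. x \<in> topspace L \<Longrightarrow> H 1 x = x"
    and Hq: "\<And>s x y. \<lbrakk>s \<in> {0..1}; x \<in> topspace L; y \<in> topspace L; q x = q y\<rbrakk> \<Longrightarrow> q (H s x) = q (H s y)"
    and f_iff: "\<And>x y. \<lbrakk>x \<in> topspace L; y \<in> topspace L\<rbrakk> \<Longrightarrow> f x = f y \<longleftrightarrow> q (H 0 x) = q (H 0 y)"
    and fH: "\<And>x. x \<in> topspace L \<Longrightarrow> f (H 0 x) = f x"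
  shows "E homotopy_equivalent_space M"
proof -
  let ?J = "top_of_set {0..1::real}"
  have Hin: "H s x \<in> topspace L" if "s \<in> {0..1}" "x \<in> topspace L" for s x
  proof -
    have "(\<lambda>(s, x). H s x) (s, x) \<in> topspace L"
      using that by (intro subsetD[OF continuous_map_image_subset_topspace[OF H]] imageI) auto
    then show ?thesis by simp
  qed
  have qc: "continuous_map L E q" and fc: "continuous_map L M f"
    using q f by (simp_all add: quotient_imp_continuous_map)
  have qs: "q ` topspace L = topspace E" and fs: "f ` topspace L = topspace M"
    using q f by (simp_all add: quotient_imp_surjective_map)
  have H0c: "continuous_map L L (H 0)"
    using continuous_map_o_Pair[OF H, of 0] by (simp add: o_def)
  obtain g where g: "continuous_map E M g" "\<And>x. x \<in> topspace L \<Longrightarrow> g (q x) = f x"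
    using quotient_map_lift_exists[OF q fc] f_iff Hq[of 0] by (metis atLeastAtMost_iff order_refl zero_le_one)
  obtain g' where g': "continuous_map M E g'" "\<And>x. x \<in> topspace L \<Longrightarrow> g' (f x) = q (H 0 x)"
    using quotient_map_lift_exists[OF f continuous_map_compose[OF H0c qc]] f_iff by (metis comp_apply)
  \<comment> \<open>The unit interval is locally compact and Hausdorff, so the product of its
    identity with \<open>q\<close> is again a quotient map. This lets \<open>H\<close> descend
    without any separation property of \<open>E\<close>.\<close>
  have Q: "quotient_map (prod_topology ?J L) (prod_topology ?J E) (\<lambda>(s, x). (s, q x))"
    by (intro quotient_map_prod_right q)
       (auto intro: compact_imp_locally_compact_space simp: compact_space_subtopology Hausdorff_space_subtopology)
  have c: "continuous_map (prod_topology ?J L) E (q \<circ> (\<lambda>(s, x). H s x))"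
    by (rule continuous_map_compose[OF H qc])
  have e: "(q \<circ> (\<lambda>(s, x). H s x)) z = (q \<circ> (\<lambda>(s, x). H s x)) w"
    if "z \<in> topspace (prod_topology ?J L)" "w \<in> topspace (prod_topology ?J L)"
      "(\<lambda>(s, x). (s, q x)) z = (\<lambda>(s, x). (s, q x)) w" for z w
  proof -
    obtain s x where z: "z = (s, x)" by (cases z)
    obtain s' y where w: "w = (s', y)" by (cases w)
    show ?thesis using that Hq[of s x y] by (simp add: z w)
  qed
  have "\<exists>k. continuous_map (prod_topology ?J E) E k \<and> (\<forall>s\<in>{0..1}. \<forall>x\<in>topspace L. k (s, q x) = q (H s x))"
  proof (rule quotient_map_lift_exists[OF Q c e])
    fix k assume k: "continuous_map (prod_topology ?J E) E k"
      "\<And>z. z \<in> topspace (prod_topology ?J L) \<Longrightarrow> k ((\<lambda>(s, x). (s, q x)) z) = (q \<circ> (\<lambda>(s, x). H s x)) z"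
    have "k (s, q x) = q (H s x)" if "s \<in> {0..1}" "x \<in> topspace L" for s x
      using k(2)[of "(s, x)"] that by simp
    then show ?thesis using k(1) by blast
  qed
  then obtain k where k: "continuous_map (prod_topology ?J E) E k"
    and kq: "\<And>s x. s \<in> {0..1} \<Longrightarrow> x \<in> topspace L \<Longrightarrow> k (s, q x) = q (H s x)" by blast
  have "homotopic_with (\<lambda>x. True) E E (g' \<circ> g) id"
  proof (subst homotopic_with)
    show "\<exists>h. continuous_map (prod_topology ?J E) E h \<and> (\<forall>x\<in>topspace E. h (0, x) = (g' \<circ> g) x) \<and>
      (\<forall>x\<in>topspace E. h (1, x) = id x) \<and> (\<forall>t\<in>{0..1}. True)"
  proof (intro exI[of _ k] conjI ballI k TrueI)
    fix e assume "e \<in> topspace E"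
    then obtain x where "x \<in> topspace L" "e = q x" using qs by blast
    then show "k (0, e) = (g' \<circ> g) e" "k (1, e) = id e" using kq[of 0 x] kq[of 1 x] g(2) g'(2) H1 by simp_all
  qed
  qed simp
  moreover have "homotopic_with (\<lambda>x. True) M M (g \<circ> g') id"
  proof (rule homotopic_with_equal)
    show "continuous_map M M (g \<circ> g')" using g g' by (metis continuous_map_compose)
    fix m assume "m \<in> topspace M"
    then obtain x where "x \<in> topspace L" "m = f x" using fs by blast
    then show "(g \<circ> g') m = id m" using g g' Hin[of 0 x] fH by simp
  qed auto
  ultimately show ?thesis using g(1) g'(1) unfolding homotopy_equivalent_space_def by blast
qed

section \<open>Multisets on the circle\<close>

definition root_poly :: "complex multiset \<Rightarrow> complex poly" where
  "root_poly U = (\<Prod>u\<in>#U. [:-u, 1:])"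

lemma root_poly_simps [simp]: "root_poly {#} = 1" "root_poly (add_mset u U) = [:-u, 1:] * root_poly U"
  by (simp_all add: root_poly_def)

lemma root_poly_nonzero [simp]: "root_poly U \<noteq> 0"
  by (auto simp: root_poly_def prod_mset_zero_iff)

lemma degree_root_poly [simp]: "degree (root_poly U) = size U"
  by (induction U) (simp_all add: degree_mult_eq del: mult_pCons_left)

lemma lead_coeff_root_poly [simp]: "coeff (root_poly U) (size U) = 1"
proof -
  have "lead_coeff (root_poly U) = 1"
    by (induction U) (simp_all only: root_poly_simps lead_coeff_mult lead_coeff_1 lead_coeff_pCons(1), simp_all)
  then show ?thesis by simp
qed

lemma root_poly_eq_iff: "root_poly U = root_poly V \<longleftrightarrow> U = V"
proof -
  have "proots (root_poly U) = U" for U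
    by (induction U) (simp_all add: proots_mult del: mult_pCons_left)
  then show ?thesis by metis
qed

lemma poly_root_poly: "poly (root_poly U) z = (\<Prod>u\<in>#U. z - u)"
  by (induction U) (simp_all add: algebra_simps)

lemma coeff_linear_mult:
  "coeff ([:a, 1:] * p) j = (a::complex) * coeff p j + (case j of 0 \<Rightarrow> 0 | Suc i \<Rightarrow> coeff p i)"
  by (simp add: coeff_pCons split: nat.split)

lemma coeff_root_poly_gt: "j > size U \<Longrightarrow> coeff (root_poly U) j = 0"
  by (simp add: coeff_eq_0)

text \<open>Serves twice: for a root of unity \<open>s\<close> it is the rotation action on
  coefficients, for real \<open>s\<close> it gives one half of the damped polynomial. Scaling roots
  instead of substituting \<open>X / s\<close> includes \<open>s = 0\<close>. Beyond the degree the
  truncated exponent meets a zero coefficient.\<close>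

lemma coeff_root_poly_scale:
  "coeff (root_poly (image_mset ((*) s) U)) j = s ^ (size U - j) * coeff (root_poly U) j"
proof (induction U arbitrary: j)
  case empty
  then show ?case by (cases j) auto
next
  case (add u U)
  show ?case
  proof (cases j)
    case 0
    then show ?thesis
      by (simp only: image_mset_add_mset root_poly_simps coeff_linear_mult add.IH) simp
  next
    case (Suc i)
    have "s ^ Suc (size U - Suc i) * coeff (root_poly U) (Suc i) = s ^ (size U - i) * coeff (root_poly U) (Suc i)"
      by (cases "size U \<ge> Suc i") (simp_all add: coeff_root_poly_gt Suc_diff_Suc)
    moreover have "- (s * u) * (p * c) + p' * c' = p' * (- u * c + c')" if "s * p * c = p' * c" for p c p' c'
      using that by algebra
    ultimately show ?thesis
      by (simp only: Suc image_mset_add_mset root_poly_simps coeff_linear_mult add.IH size_add_mset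
          diff_Suc_Suc nat.case power_Suc)
  qed
qed

lemma coeff_0_root_poly: "coeff (root_poly U) 0 = (- 1) ^ size U * prod_mset U"
  by (induction U) (simp_all add: coeff_linear_mult del: mult_pCons_left)

lemma continuous_map_coeff_prod:
  fixes f :: "'a \<Rightarrow> 'c \<Rightarrow> complex"
  assumes "\<And>c. c \<in> A \<Longrightarrow> continuous_map X euclidean (\<lambda>x. f x c)"
  shows "continuous_map X euclidean (\<lambda>x. coeff (\<Prod>c\<in>A. [:- f x c, 1:]) j)"
proof (cases "finite A")
  case True
  then show ?thesis using assms
  proof (induction A arbitrary: j)
    case empty
    then show ?case by simp
  next
    case (insert c A)
    have A: "continuous_map X euclidean (\<lambda>x. coeff (\<Prod>c\<in>A. [:- f x c, 1:]) j)" for j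
      using insert by blast
    have B: "continuous_map X euclidean (\<lambda>x. case j of 0 \<Rightarrow> 0 | Suc i \<Rightarrow> coeff (\<Prod>c\<in>A. [:- f x c, 1:]) i)"
      by (cases j) (simp_all add: A)
    show ?case
      unfolding prod.insert[OF insert.hyps] coeff_linear_mult
      by (intro continuous_map_add continuous_map_field_mult continuous_map_minus A B insert.prems) simp
  qed
qed simp

text \<open>The factor for the coefficient of \<open>X ^ j\<close> in degree \<open>r\<close>. For
  \<open>s\<close> in the unit interval it is \<open>1\<close> at both ends \<open>j = 0\<close> and
  \<open>j = r\<close>, so monic polynomials stay monic and keep their constant term. It is always
  \<open>1\<close> at \<open>s = 1\<close>, and it vanishes strictly between the ends at
  \<open>s = 0\<close>.\<close>

definition damp :: "real \<Rightarrow> nat \<Rightarrow> nat \<Rightarrow> complex" where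
  "damp s r j = of_real ((s ^ j + s ^ (r - j)) / (1 + s ^ r))"

lemma prod_mset_nonneg_real:
  fixes f :: "'a \<Rightarrow> real"
  shows "(\<And>u. u \<in># U \<Longrightarrow> 0 \<le> f u) \<Longrightarrow> 0 \<le> (\<Prod>u\<in>#U. f u)"
  by (induction U) simp_all

lemma prod_mset_strict_mono:
  fixes f g :: "'a \<Rightarrow> real"
  assumes "U \<noteq> {#}" "\<And>u. u \<in># U \<Longrightarrow> 0 \<le> f u \<and> f u < g u"
  shows "(\<Prod>u\<in>#U. f u) < (\<Prod>u\<in>#U. g u)"
  using assms
proof (induction U)
  case (add u U)
  have nn: "0 \<le> (\<Prod>u\<in>#U. f u)" using add.prems(2) by (intro prod_mset_nonneg_real) auto
  show ?case
  proof (cases "U = {#}")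
    case False
    then have "(\<Prod>u\<in>#U. f u) < (\<Prod>u\<in>#U. g u)" using add by auto
    moreover have "0 \<le> f u" "f u < g u" using add.prems(2) by auto
    ultimately show ?thesis using nn by (auto intro: mult_strict_mono)
  qed (use add.prems in auto)
qed simp

lemma norm_prod_mset: "norm (\<Prod>u\<in>#U. f u :: complex) = (\<Prod>u\<in>#U. norm (f u))"
  by (induction U) (simp_all add: norm_mult)

text \<open>In the difference of the squared norms the cross terms cancel. What remains is
  \<open>1 - s ^ 2\<close> times the difference of the squared norms of \<open>v\<close> and
  \<open>u\<close>.\<close>

lemma damped_root_comparison:
  fixes v u :: complex
  assumes "norm u = 1" "0 \<le> s" "s < 1"
  shows "norm v > 1 \<Longrightarrow> norm (of_real s * v - u) < norm (v - of_real s * u)"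
    and "norm v < 1 \<Longrightarrow> norm (v - of_real s * u) < norm (of_real s * v - u)"
proof -
  have "(norm (v - of_real s * u))\<^sup>2 - (norm (of_real s * v - u))\<^sup>2 = (1 - s\<^sup>2) * ((norm v)\<^sup>2 - (norm u)\<^sup>2)"
    unfolding cmod_power2 by (simp add: power2_eq_square algebra_simps)
  then have *: "(norm (v - of_real s * u))\<^sup>2 - (norm (of_real s * v - u))\<^sup>2 = (1 - s\<^sup>2) * ((norm v)\<^sup>2 - 1)"
    using assms(1) by simp
  have s: "1 - s\<^sup>2 > 0" using assms by (simp add: power_less_one_iff abs_square_less_1)
  show "norm (of_real s * v - u) < norm (v - of_real s * u)" if "norm v > 1"
  proof -
    have "(norm v)\<^sup>2 > 1" using that by (simp add: one_less_power)
    then have "(1 - s\<^sup>2) * ((norm v)\<^sup>2 - 1) > 0" using s by simp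
    then have "(norm (of_real s * v - u))\<^sup>2 < (norm (v - of_real s * u))\<^sup>2" using * by linarith
    then show ?thesis by (rule power_less_imp_less_base) simp
  qed
  show "norm (v - of_real s * u) < norm (of_real s * v - u)" if "norm v < 1"
  proof -
    have "(norm v)\<^sup>2 < 1" using that by (simp add: abs_square_less_1)
    then have "(1 - s\<^sup>2) * ((norm v)\<^sup>2 - 1) < 0" using s by (simp add: mult_pos_neg)
    then have "(norm (v - of_real s * u))\<^sup>2 < (norm (of_real s * v - u))\<^sup>2" using * by linarith
    then show ?thesis by (rule power_less_imp_less_base) simp
  qed
qed

text \<open>The damped polynomial is proportional to \<open>P (s X) + s\<^sup>r P (X / s)\<close> for the monic polynomial
  \<open>P\<close> of degree \<open>r\<close> with roots \<open>U\<close>. Off the unit circle the two terms have different absolute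
  values.\<close>

theorem ex_damped_roots:
  assumes U: "set_mset U \<subseteq> circle" and s: "0 \<le> s" "s \<le> 1"
  shows "\<exists>V. set_mset V \<subseteq> circle \<and> size V = size U \<and> prod_mset V = prod_mset U \<and>
    (\<forall>j. coeff (root_poly V) j = damp s (size U) j * coeff (root_poly U) j)"
proof (cases "U = {#} \<or> s = 1")
  \<comment> \<open>The strict comparison in the other case needs at least one root and
    \<open>s < 1\<close>. Here the damping changes nothing and \<open>U\<close> itself
    serves.\<close>
  case True
  have "coeff (root_poly U) j = damp s (size U) j * coeff (root_poly U) j" for j
    using True by (cases j) (auto simp: damp_def)
  then show ?thesis using U by blast
next
  case False
  then have s1: "s < 1" and Une: "U \<noteq> {#}" using s by auto
  define r where "r = size U"
  \<comment> \<open>At a point \<open>v\<close> the factors of the two polynomials are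
    \<open>s v - u\<close> and \<open>v - s u\<close>. Scaling the roots in \<open>B\<close> makes
    sense for \<open>s = 0\<close> as well.\<close>
  define A where "A = pcompose (root_poly U) [:0, of_real s:]"
  define B where "B = root_poly (image_mset ((*) (of_real s)) U)"
  define q where "q = smult (of_real (1 / (1 + s ^ r))) (A + B)"
  have pos: "1 + s ^ r > 0" using s by (simp add: add_pos_nonneg)
  have coeff_q: "coeff q j = damp s r j * coeff (root_poly U) j" for j
    by (simp add: q_def A_def B_def coeff_pcompose_linear coeff_root_poly_scale damp_def r_def
        add_divide_distrib algebra_simps)
  have "damp s r r = 1" "damp s r 0 = 1" using pos by (auto simp: damp_def add.commute)
  then have top: "coeff q r = 1" and bot: "coeff q 0 = coeff (root_poly U) 0"
    by (simp_all add: coeff_q) (simp add: r_def)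
  have deg: "degree q = r"
  proof (rule antisym)
    show "degree q \<le> r" by (rule degree_le) (simp add: coeff_q r_def coeff_root_poly_gt)
    show "r \<le> degree q" by (rule le_degree) (simp add: top)
  qed
  have "q \<noteq> 0" using top by auto
  then obtain V where V: "size V = r" "q = smult (lead_coeff q) (\<Prod>x\<in>#V. [:-x, 1:])"
    using alg_closed_imp_factorization[of q] deg by blast
  then have qV: "q = root_poly V" using top deg by (simp add: root_poly_def)
  have "prod_mset V = prod_mset U"
    using bot V(1) by (simp add: qV coeff_0_root_poly r_def)
  moreover have "norm v = 1" if "v \<in># V" for v
  proof (rule ccontr)
    assume nv: "norm v \<noteq> 1"
    have "poly (root_poly V) v = 0" using that by (auto simp: poly_root_poly prod_mset_zero_iff)
    then have "poly A v + poly B v = 0"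
      using pos unfolding qV[symmetric] q_def by (auto simp: complex_eq_iff)
    then have "norm (poly A v) = norm (poly B v)"
      by (metis add_eq_0_iff norm_minus_cancel)
    moreover have "poly A v = (\<Prod>u\<in>#U. of_real s * v - u)"
      by (simp add: A_def poly_pcompose poly_root_poly mult.commute)
    moreover have "poly B v = (\<Prod>u\<in>#U. v - of_real s * u)"
      by (simp add: B_def poly_root_poly image_mset.compositionality o_def)
    ultimately have eq: "(\<Prod>u\<in>#U. norm (of_real s * v - u)) = (\<Prod>u\<in>#U. norm (v - of_real s * u))"
      by (simp add: norm_prod_mset)
    have un: "norm u = 1" if "u \<in># U" for u using that U by auto
    have "norm v > 1 \<or> norm v < 1" using nv by linarith
    then show False
    proof
      assume "norm v > 1"
      then show False
        using prod_mset_strict_mono[OF Une, of "\<lambda>u. norm (of_real s * v - u)" "\<lambda>u. norm (v - of_real s * u)"]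
          damped_root_comparison(1)[OF un s(1) s1] eq by simp
    next
      assume "norm v < 1"
      then show False
        using prod_mset_strict_mono[OF Une, of "\<lambda>u. norm (v - of_real s * u)" "\<lambda>u. norm (of_real s * v - u)"]
          damped_root_comparison(2)[OF un s(1) s1] eq by simp
    qed
  qed
  ultimately show ?thesis
    using V(1) coeff_q unfolding qV r_def by (intro exI[of _ V]) auto
qed

section \<open>Cycles of permutations\<close>

definition cyc :: "('n \<Rightarrow> 'n) \<Rightarrow> 'n \<Rightarrow> 'n set" where
  "cyc g x = range (\<lambda>j. (g ^^ j) x)"

definition cycles :: "('n \<Rightarrow> 'n) \<Rightarrow> 'n set set" where
  "cycles g = range (cyc g)"

lemma funpow_in_cyc: "(g ^^ j) x \<in> cyc g x"
  by (auto simp: cyc_def)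

lemma self_in_cyc: "x \<in> cyc g x"
  using funpow_in_cyc[of 0 g x] by simp

lemma funpow_diff_fixed:
  assumes "bij g" "i < j" "(g ^^ i) x = (g ^^ j) x"
  shows "(g ^^ (j - i)) x = x"
proof -
  have "(g ^^ i) x = (g ^^ i) ((g ^^ (j - i)) x)"
    using assms by (metis add_diff_inverse_nat comp_apply funpow_add less_imp_le not_less)
  moreover have "inj (g ^^ i)" using assms by (metis bij_fn bij_is_inj)
  ultimately show ?thesis by (metis injD)
qed

lemma ex_funpow_self:
  fixes g :: "'n::finite \<Rightarrow> 'n"
  assumes "bij g"
  shows "\<exists>p>0. (g ^^ p) x = x"
proof -
  have "\<not> inj (\<lambda>j. (g ^^ j) x)"
    using finite_imageD[of "\<lambda>j. (g ^^ j) x" UNIV] infinite_UNIV_nat by (auto simp: finite)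
  then obtain i j where ij: "i < j" "(g ^^ i) x = (g ^^ j) x"
    unfolding inj_def by (metis linorder_neqE_nat)
  then show ?thesis using funpow_diff_fixed[OF assms ij] by (intro exI[of _ "j - i"]) simp
qed

lemma funpow_period_mod:
  assumes "(g ^^ p) x = x"
  shows "(g ^^ (j mod p)) x = (g ^^ j) x"
proof -
  have "(g ^^ (p * q)) x = x" for q
    by (induction q) (simp_all add: assms funpow_add)
  then have "(g ^^ (j mod p + p * (j div p))) x = (g ^^ (j mod p)) x"
    by (simp only: funpow_add comp_apply)
  then show ?thesis by simp
qed

text \<open>The cycle length is the least period of \<open>x\<close>: earlier iterates are distinct
  and later ones repeat them. All index arithmetic on a cycle can then be done modulo its
  cardinality.\<close>

lemma cyc_period:
  fixes g :: "'n::finite \<Rightarrow> 'n"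
  assumes g: "bij g"
  shows "card (cyc g x) > 0"
    and "(g ^^ i) x = (g ^^ j) x \<longleftrightarrow> i mod card (cyc g x) = j mod card (cyc g x)"
    and "cyc g x = (\<lambda>j. (g ^^ j) x) ` {..<card (cyc g x)}"
    and "inj_on (\<lambda>j. (g ^^ j) x) {..<card (cyc g x)}"
proof -
  define p where "p = (LEAST p. p > 0 \<and> (g ^^ p) x = x)"
  have p: "p > 0" "(g ^^ p) x = x"
    using LeastI_ex[OF ex_funpow_self[OF g]] unfolding p_def by blast+
  have least: "\<not> (0 < q \<and> (g ^^ q) x = x)" if "q < p" for q
    using not_less_Least that unfolding p_def by blast
  have inj: "inj_on (\<lambda>j. (g ^^ j) x) {..<p}"
  proof (rule linorder_inj_onI')
    fix i j assume ij: "i \<in> {..<p}" "j \<in> {..<p}" "i < j"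
    show "(g ^^ i) x \<noteq> (g ^^ j) x"
    proof
      assume "(g ^^ i) x = (g ^^ j) x"
      then have "(g ^^ (j - i)) x = x" by (rule funpow_diff_fixed[OF g ij(3)])
      moreover have "j - i < p" "0 < j - i" using ij by auto
      ultimately show False using least by blast
    qed
  qed
  have cyc: "cyc g x = (\<lambda>j. (g ^^ j) x) ` {..<p}"
  proof (intro equalityI subsetI)
    fix y assume "y \<in> cyc g x"
    then obtain j where "y = (g ^^ j) x" by (auto simp: cyc_def)
    then have "y = (g ^^ (j mod p)) x" using funpow_period_mod[OF p(2)] by metis
    then show "y \<in> (\<lambda>j. (g ^^ j) x) ` {..<p}" using p(1) by simp
  qed (auto simp: cyc_def)
  then have card: "card (cyc g x) = p" using card_image[OF inj] by simp
  show "card (cyc g x) > 0" using card p by simp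
  show "cyc g x = (\<lambda>j. (g ^^ j) x) ` {..<card (cyc g x)}" using cyc card by simp
  show "inj_on (\<lambda>j. (g ^^ j) x) {..<card (cyc g x)}" using inj card by simp
  have "(g ^^ i) x = (g ^^ j) x \<longleftrightarrow> (g ^^ (i mod p)) x = (g ^^ (j mod p)) x"
    using funpow_period_mod[OF p(2)] by simp
  also have "\<dots> \<longleftrightarrow> i mod p = j mod p"
    using inj_on_eq_iff[OF inj, of "i mod p" "j mod p"] p(1) by simp
  finally show "(g ^^ i) x = (g ^^ j) x \<longleftrightarrow> i mod card (cyc g x) = j mod card (cyc g x)"
    by (simp only: card)
qed

lemma cyc_eq:
  fixes g :: "'n::finite \<Rightarrow> 'n"
  assumes g: "bij g" and y: "y \<in> cyc g x"
  shows "cyc g y = cyc g x"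
proof -
  have sub: "cyc g y \<subseteq> cyc g x" if y: "y \<in> cyc g x" for x y
  proof -
    obtain i where "y = (g ^^ i) x" using y by (auto simp: cyc_def)
    then have "(g ^^ j) y = (g ^^ (j + i)) x" for j by (simp add: funpow_add)
    then show ?thesis by (auto simp: cyc_def)
  qed
  obtain i where i: "y = (g ^^ i) x" using y by (auto simp: cyc_def)
  let ?m = "card (cyc g x)"
  \<comment> \<open>Counted from \<open>x\<close> these are \<open>i * ?m\<close> steps, a multiple
    of the cycle length, so a forward walk from \<open>y\<close> returns to \<open>x\<close> without
    using the inverse of \<open>g\<close>.\<close>
  have "(g ^^ (i * ?m - i)) y = (g ^^ (i * ?m - i + i)) x" by (simp add: i funpow_add)
  also have "\<dots> = (g ^^ 0) x"
    unfolding cyc_period(2)[OF g] using cyc_period(1)[OF g, of x] by simp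
  finally have "x \<in> cyc g y" by (metis funpow_0 funpow_in_cyc)
  then show ?thesis using sub sub[OF y] by blast
qed

lemma cycles_eq_cyc:
  fixes g :: "'n::finite \<Rightarrow> 'n"
  assumes "bij g" "C \<in> cycles g" "x \<in> C"
  shows "C = cyc g x"
proof -
  obtain y where "C = cyc g y" using assms(2) by (auto simp: cycles_def)
  then show ?thesis using cyc_eq[OF assms(1), of x y] assms(3) by simp
qed

lemma cyc_in_cycles: "cyc g x \<in> cycles g"
  by (simp add: cycles_def)

lemma finite_cycles [simp]: "finite (cycles (g :: 'n::finite \<Rightarrow> 'n))"
  by (simp add: cycles_def)

lemma Union_cycles: "\<Union> (cycles g) = UNIV"
  using self_in_cyc[of _ g] cyc_in_cycles[of g] by (meson UNIV_I UnionI subsetI subset_antisym)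

lemma prod_cycles:
  fixes g :: "'n::finite \<Rightarrow> 'n"
  assumes "bij g"
  shows "(\<Prod>x\<in>UNIV. f x) = (\<Prod>C\<in>cycles g. \<Prod>x\<in>C. f x)"
proof -
  have "\<Union> (cycles g) = UNIV" by (rule Union_cycles)
  moreover have "\<forall>A\<in>cycles g. \<forall>B\<in>cycles g. A \<noteq> B \<longrightarrow> A \<inter> B = {}"
    using cycles_eq_cyc[OF assms] by blast
  ultimately show ?thesis
    using prod.Union_disjoint[of "cycles g" f] by (simp add: comp_def)
qed

lemma card_cycles_sum:
  fixes g :: "'n::finite \<Rightarrow> 'n"
  assumes "bij g"
  shows "(\<Sum>C\<in>cycles g. card C) = CARD('n)"
proof -
  have "\<Union> (cycles g) = UNIV" by (rule Union_cycles)
  moreover have "pairwise disjnt (cycles g)"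
    using cycles_eq_cyc[OF assms] by (auto simp: pairwise_def disjnt_def)
  ultimately show ?thesis
    using card_Union_disjoint[of "cycles g"] by simp
qed

definition cycle_type :: "('n::finite \<Rightarrow> 'n) \<Rightarrow> nat multiset" where
  "cycle_type g = image_mset card (mset_set (cycles g))"

lemma cycle_type_partition:
  fixes g :: "'n::finite \<Rightarrow> 'n"
  assumes "bij g"
  shows "cycle_type g \<in> partitions CARD('n)"
proof -
  have "sum_mset (cycle_type g) = CARD('n)"
    using card_cycles_sum[OF assms] unfolding cycle_type_def sum_unfold_sum_mset .
  moreover have "card C > 0" if "C \<in> cycles g" for C
    using that cyc_period(1)[OF assms] unfolding cycles_def by blast
  then have "\<forall>m\<in>#cycle_type g. m > 0" by (simp add: cycle_type_def)
  ultimately show ?thesis by (simp add: partitions_def)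
qed

text \<open>Twisted fixed points: \<open>g\<close> moves \<open>t\<close> to \<open>\<zeta> t\<close>. On a cycle of \<open>g\<close> the entries of \<open>t\<close>
  differ by powers of \<open>\<zeta>\<close>, so their powers with exponent \<open>root_ord \<zeta>\<close> agree.\<close>

definition twisted :: "complex \<Rightarrow> ('n \<Rightarrow> 'n) \<Rightarrow> ('n \<Rightarrow> complex) \<Rightarrow> bool" where
  "twisted \<zeta> g t \<longleftrightarrow> (\<forall>x. t x = \<zeta> * t (g x)) \<and> (\<forall>x. t x \<in> circle)"

definition cycle_value :: "complex \<Rightarrow> ('n \<Rightarrow> complex) \<Rightarrow> 'n set \<Rightarrow> complex" where
  "cycle_value \<zeta> t C = t (SOME x. x \<in> C) ^ root_ord \<zeta>"

definition cycle_values :: "complex \<Rightarrow> ('n::finite \<Rightarrow> 'n) \<Rightarrow> ('n \<Rightarrow> complex) \<Rightarrow> nat \<Rightarrow> complex multiset" where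
  "cycle_values \<zeta> g t m = image_mset (cycle_value \<zeta> t) (mset_set {C \<in> cycles g. card C = m})"

lemma twistedD:
  assumes "twisted \<zeta> g t"
  shows "t x = \<zeta> * t (g x)" "t x \<in> circle" "t x \<noteq> 0"
proof -
  have *: "(\<forall>x. t x = \<zeta> * t (g x)) \<and> (\<forall>x. t x \<in> circle)" using assms unfolding twisted_def .
  show "t x = \<zeta> * t (g x)" by (rule conjunct1[OF *, THEN spec])
  show "t x \<in> circle" by (rule conjunct2[OF *, THEN spec])
  then show "t x \<noteq> 0" by (metis dist_self mem_sphere zero_neq_one)
qed

lemma twisted_funpow:
  assumes "twisted \<zeta> g t"
  shows "t x = \<zeta> ^ j * t ((g ^^ j) x)"
proof (induction j)
  case (Suc j)
  also have "t ((g ^^ j) x) = \<zeta> * t ((g ^^ Suc j) x)"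
    using twistedD(1)[OF assms, of "(g ^^ j) x"] by simp
  finally show ?case by (simp only: power_Suc mult_ac)
qed simp

text \<open>Going once round the cycle reproduces the same nonzero entry with the factor
  \<open>\<zeta> ^ card C\<close>.\<close>

lemma twisted_root:
  fixes g :: "'n::finite \<Rightarrow> 'n"
  assumes "bij g" "twisted \<zeta> g t" "C \<in> cycles g"
  shows "\<zeta> ^ card C = 1"
proof -
  obtain x where C: "C = cyc g x" using assms(3) by (auto simp: cycles_def)
  have "(g ^^ card C) x = (g ^^ 0) x" unfolding C cyc_period(2)[OF assms(1)] by simp
  then have "t x = \<zeta> ^ card C * t x" using twisted_funpow[OF assms(2), of x "card C"] by simp
  moreover have "t x \<noteq> 0" using twistedD(3)[OF assms(2)] .
  ultimately show ?thesis by simp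
qed

lemma twisted_root_ord:
  fixes g :: "'n::finite \<Rightarrow> 'n"
  assumes "bij g" "twisted \<zeta> g t"
  shows "root_ord \<zeta> > 0" "\<zeta> ^ root_ord \<zeta> = 1" "C \<in> cycles g \<Longrightarrow> root_ord \<zeta> dvd card C"
proof -
  have *: "card (cyc g undefined) > 0" "\<zeta> ^ card (cyc g undefined) = 1"
    by (rule cyc_period(1)[OF assms(1)], rule twisted_root[OF assms cyc_in_cycles])
  show "root_ord \<zeta> > 0" "\<zeta> ^ root_ord \<zeta> = 1" by (rule root_ord_pos[OF *])+
  show "root_ord \<zeta> dvd card C" if "C \<in> cycles g"
    by (rule power_eq_1_iff_root_ord_dvd[OF *, THEN iffD1]) (rule twisted_root[OF assms that])
qed

lemma cycle_value_eq:
  fixes g :: "'n::finite \<Rightarrow> 'n"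
  assumes g: "bij g" and t: "twisted \<zeta> g t" and C: "C \<in> cycles g" and x: "x \<in> C"
  shows "cycle_value \<zeta> t C = t x ^ root_ord \<zeta>"
proof -
  let ?y = "SOME x. x \<in> C"
  have "?y \<in> C" using x by (rule someI)
  then have "?y \<in> cyc g x" using cycles_eq_cyc[OF g C x] by simp
  then obtain j where y: "?y = (g ^^ j) x" by (auto simp: cyc_def)
  have "t x ^ root_ord \<zeta> = (\<zeta> ^ j * t ?y) ^ root_ord \<zeta>"
    using twisted_funpow[OF t, of x j] y by metis
  also have "\<dots> = (\<zeta> ^ root_ord \<zeta>) ^ j * t ?y ^ root_ord \<zeta>"
    by (simp add: power_mult_distrib mult.commute flip: power_mult)
  finally show ?thesis by (simp add: cycle_value_def twisted_root_ord(2)[OF g t])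
qed

lemma cycle_value_circle: "twisted \<zeta> g t \<Longrightarrow> cycle_value \<zeta> t C \<in> circle"
  using twistedD(2)[of \<zeta> g t "SOME x. x \<in> C"] by (simp add: cycle_value_def norm_power)

text \<open>Multiplying the entry \<open>t ((g ^^ j) x)\<close> by \<open>\<zeta> ^ j\<close> always
  gives \<open>t x\<close>. So the product over a cycle, corrected by these factors, is
  \<open>t x ^ card C\<close>, which is a power of the cycle value. This translates the determinant
  condition into a monomial condition.\<close>

lemma prod_twisted:
  fixes g :: "'n::finite \<Rightarrow> 'n"
  assumes g: "bij g" and t: "twisted \<zeta> g t"
  shows "(\<Prod>C\<in>cycles g. cycle_value \<zeta> t C ^ (card C div root_ord \<zeta>)) =
    (\<Prod>x\<in>UNIV. t x) * (\<Prod>C\<in>cycles g. \<zeta> ^ (\<Sum>{..<card C}))"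
proof -
  have "cycle_value \<zeta> t C ^ (card C div root_ord \<zeta>) = (\<Prod>x\<in>C. t x) * \<zeta> ^ (\<Sum>{..<card C})"
    if C: "C \<in> cycles g" for C
  proof -
    obtain x where x: "C = cyc g x" using C by (auto simp: cycles_def)
    have "cycle_value \<zeta> t C ^ (card C div root_ord \<zeta>) = t x ^ card C"
      using cycle_value_eq[OF g t C, of x] self_in_cyc[of x g] twisted_root_ord(3)[OF g t C]
      by (simp add: x flip: power_mult)
    moreover have "(\<Prod>x\<in>C. t x) = (\<Prod>j<card C. t ((g ^^ j) x))"
      using prod.reindex[OF cyc_period(4)[OF g, of x], of t] cyc_period(3)[OF g, of x] by (simp add: x)
    then have "(\<Prod>x\<in>C. t x) * \<zeta> ^ (\<Sum>{..<card C}) = (\<Prod>j<card C. \<zeta> ^ j * t ((g ^^ j) x))"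
      by (simp add: prod.distrib power_sum mult.commute)
    then have "(\<Prod>x\<in>C. t x) * \<zeta> ^ (\<Sum>{..<card C}) = t x ^ card C"
      using twisted_funpow[OF t, of x, symmetric] by simp
    ultimately show ?thesis by simp
  qed
  then show ?thesis by (simp add: prod_cycles[OF g] prod.distrib)
qed

text \<open>The invariance half of the classification of orbits. The number \<open>\<zeta>\<close>
  is the ratio of neighbouring entries on a cycle, which neither a relabelling nor a common factor
  \<open>\<eta>\<close> can change.\<close>

lemma cycle_values_conj:
  fixes g g' \<alpha> :: "'n::finite \<Rightarrow> 'n"
  assumes g: "bij g" "bij g'" and t: "twisted \<zeta> g t" "twisted \<zeta>' g' t'" and \<alpha>: "bij \<alpha>"
    and conj: "\<And>x. g' (\<alpha> x) = \<alpha> (g x)" and rot: "\<And>x. t' (\<alpha> x) = \<eta> * t x"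
  shows "\<zeta>' = \<zeta>" "cycle_type g' = cycle_type g"
    "cycle_values \<zeta> g' t' m = image_mset ((*) (\<eta> ^ root_ord \<zeta>)) (cycle_values \<zeta> g t m)"
proof -
  have nz: "t x \<noteq> 0" "t' x \<noteq> 0" for x
    by (rule twistedD(3)[OF t(1)], rule twistedD(3)[OF t(2)])
  have "\<eta> * t x = \<zeta>' * (\<eta> * t (g x))" for x
    using twistedD(1)[OF t(2), of "\<alpha> x"] by (simp only: rot conj)
  then have "\<zeta>' * (\<eta> * t (g x)) = \<zeta> * (\<eta> * t (g x))" for x
    using twistedD(1)[OF t(1), of x] by (metis mult.left_commute)
  moreover have "\<eta> * t (g x) \<noteq> 0" for x using rot nz(2) by metis
  ultimately show z: "\<zeta>' = \<zeta>" by (metis mult_right_cancel)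
  have pow: "(g' ^^ j) (\<alpha> x) = \<alpha> ((g ^^ j) x)" for j x
    by (induction j) (simp_all add: conj)
  have cyc: "cyc g' (\<alpha> x) = \<alpha> ` cyc g x" for x
    unfolding cyc_def by (auto simp: pow)
  have cycles: "cycles g' = (`) \<alpha> ` cycles g"
  proof (intro equalityI subsetI)
    fix C assume "C \<in> cycles g'"
    then obtain y where "C = cyc g' y" by (auto simp: cycles_def)
    moreover obtain x where "y = \<alpha> x" using bij_is_surj[OF \<alpha>] by (metis surjD)
    ultimately show "C \<in> (`) \<alpha> ` cycles g" using cyc cyc_in_cycles by (metis imageI)
  next
    fix C assume "C \<in> (`) \<alpha> ` cycles g"
    then obtain x where "C = \<alpha> ` cyc g x" by (auto simp: cycles_def)
    then show "C \<in> cycles g'" by (metis cyc cyc_in_cycles)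
  qed
  have inj: "inj_on ((`) \<alpha>) A" for A
    using bij_is_inj[OF \<alpha>] by (auto simp: inj_on_def inj_image_eq_iff)
  have card: "card (\<alpha> ` C) = card C" for C
    using bij_is_inj[OF \<alpha>] by (simp add: card_image inj_on_subset)
  show "cycle_type g' = cycle_type g"
    unfolding cycle_type_def cycles
    by (simp add: image_mset_mset_set[OF inj, symmetric] image_mset.compositionality comp_def card)
  have "{C \<in> cycles g'. card C = m} = (`) \<alpha> ` {C \<in> cycles g. card C = m}"
    unfolding cycles using card by auto
  then have "cycle_values \<zeta> g' t' m =
      image_mset (\<lambda>C. cycle_value \<zeta> t' (\<alpha> ` C)) (mset_set {C \<in> cycles g. card C = m})"
    by (simp add: cycle_values_def image_mset_mset_set[OF inj, symmetric] image_mset.compositionality comp_def)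
  also have "\<dots> = image_mset (\<lambda>C. \<eta> ^ root_ord \<zeta> * cycle_value \<zeta> t C) (mset_set {C \<in> cycles g. card C = m})"
  proof (rule image_mset_cong)
    fix C assume "C \<in># mset_set {C \<in> cycles g. card C = m}"
    then have C: "C \<in> cycles g" by simp
    then obtain x where x: "C = cyc g x" by (auto simp: cycles_def)
    have C': "\<alpha> ` C \<in> cycles g'" using C cycles by blast
    have in': "\<alpha> x \<in> \<alpha> ` C" "x \<in> C" using self_in_cyc[of x g] x by auto
    show "cycle_value \<zeta> t' (\<alpha> ` C) = \<eta> ^ root_ord \<zeta> * cycle_value \<zeta> t C"
      using cycle_value_eq[OF g(2) t(2) C' in'(1)] cycle_value_eq[OF g(1) t(1) C in'(2)] z
      by (simp add: rot power_mult_distrib)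
  qed
  finally show "cycle_values \<zeta> g' t' m = image_mset ((*) (\<eta> ^ root_ord \<zeta>)) (cycle_values \<zeta> g t m)"
    by (simp add: cycle_values_def image_mset.compositionality comp_def)
qed

lemma image_mset_eq_ex_bij:
  assumes fin: "finite A" "finite B" and eq: "image_mset f (mset_set A) = image_mset f' (mset_set B)"
  shows "\<exists>\<beta>. bij_betw \<beta> A B \<and> (\<forall>a\<in>A. f' (\<beta> a) = f a)"
proof -
  have "card A = card B" using arg_cong[OF eq, of size] by simp
  then obtain h where h: "bij_betw h A B" using finite_same_card_bij fin by blast
  have "mset_set B = image_mset h (mset_set A)"
    using h image_mset_mset_set[of h A] by (auto simp: bij_betw_def)
  then have "image_mset f (mset_set A) = image_mset (f' \<circ> h) (mset_set A)"
    using eq by (simp add: image_mset.compositionality)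
  then obtain p where p: "p permutes A" "\<forall>x\<in>A. f x = (f' \<circ> h) (p x)"
    using image_mset_eq_implies_permutes[OF fin(1)] by blast
  have "bij_betw (h \<circ> p) A B"
    using permutes_imp_bij[OF p(1)] h by (rule bij_betw_trans)
  then show ?thesis using p(2) by (intro exI[of _ "h \<circ> p"]) simp
qed

text \<open>The converse half. Cycles are paired by length and value. In the target cycle a point is
  chosen whose entry is exactly \<open>\<eta>\<close> times the entry at the base point of the
  source cycle: numbers with equal \<open>root_ord \<zeta>\<close>-th powers differ by a power of
  \<open>\<zeta>\<close>, and walking along a cycle supplies these powers. Pairing the base points
  determines a map that commutes with the permutations.\<close>

lemma ex_conj_of_cycle_values:
  fixes g g' :: "'n::finite \<Rightarrow> 'n"
  assumes g: "bij g" "bij g'" and t: "twisted \<zeta> g t" "twisted \<zeta> g' t'" and \<eta>: "norm \<eta> = 1"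
    and vals: "\<And>m. cycle_values \<zeta> g' t' m = image_mset ((*) (\<eta> ^ root_ord \<zeta>)) (cycle_values \<zeta> g t m)"
  obtains \<alpha> where "bij \<alpha>" "\<And>x. g' (\<alpha> x) = \<alpha> (g x)" "\<And>x. t' (\<alpha> x) = \<eta> * t x"
proof -
  let ?d = "root_ord \<zeta>"
  have nz: "t x \<noteq> 0" "t' x \<noteq> 0" for x
    by (rule twistedD(3)[OF t(1)], rule twistedD(3)[OF t(2)])
  \<comment> \<open>Tagging each value with the length of its cycle merges the equalities for all
    \<open>m\<close> into a single one, hence into one bijection of cycles.\<close>
  have "image_mset (\<lambda>C. (card C, \<eta> ^ ?d * cycle_value \<zeta> t C)) (mset_set (cycles g))
      = image_mset (\<lambda>C. (card C, cycle_value \<zeta> t' C)) (mset_set (cycles g'))"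
  proof (rule multiset_eqI)
    fix mv :: "nat \<times> complex"
    obtain m v where mv: "mv = (m, v)" by (cases mv)
    have "count (cycle_values \<zeta> g' t' m) v = card {C \<in> cycles g'. (card C, cycle_value \<zeta> t' C) = mv}"
      by (simp add: cycle_values_def count_image_mset_eq_card_vimage mv conj_assoc)
    moreover have "image_mset ((*) (\<eta> ^ ?d)) (cycle_values \<zeta> g t m) =
        image_mset (\<lambda>C. \<eta> ^ ?d * cycle_value \<zeta> t C) (mset_set {C \<in> cycles g. card C = m})"
      by (simp add: cycle_values_def image_mset.compositionality comp_def)
    then have "count (image_mset ((*) (\<eta> ^ ?d)) (cycle_values \<zeta> g t m)) v
        = card {C \<in> cycles g. (card C, \<eta> ^ ?d * cycle_value \<zeta> t C) = mv}"
      by (simp add: count_image_mset_eq_card_vimage mv conj_assoc)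
    ultimately show "count (image_mset (\<lambda>C. (card C, \<eta> ^ ?d * cycle_value \<zeta> t C)) (mset_set (cycles g))) mv
      = count (image_mset (\<lambda>C. (card C, cycle_value \<zeta> t' C)) (mset_set (cycles g'))) mv"
      using vals by (simp add: count_image_mset_eq_card_vimage)
  qed
  from image_mset_eq_ex_bij[OF finite_cycles finite_cycles this]
  obtain \<beta> where \<beta>: "bij_betw \<beta> (cycles g) (cycles g')"
    "\<And>C. C \<in> cycles g \<Longrightarrow> (card (\<beta> C), cycle_value \<zeta> t' (\<beta> C)) = (card C, \<eta> ^ ?d * cycle_value \<zeta> t C)"
    by blast
  then have \<beta>in: "\<beta> C \<in> cycles g'" if "C \<in> cycles g" for C
    using that by (auto simp: bij_betw_def)
  define b where "b = (\<lambda>C::'n set. SOME x. x \<in> C)"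
  have b: "b C \<in> C" "C = cyc g (b C)" if "C \<in> cycles g" for C
  proof -
    show "b C \<in> C" using that self_in_cyc unfolding b_def cycles_def by (metis imageE someI)
    then show "C = cyc g (b C)" using cycles_eq_cyc[OF g(1) that] by blast
  qed
  have "\<exists>y. y \<in> \<beta> C \<and> t' y = \<eta> * t (b C)" if C: "C \<in> cycles g" for C
  proof -
    obtain y where y: "\<beta> C = cyc g' y" using \<beta>in[OF C] by (auto simp: cycles_def)
    have "t' y ^ ?d = (\<eta> * t (b C)) ^ ?d"
      using \<beta>(2)[OF C] cycle_value_eq[OF g(1) t(1) C b(1)[OF C]]
        cycle_value_eq[OF g(2) t(2) \<beta>in[OF C], of y] self_in_cyc[of y g'] y
      by (simp add: power_mult_distrib)
    then have "(t' y / (\<eta> * t (b C))) ^ ?d = 1"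
      using nz \<eta> by (auto simp: power_divide)
    then obtain j where j: "t' y / (\<eta> * t (b C)) = \<zeta> ^ j"
      using ex_root_ord_power[OF twisted_root_ord(1,2)[OF g(1) t(1)]] by blast
    have "\<zeta> ^ j * t' ((g' ^^ j) y) = t' y" using twisted_funpow[OF t(2)] by simp
    also have "t' y = \<zeta> ^ j * (\<eta> * t (b C))"
    proof -
      have "\<eta> * t (b C) \<noteq> 0" using nz(1)[of "b C"] \<eta> by auto
      from nonzero_divide_eq_eq[OF this] show ?thesis using j by metis
    qed
    finally have *: "\<zeta> ^ j * t' ((g' ^^ j) y) = \<zeta> ^ j * (\<eta> * t (b C))" .
    have "t' ((g' ^^ j) y) = \<eta> * t (b C)"
    proof -
      have "\<zeta> ^ j \<noteq> 0" using j nz \<eta> by (metis divide_eq_0_iff mult_eq_0_iff norm_zero zero_neq_one)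
      then show ?thesis using * by (metis mult_left_cancel)
    qed
    then show ?thesis using y funpow_in_cyc by metis
  qed
  then have "\<forall>C\<in>cycles g. \<exists>y. y \<in> \<beta> C \<and> t' y = \<eta> * t (b C)" by blast
  then obtain b' where b': "\<forall>C\<in>cycles g. b' C \<in> \<beta> C \<and> t' (b' C) = \<eta> * t (b C)"
    by (rule bchoice[THEN exE])
  have b'cyc: "\<beta> C = cyc g' (b' C)" if "C \<in> cycles g" for C
    using cycles_eq_cyc[OF g(2) \<beta>in[OF that]] b' that by blast
  \<comment> \<open>The index is determined only modulo the cycle length. Paired cycles have equal
    length, so \<open>\<alpha>\<close> does not depend on the choice.\<close>
  define idx where "idx = (\<lambda>x. SOME j. (g ^^ j) (b (cyc g x)) = x)"
  define \<alpha> where "\<alpha> = (\<lambda>x. (g' ^^ idx x) (b' (cyc g x)))"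
  have \<alpha>: "\<alpha> ((g ^^ j) (b C)) = (g' ^^ j) (b' C)" if C: "C \<in> cycles g" for j C
  proof -
    let ?x = "(g ^^ j) (b C)"
    have "cyc g ?x = cyc g (b C)" using cyc_eq[OF g(1) funpow_in_cyc] .
    then have cx: "cyc g ?x = C" using b(2)[OF C] by simp
    have "(g ^^ idx ?x) (b (cyc g ?x)) = ?x"
      unfolding idx_def by (rule someI[of _ j]) (simp only: cx)
    then have "(g ^^ idx ?x) (b C) = (g ^^ j) (b C)" by (simp only: cx)
    then have "idx ?x mod card C = j mod card C"
      unfolding cyc_period(2)[OF g(1)] using b(2)[OF C] by simp
    moreover have "card (cyc g' (b' C)) = card C" using \<beta>(2)[OF C] b'cyc[OF C] by simp
    ultimately have "(g' ^^ idx ?x) (b' C) = (g' ^^ j) (b' C)"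
      unfolding cyc_period(2)[OF g(2)] by simp
    then show ?thesis by (simp only: \<alpha>_def cx)
  qed
  have ex: "\<exists>C\<in>cycles g. \<exists>j. x = (g ^^ j) (b C)" for x
  proof -
    have "x \<in> cyc g (b (cyc g x))" using b(2)[OF cyc_in_cycles] self_in_cyc by metis
    moreover have "\<exists>j. x = (g ^^ j) y" if "x \<in> cyc g y" for y using that by (auto simp: cyc_def)
    ultimately have "\<exists>j. x = (g ^^ j) (b (cyc g x))" by blast
    then show ?thesis using cyc_in_cycles by (rule bexI)
  qed
  have "inj \<alpha>"
  proof (rule injI)
    fix x x' assume eq: "\<alpha> x = \<alpha> x'"
    obtain C j where C: "C \<in> cycles g" "x = (g ^^ j) (b C)" using ex by blast
    obtain C' j' where C': "C' \<in> cycles g" "x' = (g ^^ j') (b C')" using ex by blast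
    have eq': "(g' ^^ j) (b' C) = (g' ^^ j') (b' C')" using eq \<alpha> C C' by simp
    then have "\<beta> C = \<beta> C'"
      using b'cyc C(1) C'(1) cyc_eq[OF g(2) funpow_in_cyc] by metis
    then have CC: "C = C'" using \<beta>(1) C(1) C'(1) by (auto simp: bij_betw_def inj_on_def)
    then have "j mod card (\<beta> C) = j' mod card (\<beta> C)"
      using eq' cyc_period(2)[OF g(2)] b'cyc[OF C(1)] by simp
    then have "j mod card C = j' mod card C" using \<beta>(2)[OF C(1)] by simp
    then have "(g ^^ j) (b C) = (g ^^ j') (b C)"
      unfolding cyc_period(2)[OF g(1)] using b(2)[OF C(1)] by simp
    then show "x = x'" using C C' CC by simp
  qed
  then have "bij \<alpha>" by (simp add: bij_def finite_UNIV_inj_surj)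
  moreover have "g' (\<alpha> x) = \<alpha> (g x)" for x
  proof -
    obtain C j where C: "C \<in> cycles g" "x = (g ^^ j) (b C)" using ex by blast
    then show ?thesis using \<alpha>[OF C(1), of j] \<alpha>[OF C(1), of "Suc j"] by simp
  qed
  moreover have "t' (\<alpha> x) = \<eta> * t x" for x
  proof -
    obtain C j where C: "C \<in> cycles g" "x = (g ^^ j) (b C)" using ex by blast
    have "\<zeta> ^ j * t' (\<alpha> x) = t' (b' C)"
      using twisted_funpow[OF t(2), of "b' C" j] \<alpha>[OF C(1), of j] C by simp
    also have "\<dots> = \<eta> * t (b C)" using b' C by blast
    also have "\<dots> = \<zeta> ^ j * (\<eta> * t x)"
      using twisted_funpow[OF t(1), of "b C" j] C by simp
    finally have "\<zeta> ^ j * t' (\<alpha> x) = \<zeta> ^ j * (\<eta> * t x)" .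
    moreover have "\<zeta> \<noteq> 0" by (metis twistedD(1,3)[OF t(1)] mult_zero_left)
    ultimately show ?thesis by simp
  qed
  ultimately show ?thesis using that by blast
qed

lemma count_image_mset_Pair: "count (image_mset (Pair a) A) (b, x) = (if a = b then count A x else 0)"
  by (induction A) auto

text \<open>Each pair of a part \<open>m\<close> and a value from \<open>U m\<close> becomes one
  cycle of \<open>m\<close> positions. The positions form a dependent sum with
  \<open>sum_mset \<mu>\<close> points, which is identified with the index type.\<close>

lemma ex_twisted_with_values:
  assumes \<mu>: "\<mu> \<in> partitions CARD('n::finite)" and \<zeta>: "\<And>m. m \<in># \<mu> \<Longrightarrow> \<zeta> ^ m = 1"
    and size: "\<And>m. size (U m) = count \<mu> m" and U: "\<And>m. set_mset (U m) \<subseteq> circle"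
  shows "\<exists>(g :: 'n \<Rightarrow> 'n) t. bij g \<and> twisted \<zeta> g t \<and> cycle_type g = \<mu> \<and> (\<forall>m. cycle_values \<zeta> g t m = U m)"
proof -
  have \<mu>pos: "m > 0" if "m \<in># \<mu>" for m using \<mu> that by (auto simp: partitions_def)
  have sum\<mu>: "sum_mset \<mu> = CARD('n)" using \<mu> by (simp add: partitions_def)
  then have "\<mu> \<noteq> {#}" by auto
  then obtain m0 where m0: "m0 \<in># \<mu>" by blast
  note ord = root_ord_pos[OF \<mu>pos[OF m0] \<zeta>[OF m0]]
  have norm\<zeta>: "norm \<zeta> = 1" using \<zeta>[OF m0] \<mu>pos[OF m0] by (rule norm_eq_1_if_power)
  define M where "M = (\<Sum>m\<in>set_mset \<mu>. image_mset (Pair m) (U m))"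
  have countM: "count M (m, v) = count (U m) v" for m v
  proof -
    have "count (image_mset (Pair m') (U m')) (m, v) = (if m' = m then count (U m) v else 0)" for m'
      by (simp add: count_image_mset_Pair)
    then have "count M (m, v) = (\<Sum>m'\<in>set_mset \<mu>. if m' = m then count (U m) v else 0)"
      by (simp add: M_def count_sum)
    also have "\<dots> = (if m \<in># \<mu> then count (U m) v else 0)" by simp
    also have "\<dots> = count (U m) v"
    proof (cases "m \<in># \<mu>")
      case False
      then have "U m = {#}" using size[of m] by (simp add: not_in_iff)
      then show ?thesis by simp
    qed simp
    finally show ?thesis .
  qed
  have filterM: "filter_mset (\<lambda>q. fst q = m) M = image_mset (Pair m) (U m)" for m
  proof (rule multiset_eqI)
    fix q :: "nat \<times> complex"
    obtain a v where q: "q = (a, v)" by (cases q)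
    show "count (filter_mset (\<lambda>q. fst q = m) M) q = count (image_mset (Pair m) (U m)) q"
      by (simp add: q countM count_image_mset_Pair)
  qed
  have fstM: "image_mset fst M = \<mu>"
  proof (rule multiset_eqI)
    fix m
    have "replicate_mset (count (image_mset fst M) m) m = image_mset fst (filter_mset (\<lambda>q. fst q = m) M)"
      by (simp add: filter_mset_image_mset flip: filter_eq_replicate_mset)
    then have "size (replicate_mset (count (image_mset fst M) m) m) = count \<mu> m"
      using size by (simp add: filterM)
    then show "count (image_mset fst M) m = count \<mu> m" by simp
  qed
  obtain ps where ps: "mset ps = M" using ex_mset by blast
  define N where "N = length ps"
  define mm where "mm = (\<lambda>i. fst (ps ! i))"
  define uu where "uu = (\<lambda>i. snd (ps ! i))"
  have M: "M = image_mset (\<lambda>i. (mm i, uu i)) (mset_set {..<N})"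
  proof -
    have "mset ps = mset (map ((!) ps) [0..<N])" by (simp add: N_def map_nth)
    also have "\<dots> = image_mset ((!) ps) (mset_set {..<N})" by (simp add: atLeast0LessThan)
    finally show ?thesis by (simp add: ps mm_def uu_def)
  qed
  have in\<mu>: "mm i \<in># \<mu>" if "i < N" for i
  proof -
    have "(mm i, uu i) \<in># M" using that unfolding M by auto
    then have "fst (mm i, uu i) \<in># image_mset fst M" unfolding set_image_mset by (rule imageI)
    then show ?thesis by (simp add: fstM)
  qed
  have mpos: "mm i > 0" "\<zeta> ^ mm i = 1" if "i < N" for i using in\<mu>[OF that] \<mu>pos \<zeta> by auto
  have "\<exists>v. v \<in> circle \<and> v ^ root_ord \<zeta> = uu i" if "i < N" for i
  proof -
    have "(mm i, uu i) \<in># M" using that unfolding M by auto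
    then have "uu i \<in># U (mm i)" unfolding count_greater_zero_iff[symmetric] countM .
    then have "uu i \<in> circle" using U by blast
    then show ?thesis using circle_power_root ord(1) by metis
  qed
  then have "\<forall>i\<in>{..<N}. \<exists>v. v \<in> circle \<and> v ^ root_ord \<zeta> = uu i" by blast
  then obtain vv where vv: "\<forall>i\<in>{..<N}. vv i \<in> circle \<and> vv i ^ root_ord \<zeta> = uu i"
    by (rule bchoice[THEN exE])
  define X where "X = (SIGMA i:{..<N}. {..<mm i})"
  have X: "(i, j) \<in> X \<longleftrightarrow> i < N \<and> j < mm i" for i j by (auto simp: X_def)
  have "card X = (\<Sum>i<N. mm i)" by (simp add: X_def)
  also have "\<dots> = sum_mset (image_mset fst M)"
    unfolding M sum_unfold_sum_mset by (simp add: image_mset.compositionality comp_def)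
  finally have "card X = CARD('n)" by (simp add: fstM sum\<mu>)
  moreover have "finite X" by (simp add: X_def)
  ultimately obtain h where h: "bij_betw h X (UNIV :: 'n set)"
    using finite_same_card_bij[of X "UNIV :: 'n set"] by auto
  define k where "k = inv_into X h"
  have kh: "k (h x) = x" if "x \<in> X" for x
    using that bij_betw_inv_into_left[OF h] by (simp add: k_def)
  have hk: "h (k y) = y" "k y \<in> X" for y
    using bij_betw_inv_into_right[OF h] bij_betw_inv_into[OF h] by (auto simp: k_def bij_betw_def)
  have hX: "\<exists>i j. i < N \<and> j < mm i \<and> y = h (i, j)" for y
    using hk[of y] X by (metis surj_pair)
  define rot where "rot = (\<lambda>(i, j). (i, Suc j mod mm i))"
  define g where "g = (\<lambda>y. h (rot (k y)))"
  \<comment> \<open>Each step along a cycle removes one factor \<open>\<zeta>\<close>. The exponent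
    \<open>mm i - j\<close> stays natural; because \<open>\<zeta> ^ mm i = 1\<close>, the entry at
    \<open>j = 0\<close> is \<open>vv i\<close> and the step from the last position back to the
    first is consistent.\<close>
  define t where "t = (\<lambda>y. (\<lambda>(i, j). vv i * \<zeta> ^ (mm i - j)) (k y))"
  have gh: "g (h (i, j)) = h (i, Suc j mod mm i)" if "i < N" "j < mm i" for i j
    using that kh[of "(i, j)"] by (simp add: g_def rot_def X)
  have th: "t (h (i, j)) = vv i * \<zeta> ^ (mm i - j)" if "i < N" "j < mm i" for i j
    using that kh[of "(i, j)"] by (simp add: t_def X)
  have hinj: "i = i' \<and> j = j'" if "h (i, j) = h (i', j')" "i < N" "j < mm i" "i' < N" "j' < mm i'" for i j i' j'
  proof -
    have "(i, j) \<in> X" "(i', j') \<in> X" using that(2-5) X by simp_all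
    then have "(i, j) = (i', j')" using kh that(1) by metis
    then show ?thesis by simp
  qed
  have "inj g"
  proof (rule injI)
    fix y y' assume eq: "g y = g y'"
    obtain i j where y: "i < N" "j < mm i" "y = h (i, j)" using hX by blast
    obtain i' j' where y': "i' < N" "j' < mm i'" "y' = h (i', j')" using hX by blast
    have "h (i, Suc j mod mm i) = h (i', Suc j' mod mm i')"
      using eq gh[OF y(1,2)] gh[OF y'(1,2)] y(3) y'(3) by metis
    moreover have "Suc j mod mm i < mm i" "Suc j' mod mm i' < mm i'"
      using mpos(1)[OF y(1)] mpos(1)[OF y'(1)] by simp_all
    ultimately have ii: "i = i' \<and> Suc j mod mm i = Suc j' mod mm i'"
      using hinj y(1) y'(1) by blast
    moreover have "j mod mm i = j" "j' mod mm i = j'" using ii y(2) y'(2) by auto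
    ultimately have "i = i' \<and> j = j'" by (auto simp: mod_Suc split: if_splits)
    then show "y = y'" using y(3) y'(3) by simp
  qed
  then have bij: "bij g" by (simp add: bij_def finite_UNIV_inj_surj)
  have tw: "twisted \<zeta> g t"
    unfolding twisted_def
  proof (intro conjI allI)
    fix y
    obtain i j where y: "i < N" "j < mm i" "y = h (i, j)" using hX by blast
    show "t y \<in> circle" using y vv norm\<zeta> by (simp add: th norm_mult norm_power)
    show "t y = \<zeta> * t (g y)"
    proof (cases "Suc j < mm i")
      case True
      then have "mm i - j = Suc (mm i - Suc j)" by simp
      then show ?thesis using y True by (simp add: gh th)
    next
      case False
      then have "mm i = Suc j" using y by simp
      then show ?thesis using y mpos(2)[OF y(1)] by (simp add: gh th)
    qed
  qed
  have pow: "(g ^^ l) (h (i, 0)) = h (i, l mod mm i)" if "i < N" for i l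
  proof (induction l)
    case (Suc l)
    then show ?case using gh[OF that, of "l mod mm i"] mpos(1)[OF that] by (simp add: mod_Suc_eq)
  qed simp
  define Cf where "Cf = (\<lambda>i. cyc g (h (i, 0)))"
  have Cf: "Cf i = (\<lambda>j. h (i, j)) ` {..<mm i}" if "i < N" for i
  proof -
    have "Cf i = range (\<lambda>l. h (i, l mod mm i))" unfolding Cf_def cyc_def using pow[OF that] by simp
    also have "\<dots> = (\<lambda>j. h (i, j)) ` {..<mm i}"
    proof (intro equalityI subsetI)
      fix y assume "y \<in> (\<lambda>j. h (i, j)) ` {..<mm i}"
      then obtain j where "j < mm i" "y = h (i, j)" by auto
      then have "y = h (i, j mod mm i)" by simp
      then show "y \<in> range (\<lambda>l. h (i, l mod mm i))" by blast
    qed (use mpos(1)[OF that] in auto)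
    finally show ?thesis .
  qed
  have cardCf: "card (Cf i) = mm i" if "i < N" for i
  proof -
    have "inj_on (\<lambda>j. h (i, j)) {..<mm i}" using hinj that by (auto simp: inj_on_def)
    then show ?thesis by (simp add: Cf[OF that] card_image)
  qed
  have h0: "h (i, 0) \<in> Cf i" for i unfolding Cf_def by (rule self_in_cyc)
  have injCf: "inj_on Cf {..<N}"
  proof (rule inj_onI)
    fix i i' assume i: "i \<in> {..<N}" "i' \<in> {..<N}" "Cf i = Cf i'"
    then have "h (i, 0) \<in> (\<lambda>j. h (i', j)) ` {..<mm i'}" using h0[of i] Cf by auto
    then obtain j where "j < mm i'" "h (i, 0) = h (i', j)" by auto
    then show "i = i'" using hinj[of i 0 i' j] i mpos by auto
  qed
  have cycles: "cycles g = Cf ` {..<N}"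
  proof (intro equalityI subsetI)
    fix C assume "C \<in> cycles g"
    then obtain y where C: "C = cyc g y" by (auto simp: cycles_def)
    obtain i j where y: "i < N" "j < mm i" "y = h (i, j)" using hX by blast
    then have "y \<in> Cf i" by (auto simp: Cf)
    then have "C = Cf i" unfolding C Cf_def by (rule cyc_eq[OF bij])
    then show "C \<in> Cf ` {..<N}" using y by blast
  qed (auto simp: Cf_def cyc_in_cycles)
  have val: "cycle_value \<zeta> t (Cf i) = uu i" if "i < N" for i
  proof -
    have "Cf i \<in> cycles g" unfolding Cf_def by (rule cyc_in_cycles)
    then have "cycle_value \<zeta> t (Cf i) = t (h (i, 0)) ^ root_ord \<zeta>"
      using cycle_value_eq[OF bij tw] h0 by blast
    also have "\<dots> = uu i" using that vv th[of i 0] mpos[OF that] by simp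
    finally show ?thesis .
  qed
  have "cycle_type g = image_mset card (image_mset Cf (mset_set {..<N}))"
    unfolding cycle_type_def cycles image_mset_mset_set[OF injCf] ..
  also have "\<dots> = image_mset mm (mset_set {..<N})"
    unfolding image_mset.compositionality by (rule image_mset_cong) (simp add: cardCf)
  also have "\<dots> = image_mset fst M" unfolding M by (simp add: image_mset.compositionality comp_def)
  finally have "cycle_type g = \<mu>" by (simp add: fstM)
  moreover have "cycle_values \<zeta> g t m = U m" for m
  proof -
    have "{C \<in> cycles g. card C = m} = Cf ` {i \<in> {..<N}. mm i = m}"
      unfolding cycles using cardCf by auto
    moreover have "inj_on Cf {i \<in> {..<N}. mm i = m}" using injCf by (rule inj_on_subset) auto
    ultimately have "cycle_values \<zeta> g t m = image_mset (\<lambda>i. cycle_value \<zeta> t (Cf i)) (mset_set {i \<in> {..<N}. mm i = m})"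
      by (simp add: cycle_values_def image_mset_mset_set[symmetric] image_mset.compositionality comp_def)
    also have "\<dots> = image_mset uu (mset_set {i \<in> {..<N}. mm i = m})"
      by (rule image_mset_cong) (simp add: val)
    also have "\<dots> = image_mset snd (filter_mset (\<lambda>q. fst q = m) M)"
      unfolding M filter_mset_image_mset by (simp add: image_mset.compositionality comp_def)
    also have "\<dots> = U m" by (simp add: filterM image_mset.compositionality comp_def)
    finally show ?thesis .
  qed
  ultimately show ?thesis using bij tw by blast
qed

section \<open>The inertia space of the Weyl group\<close>

lemma open_map_discrete_prod:
  assumes f: "open_map X Y f"
  shows "open_map (prod_topology (discrete_topology B) X) (prod_topology (discrete_topology B) Y) (\<lambda>(b, x). (b, f x))"
  unfolding open_map_def
proof (intro allI impI)
  fix U assume U: "openin (prod_topology (discrete_topology B) X) U"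
  have sub: "U \<subseteq> B \<times> topspace X" using openin_subset[OF U] by simp
  have "openin X {x \<in> topspace X. (b, x) \<in> U}" if "b \<in> B" for b
    by (rule openin_continuous_map_preimage[OF _ U]) (simp add: continuous_map_pairwise comp_def that)
  then have "openin Y (f ` {x \<in> topspace X. (b, x) \<in> U})" if "b \<in> B" for b
    using f that unfolding open_map_def by blast
  then have "openin (prod_topology (discrete_topology B) Y) (\<Union>b\<in>B. {b} \<times> f ` {x \<in> topspace X. (b, x) \<in> U})"
    by (intro openin_Union) (auto simp: openin_prod_Times_iff)
  moreover have "(\<lambda>(b, x). (b, f x)) ` U = (\<Union>b\<in>B. {b} \<times> f ` {x \<in> topspace X. (b, x) \<in> U})"
    (is "?L = ?R")
  proof (intro equalityI subsetI)
    fix w assume "w \<in> ?L"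
    then obtain b x where "(b, x) \<in> U" "w = (b, f x)" by auto
    then show "w \<in> ?R" using sub by auto
  next
    fix w assume "w \<in> ?R"
    then obtain b x where "(b, x) \<in> U" "w = (b, f x)" by auto
    then show "w \<in> ?L" by (intro image_eqI[of _ _ "(b, x)"]) auto
  qed
  ultimately show "openin (prod_topology (discrete_topology B) Y) ((\<lambda>(b, x). (b, f x)) ` U)" by simp
qed

section \<open>Diagonal matrices, central cosets and conjugation by permutations\<close>

abbreviation diag :: "complex^'n^'n \<Rightarrow> 'n \<Rightarrow> complex" where
  "diag A \<equiv> \<lambda>i. A $ i $ i"

lemma torus_iff:
  "A \<in> torus \<longleftrightarrow> (\<forall>i j. i \<noteq> j \<longrightarrow> A $ i $ j = 0) \<and> (\<forall>i. norm (A $ i $ i) = 1) \<and> (\<Prod>i\<in>UNIV. A $ i $ i) = 1"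
proof (cases "\<forall>i j. i \<noteq> j \<longrightarrow> A $ i $ j = 0")
  case True
  have entry: "(A ** conj_transpose A) $ i $ j = (if i = j then A $ i $ i * cnj (A $ i $ i) else 0)"
    "(conj_transpose A ** A) $ i $ j = (if i = j then A $ i $ i * cnj (A $ i $ i) else 0)" for i j
  proof -
    have "(A ** conj_transpose A) $ i $ j = (\<Sum>l\<in>UNIV. A $ i $ l * cnj (A $ j $ l))"
      by (simp add: matrix_matrix_mult_def conj_transpose_def)
    also have "\<dots> = (\<Sum>l\<in>{i}. A $ i $ l * cnj (A $ j $ l))"
      using True by (intro sum.mono_neutral_right) auto
    finally show "(A ** conj_transpose A) $ i $ j = (if i = j then A $ i $ i * cnj (A $ i $ i) else 0)"
      using True by auto
    have "(conj_transpose A ** A) $ i $ j = (\<Sum>l\<in>UNIV. cnj (A $ l $ i) * A $ l $ j)"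
      by (simp add: matrix_matrix_mult_def conj_transpose_def)
    also have "\<dots> = (\<Sum>l\<in>{i}. cnj (A $ l $ i) * A $ l $ j)"
      using True by (intro sum.mono_neutral_right) auto
    finally show "(conj_transpose A ** A) $ i $ j = (if i = j then A $ i $ i * cnj (A $ i $ i) else 0)"
      using True by auto
  qed
  have unit: "z * cnj z = 1 \<longleftrightarrow> norm z = 1" for z :: complex
  proof -
    have "z * cnj z = of_real ((norm z)\<^sup>2)" by (simp only: complex_norm_square)
    then show ?thesis by (metis norm_ge_zero of_real_1 of_real_eq_iff one_power2 power2_eq_imp_eq zero_le_one)
  qed
  have "A ** conj_transpose A = mat 1 \<longleftrightarrow> (\<forall>i. norm (A $ i $ i) = 1)"
    "conj_transpose A ** A = mat 1 \<longleftrightarrow> (\<forall>i. norm (A $ i $ i) = 1)"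
    unfolding vec_eq_iff entry by (auto simp: mat_def unit)
  moreover have "det A = (\<Prod>i\<in>UNIV. A $ i $ i)" using True by (intro det_diagonal) auto
  ultimately show ?thesis using True by (auto simp: torus_def SU_def)
qed (auto simp: torus_def)

lemma diag_inj: "A \<in> torus \<Longrightarrow> B \<in> torus \<Longrightarrow> diag A = diag B \<Longrightarrow> A = B"
proof -
  assume "A \<in> torus" "B \<in> torus" "diag A = diag B"
  then have "A $ i $ j = B $ i $ j" for i j
    by (cases "i = j") (auto simp: torus_iff dest: fun_cong[of _ _ i])
  then show "A = B" by (simp add: vec_eq_iff)
qed

lemma ex_torus_diag:
  fixes t :: "'n::finite \<Rightarrow> complex"
  assumes "\<And>i. norm (t i) = 1" "(\<Prod>i\<in>UNIV. t i) = 1"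
  obtains A where "A \<in> torus" "diag A = t"
  using assms that[of "\<chi> i j. if i = j then t i else 0"] by (auto simp: torus_iff)

lemma compact_torus: "compact (torus :: (complex^'n::finite^'n) set)"
proof -
  have "closed (torus :: (complex^'n^'n) set)"
  proof -
    have eq: "(torus :: (complex^'n^'n) set) =
        {A. (\<forall>i j. i \<noteq> j \<longrightarrow> A $ i $ j = 0) \<and> (\<forall>i. norm (A $ i $ i) = 1) \<and> (\<Prod>i\<in>UNIV. A $ i $ i) = 1}"
      using torus_iff by blast
    show ?thesis unfolding eq
      by (intro closed_Collect_conj closed_Collect_all closed_Collect_imp closed_Collect_eq continuous_intros)
         auto
  qed
  moreover have "bounded (torus :: (complex^'n^'n) set)"
  proof (rule boundedI)
    fix A :: "complex^'n^'n" assume A: "A \<in> torus"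
    have "norm (A $ i) \<le> 1" for i
    proof -
      have "norm (A $ i) \<le> (\<Sum>j\<in>UNIV. norm (A $ i $ j))" by (simp add: norm_vec_def L2_set_le_sum)
      also have "\<dots> = (\<Sum>j\<in>UNIV. if j = i then 1 else 0)"
        using A by (intro sum.cong) (auto simp: torus_iff)
      finally show ?thesis by simp
    qed
    then have "(\<Sum>i\<in>UNIV. norm (A $ i)) \<le> (\<Sum>i\<in>(UNIV::'n set). 1)" by (intro sum_mono)
    moreover have "norm A \<le> (\<Sum>i\<in>UNIV. norm (A $ i))" by (simp add: norm_vec_def L2_set_le_sum)
    ultimately show "norm A \<le> real CARD('n)" by simp
  qed
  ultimately show ?thesis by (simp add: compact_eq_bounded_closed)
qed

lemma mat_mult_entry: "(mat z ** A) $ i $ j = z * (A :: complex^'n::finite^'n) $ i $ j"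
proof -
  have "(mat z ** A) $ i $ j = (\<Sum>l\<in>UNIV. (if i = l then z else 0) * A $ l $ j)"
    by (simp add: matrix_matrix_mult_def mat_def)
  also have "\<dots> = (\<Sum>l\<in>{i}. (if i = l then z else 0) * A $ l $ j)"
    by (intro sum.mono_neutral_right) auto
  finally show ?thesis by simp
qed

abbreviation zcoset :: "nat \<Rightarrow> complex^'n::finite^'n \<Rightarrow> (complex^'n^'n) set" where
  "zcoset k A \<equiv> center_roots k #>\<^bsub>SU\<^esub> A"

lemma coset_eq: "zcoset k A = {mat z ** A | z. z ^ k = 1}"
  by (auto simp: r_coset_def center_roots_def SU_def)

lemma mat_mat_mult: "mat z ** (mat w ** A) = mat (z * w) ** (A :: complex^'n::finite^'n)"
  by (simp add: vec_eq_iff mat_mult_entry mult.assoc)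

lemma mat_1_mult: "mat 1 ** A = (A :: complex^'n::finite^'n)"
  by (simp add: vec_eq_iff mat_mult_entry)

lemma coset_eq_iff:
  assumes "k > 0"
  shows "zcoset k A = zcoset k B \<longleftrightarrow> (\<exists>z. z ^ k = 1 \<and> B = mat z ** (A :: complex^'n::finite^'n))"
proof
  assume "zcoset k A = zcoset k B"
  moreover have "B \<in> zcoset k B"
    unfolding coset_eq by (rule CollectI, rule exI[of _ 1]) (simp add: mat_1_mult)
  ultimately show "\<exists>z. z ^ k = 1 \<and> B = mat z ** A" unfolding coset_eq by blast
next
  assume "\<exists>z. z ^ k = 1 \<and> B = mat z ** A"
  then obtain z where z: "z ^ k = 1" "B = mat z ** A" by blast
  have z0: "z \<noteq> 0" using z(1) assms by (auto simp: power_0_left)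
  have "mat w ** A = mat (w / z) ** B" for w using z0 by (simp add: z(2) mat_mat_mult)
  moreover have "mat w ** B = mat (w * z) ** A" for w by (simp add: z(2) mat_mat_mult)
  moreover have "(w / z) ^ k = 1" "(w * z) ^ k = 1" if "w ^ k = 1" for w
    using that z(1) by (simp_all add: power_divide power_mult_distrib)
  ultimately show "zcoset k A = zcoset k B"
    unfolding coset_eq by blast
qed

lemma mat_mult_torus:
  assumes "z ^ k = 1" "k > 0" "k dvd CARD('n)" "A \<in> torus"
  shows "mat z ** (A :: complex^'n::finite^'n) \<in> torus"
proof -
  have "norm z = 1" using assms(1,2) by (rule norm_eq_1_if_power)
  moreover have "z ^ CARD('n) = 1" using assms(1,3) by (metis dvdE power_mult power_one)
  ultimately show ?thesis using assms(4) by (simp add: torus_iff mat_mult_entry norm_mult prod.distrib)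
qed

lemma permute_entry: "bij \<sigma> \<Longrightarrow> permute_matrix \<sigma> A $ \<sigma> i $ \<sigma> j = A $ i $ j"
  by (simp add: permute_matrix_def inv_into_f_f bij_is_inj)

lemma permute_eqI:
  assumes "bij \<sigma>" "\<And>i j. B $ \<sigma> i $ \<sigma> j = A $ i $ j"
  shows "B = permute_matrix \<sigma> A"
proof -
  have "B $ i $ j = permute_matrix \<sigma> A $ i $ j" for i j
    using assms(2)[of "inv_into UNIV \<sigma> i" "inv_into UNIV \<sigma> j"] bij_is_surj[OF assms(1)]
    by (simp add: permute_matrix_def surj_f_inv_f)
  then show ?thesis by (simp add: vec_eq_iff)
qed

lemma permute_torus:
  assumes \<sigma>: "bij \<sigma>" and A: "A \<in> torus"
  shows "permute_matrix \<sigma> (A :: complex^'n::finite^'n) \<in> torus"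
proof -
  let ?\<tau> = "inv_into UNIV \<sigma>"
  have \<tau>: "bij ?\<tau>" using \<sigma> by (rule bij_imp_bij_inv)
  have "(\<Prod>i\<in>UNIV. A $ ?\<tau> i $ ?\<tau> i) = (\<Prod>i\<in>UNIV. A $ i $ i)"
    using prod.reindex_bij_betw[OF \<tau>, of "\<lambda>i. A $ i $ i"] by simp
  then show ?thesis
    using A bij_is_inj[OF \<tau>] by (auto simp: torus_iff permute_matrix_def inj_eq)
qed

lemma permute_comp:
  assumes "bij \<sigma>" "bij \<tau>"
  shows "permute_matrix \<sigma> (permute_matrix \<tau> A) = permute_matrix (\<sigma> \<circ> \<tau>) A"
  using assms by (intro permute_eqI bij_comp) (simp_all add: permute_entry)

lemma permute_id: "permute_matrix id A = A"
  by (rule permute_eqI[symmetric]) auto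

lemma permute_coset:
  assumes "bij \<sigma>"
  shows "permute_matrix \<sigma> ` (zcoset k A) = zcoset k (permute_matrix \<sigma> (A :: complex^'n::finite^'n))"
proof -
  have "permute_matrix \<sigma> (mat z ** A) = mat z ** permute_matrix \<sigma> A" for z
    by (rule permute_eqI[OF assms, symmetric]) (simp add: mat_mult_entry permute_entry[OF assms])
  then have "permute_matrix \<sigma> ` {mat z ** A | z. z ^ k = 1} = {mat z ** permute_matrix \<sigma> A | z. z ^ k = 1}"
    unfolding setcompr_eq_image image_image by simp
  then show ?thesis unfolding coset_eq .
qed

section \<open>Orbits in the inertia space and twisted fixed points\<close>

lemma carrier_Weyl: "carrier Weyl = {f. bij f}"
  by (simp add: BijGroup_def Bij_def extensional_UNIV)

lemma inertia_action_Weyl: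
  assumes "bij \<alpha>" "bij g"
  shows "inertia_action Weyl Weyl_action \<alpha> (g, S) = (\<alpha> \<circ> g \<circ> inv_into UNIV \<alpha>, permute_matrix \<alpha> ` S)"
proof -
  have Bij: "f \<in> Bij UNIV \<longleftrightarrow> bij f" for f :: "'a \<Rightarrow> 'a" by (simp add: Bij_def)
  have "m_inv Weyl \<alpha> = inv_into UNIV \<alpha>" using assms by (subst inv_BijGroup) (simp_all add: Bij restrict_UNIV)
  moreover have "bij (\<alpha> \<circ> g)" "bij (inv_into UNIV \<alpha>)" using assms by (auto intro: bij_comp bij_imp_bij_inv)
  ultimately show ?thesis
    using assms by (simp add: inertia_action_def Weyl_action_def BijGroup_def Bij compose_def comp_def restrict_UNIV)
qed

abbreviation Weyl_orbit ::
  "('n::finite \<Rightarrow> 'n) \<times> (complex^'n^'n) set \<Rightarrow> (('n \<Rightarrow> 'n) \<times> (complex^'n^'n) set) set" where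
  "Weyl_orbit \<equiv> orbit Weyl (inertia_action Weyl Weyl_action)"

lemma Weyl_orbit_eq_iff:
  fixes S S' :: "(complex^'n::finite^'n) set"
  assumes g: "bij g" "bij g'"
  shows "Weyl_orbit (g, S) = Weyl_orbit (g', S')
    \<longleftrightarrow> (\<exists>\<alpha>. bij \<alpha> \<and> g' \<circ> \<alpha> = \<alpha> \<circ> g \<and> S' = permute_matrix \<alpha> ` S)"
proof -
  have act: "inertia_action Weyl Weyl_action \<alpha> (g, S) = (g', S') \<longleftrightarrow> g' \<circ> \<alpha> = \<alpha> \<circ> g \<and> S' = permute_matrix \<alpha> ` S"
    if "bij \<alpha>" "bij g" for \<alpha> g g' and S S' :: "(complex^'n^'n) set"
  proof -
    have "\<alpha> \<circ> g \<circ> inv_into UNIV \<alpha> = g' \<longleftrightarrow> \<alpha> \<circ> g = g' \<circ> \<alpha>"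
      using bij_is_inj[OF that(1)] bij_is_surj[OF that(1)]
      by (metis comp_assoc comp_id inv_o_cancel surj_iff)
    then show ?thesis unfolding inertia_action_Weyl[OF that] by auto
  qed
  have orb: "(h', T') \<in> Weyl_orbit (h, T) \<longleftrightarrow>
      (\<exists>\<alpha>. bij \<alpha> \<and> h' \<circ> \<alpha> = \<alpha> \<circ> h \<and> T' = permute_matrix \<alpha> ` T)"
    if "bij h" for h h' and T T' :: "(complex^'n^'n) set"
  proof -
    have "(h', T') \<in> Weyl_orbit (h, T) \<longleftrightarrow>
        (\<exists>\<alpha>. bij \<alpha> \<and> inertia_action Weyl Weyl_action \<alpha> (h, T) = (h', T'))"
      unfolding orbit_def carrier_Weyl mem_Collect_eq by metis
    also have "\<dots> \<longleftrightarrow> (\<exists>\<alpha>. bij \<alpha> \<and> h' \<circ> \<alpha> = \<alpha> \<circ> h \<and> T' = permute_matrix \<alpha> ` T)"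
      by (rule ex_cong1, rule conj_cong[OF refl], rule act[OF _ that])
    finally show ?thesis .
  qed
  have trans: "Weyl_orbit (h', T') \<subseteq> Weyl_orbit (h, T)"
    if h: "bij h" "bij h'" "bij \<alpha>" "h' \<circ> \<alpha> = \<alpha> \<circ> h" "T' = permute_matrix \<alpha> ` T" for h h' \<alpha> and T T' :: "(complex^'n^'n) set"
  proof
    fix w assume w: "w \<in> Weyl_orbit (h', T')"
    obtain h'' T'' where ww: "w = (h'', T'')" by (cases w)
    then obtain \<beta> where \<beta>: "bij \<beta>" "h'' \<circ> \<beta> = \<beta> \<circ> h'" "T'' = permute_matrix \<beta> ` T'"
      using w orb[OF h(2)] by blast
    have "h'' \<circ> (\<beta> \<circ> \<alpha>) = (\<beta> \<circ> \<alpha>) \<circ> h" using \<beta>(2) h(4) by (metis comp_assoc)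
    moreover have "T'' = permute_matrix (\<beta> \<circ> \<alpha>) ` T"
      using permute_comp[OF \<beta>(1) h(3)] by (simp add: \<beta>(3) h(5) image_image)
    moreover have "bij (\<beta> \<circ> \<alpha>)" using \<beta>(1) h(3) by (rule bij_comp[rotated])
    ultimately show "w \<in> Weyl_orbit (h, T)"
      unfolding ww orb[OF h(1)] by blast
  qed
  show ?thesis
  proof
    assume eq: "Weyl_orbit (g, S) = Weyl_orbit (g', S')"
    have "(g', S') \<in> Weyl_orbit (g', S')"
      unfolding orb[OF g(2)] by (rule exI[of _ id]) (simp add: permute_id)
    then show "\<exists>\<alpha>. bij \<alpha> \<and> g' \<circ> \<alpha> = \<alpha> \<circ> g \<and> S' = permute_matrix \<alpha> ` S"
      unfolding eq[symmetric] orb[OF g(1)] .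
  next
    assume "\<exists>\<alpha>. bij \<alpha> \<and> g' \<circ> \<alpha> = \<alpha> \<circ> g \<and> S' = permute_matrix \<alpha> ` S"
    then obtain \<alpha> where \<alpha>: "bij \<alpha>" "g' \<circ> \<alpha> = \<alpha> \<circ> g" "S' = permute_matrix \<alpha> ` S" by blast
    let ?\<beta> = "inv_into UNIV \<alpha>"
    have io: "?\<beta> \<circ> \<alpha> = id" "\<alpha> \<circ> ?\<beta> = id"
      using bij_is_inj[OF \<alpha>(1)] bij_is_surj[OF \<alpha>(1)] by (simp_all add: surj_iff)
    have "bij ?\<beta>" using \<alpha>(1) by (rule bij_imp_bij_inv)
    moreover have "g \<circ> ?\<beta> = ?\<beta> \<circ> g'" using \<alpha>(2) io by (metis comp_assoc comp_id id_comp)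
    moreover have "S = permute_matrix ?\<beta> ` S'"
      using permute_comp[OF \<open>bij ?\<beta>\<close> \<alpha>(1)] by (simp add: \<alpha>(3) image_image io permute_id)
    ultimately show "Weyl_orbit (g, S) = Weyl_orbit (g', S')"
      using trans[OF g \<alpha>] trans[OF g(2,1)] by blast
  qed
qed

type_synonym 'n twisted_point = "(('n \<Rightarrow> 'n) \<times> complex) \<times> (complex^'n^'n)"

text \<open>The triples of the overview as a space: for \<open>k > 0\<close>, finitely many closed
  pieces of the compact torus, one for each \<open>(g, \<zeta>)\<close>. Recording
  \<open>\<zeta>\<close> turns the condition that a coset is fixed into equations between
  entries.\<close>

definition twisted_torus :: "nat \<Rightarrow> ('n::finite) twisted_point topology" where
  "twisted_torus k = subtopology
     (prod_topology (discrete_topology ({g. bij g} \<times> {\<zeta>. \<zeta> ^ k = 1})) (top_of_set torus))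
     {((g, \<zeta>), A). twisted \<zeta> g (diag A)}"

definition quotient_class :: "nat \<Rightarrow> ('n::finite) twisted_point \<Rightarrow> (('n \<Rightarrow> 'n) \<times> (complex^'n^'n) set) set" where
  "quotient_class k = (\<lambda>((g, \<zeta>), A). Weyl_orbit (g, zcoset k A))"

lemma topspace_twisted_torus:
  "((g, \<zeta>), A) \<in> topspace (twisted_torus k) \<longleftrightarrow> bij g \<and> \<zeta> ^ k = 1 \<and> A \<in> torus \<and> twisted \<zeta> g (diag A)"
  by (auto simp: twisted_torus_def)

text \<open>The coset relation contributes \<open>\<eta>\<close> and the orbit relation contributes
  \<open>\<alpha>\<close>; they combine because scalar factors commute with permuting entries. The
  right-hand side does not mention \<open>\<zeta>\<close>, which is determined by \<open>g\<close>
  and \<open>A\<close>.\<close>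

lemma quotient_class_eq_iff:
  fixes A A' :: "complex^'n::finite^'n"
  assumes k: "k > 0" "k dvd CARD('n)"
    and z: "((g, \<zeta>), A) \<in> topspace (twisted_torus k)" and z': "((g', \<zeta>'), A') \<in> topspace (twisted_torus k)"
  shows "quotient_class k ((g, \<zeta>), A) = quotient_class k ((g', \<zeta>'), A') \<longleftrightarrow>
    (\<exists>\<alpha> \<eta>. bij \<alpha> \<and> \<eta> ^ k = 1 \<and> (\<forall>x. g' (\<alpha> x) = \<alpha> (g x)) \<and> (\<forall>x. diag A' (\<alpha> x) = \<eta> * diag A x))"
proof -
  have g: "bij g" "bij g'" and A: "A \<in> torus" "A' \<in> torus" using z z' by (auto simp: topspace_twisted_torus)
  have "A' = mat \<eta> ** permute_matrix \<alpha> A \<longleftrightarrow> (\<forall>x. diag A' (\<alpha> x) = \<eta> * diag A x)"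
    if \<alpha>: "bij \<alpha>" and \<eta>: "\<eta> ^ k = 1" for \<alpha> \<eta>
  proof -
    have B: "mat \<eta> ** permute_matrix \<alpha> A \<in> torus"
      by (rule mat_mult_torus[OF \<eta> k permute_torus[OF \<alpha> A(1)]])
    have "(\<forall>x. diag A' (\<alpha> x) = \<eta> * diag A x) \<longleftrightarrow> (\<forall>x. diag A' (\<alpha> x) = diag (mat \<eta> ** permute_matrix \<alpha> A) (\<alpha> x))"
      by (simp add: mat_mult_entry permute_entry[OF \<alpha>])
    also have "\<dots> \<longleftrightarrow> diag A' = diag (mat \<eta> ** permute_matrix \<alpha> A)"
      using bij_is_surj[OF \<alpha>] by (metis surjD)
    also have "\<dots> \<longleftrightarrow> A' = mat \<eta> ** permute_matrix \<alpha> A" using diag_inj[OF A(2) B] by metis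
    finally show ?thesis ..
  qed
  note key = this
  have "zcoset k A' = permute_matrix \<alpha> ` (zcoset k A) \<longleftrightarrow>
      (\<exists>\<eta>. \<eta> ^ k = 1 \<and> (\<forall>x. diag A' (\<alpha> x) = \<eta> * diag A x))" if \<alpha>: "bij \<alpha>" for \<alpha>
  proof -
    have "zcoset k A' = permute_matrix \<alpha> ` (zcoset k A) \<longleftrightarrow>
        (\<exists>\<eta>. \<eta> ^ k = 1 \<and> A' = mat \<eta> ** permute_matrix \<alpha> A)"
      unfolding permute_coset[OF \<alpha>] coset_eq_iff[OF k(1), symmetric] by (rule eq_commute)
    then show ?thesis using key[OF \<alpha>] by blast
  qed
  note H = this
  have G: "g' \<circ> \<alpha> = \<alpha> \<circ> g \<longleftrightarrow> (\<forall>x. g' (\<alpha> x) = \<alpha> (g x))" for \<alpha>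
    by (simp add: fun_eq_iff)
  have "quotient_class k ((g, \<zeta>), A) = quotient_class k ((g', \<zeta>'), A') \<longleftrightarrow>
      (\<exists>\<alpha>. bij \<alpha> \<and> (\<forall>x. g' (\<alpha> x) = \<alpha> (g x)) \<and> (\<exists>\<eta>. \<eta> ^ k = 1 \<and> (\<forall>x. diag A' (\<alpha> x) = \<eta> * diag A x)))"
    unfolding quotient_class_def prod.case Weyl_orbit_eq_iff[OF g]
    by (rule ex_cong1, rule conj_cong[OF refl], rule conj_cong[OF G H])
  also have "(\<exists>\<alpha>. P \<alpha> \<and> Q \<alpha> \<and> (\<exists>\<eta>. R \<eta> \<and> S \<alpha> \<eta>)) \<longleftrightarrow> (\<exists>\<alpha> \<eta>. P \<alpha> \<and> R \<eta> \<and> Q \<alpha> \<and> S \<alpha> \<eta>)"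
    for P Q :: "('n \<Rightarrow> 'n) \<Rightarrow> bool" and R :: "complex \<Rightarrow> bool" and S by blast
  finally show ?thesis .
qed

lemma compact_twisted_torus:
  assumes "k > 0"
  shows "compact_space (twisted_torus k :: ('n::finite) twisted_point topology)"
proof -
  let ?B = "{g::'n \<Rightarrow> 'n. bij g} \<times> {\<zeta>::complex. \<zeta> ^ k = 1}"
  let ?X = "prod_topology (discrete_topology ?B) (top_of_set (torus :: (complex^'n^'n) set))"
  have fin: "finite ?B" using assms by (simp add: finite_roots_unity)
  have "compact_space ?X"
  proof -
    have "compact_space (top_of_set (torus :: (complex^'n^'n) set))"
      using compact_torus by (intro compact_space_subtopology) (simp add: compactin_euclidean_iff)
    moreover have "compact_space (discrete_topology ?B)"
      using fin unfolding compact_space_discrete_topology .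
    ultimately show ?thesis unfolding compact_space_prod_topology by blast
  qed
  moreover have "closedin ?X (topspace ?X \<inter> {((g, \<zeta>), A). twisted \<zeta> g (diag A)})"
  proof -
    have "closedin (top_of_set torus) {A \<in> torus. twisted \<zeta> g (diag A)}" for \<zeta> and g :: "'n \<Rightarrow> 'n"
    proof -
      have "closed {A :: complex^'n^'n. twisted \<zeta> g (diag A)}"
        unfolding twisted_def mem_sphere dist_0_norm
        by (intro closed_Collect_conj closed_Collect_all closed_Collect_eq continuous_intros)
      then have "closedin (top_of_set torus) (torus \<inter> {A. twisted \<zeta> g (diag A)})"
        by (rule closedin_closed_Int)
      then show ?thesis by (simp add: Collect_conj_eq)
    qed
    then have "closedin ?X ({(g, \<zeta>)} \<times> {A \<in> torus. twisted \<zeta> g (diag A)})" if "(g, \<zeta>) \<in> ?B" for g \<zeta>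
      unfolding closedin_prod_Times_iff using that by simp
    then have "closedin ?X (\<Union>b\<in>?B. {b} \<times> {A \<in> torus. twisted (snd b) (fst b) (diag A)})"
      using fin by (intro closedin_Union) auto
    moreover have "(\<Union>b\<in>?B. {b} \<times> {A \<in> torus. twisted (snd b) (fst b) (diag A)}) =
        topspace ?X \<inter> {((g, \<zeta>), A). twisted \<zeta> g (diag A)}" by auto
    ultimately show ?thesis by simp
  qed
  ultimately have "compactin ?X (topspace ?X \<inter> {((g, \<zeta>), A). twisted \<zeta> g (diag A)})"
    by (rule closedin_compact_space)
  then have "compact_space (subtopology ?X (topspace ?X \<inter> {((g, \<zeta>), A). twisted \<zeta> g (diag A)}))"
    by (rule compact_space_subtopology)
  then show ?thesis unfolding twisted_torus_def by (simp only: subtopology_restrict)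
qed

text \<open>The matrices whose coset meets \<open>U\<close> form a union of preimages of
  \<open>U\<close> under scalar multiplications. Openness is wanted because the quotient has to be
  restricted to the inertia space, and open maps restrict well to full preimages.\<close>

lemma open_map_coset:
  assumes k: "k > 0" "k dvd CARD('n)"
  shows "open_map (top_of_set torus) (torus_mod k :: (complex^'n::finite^'n) set topology) (\<lambda>A. zcoset k A)"
  unfolding open_map_def
proof (intro allI impI)
  fix U :: "(complex^'n^'n) set" assume U: "openin (top_of_set torus) U"
  let ?c = "\<lambda>A :: complex^'n^'n. zcoset k A"
  have sub: "U \<subseteq> torus" using openin_subset[OF U] by simp
  have "openin (top_of_set torus) {A \<in> torus. mat z ** A \<in> U}" if "z ^ k = 1" for z
  proof -
    have "continuous_map (top_of_set torus) (top_of_set torus) (\<lambda>A :: complex^'n^'n. mat z ** A)"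
      using mat_mult_torus[OF that k]
      by (auto simp: matrix_matrix_mult_def intro!: continuous_intros)
    from openin_continuous_map_preimage[OF this U] show ?thesis by simp
  qed
  then have "openin (top_of_set torus) (\<Union>z\<in>{z. z ^ k = 1}. {A \<in> torus. mat z ** A \<in> U})" by blast
  moreover have "(\<Union>z\<in>{z. z ^ k = 1}. {A \<in> torus. mat z ** A \<in> U}) = {A \<in> topspace (top_of_set torus). ?c A \<in> ?c ` U}"
    unfolding image_iff coset_eq_iff[OF k(1)] by auto
  ultimately show "openin (torus_mod k) (?c ` U)"
    unfolding torus_mod_def openin_quotient_space using sub by auto
qed

text \<open>By openness the pairs \<open>(g, A)\<close> lying over the inertia space map onto it by
  a quotient map. This map factors through the twisted torus by means of a continuous choice
  \<open>s\<close> of the label \<open>\<zeta>\<close>, so the projection \<open>P\<close> from the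
  twisted torus is a quotient map as well.\<close>

lemma quotient_map_quotient_class:
  assumes k: "k > 0" "k dvd CARD('n)"
  shows "quotient_map (twisted_torus k)
    (extended_quotient Weyl Weyl_action (torus_mod k :: (complex^'n::finite^'n) set topology)) (quotient_class k)"
proof -
  let ?c = "\<lambda>A :: complex^'n^'n. zcoset k A"
  let ?X = "prod_topology (discrete_topology {g :: 'n \<Rightarrow> 'n. bij g}) (top_of_set torus)"
  let ?Y = "prod_topology (discrete_topology {g :: 'n \<Rightarrow> 'n. bij g}) (torus_mod k)"
  let ?f = "\<lambda>(g :: 'n \<Rightarrow> 'n, A). (g, ?c A)"
  let ?V = "{(g, S). Weyl_action g S = S}"
  let ?U = "{x \<in> topspace ?X. ?f x \<in> ?V}"
  have inertia: "inertia_space Weyl Weyl_action (torus_mod k) = subtopology ?Y ?V"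
    by (simp add: inertia_space_def carrier_Weyl)
  have U: "(g, A) \<in> ?U \<longleftrightarrow> bij g \<and> A \<in> torus \<and> (\<exists>\<zeta>. \<zeta> ^ k = 1 \<and> twisted \<zeta> g (diag A))" for g A
  proof -
    have "Weyl_action g (?c A) = ?c A \<longleftrightarrow> (\<exists>\<zeta>. \<zeta> ^ k = 1 \<and> twisted \<zeta> g (diag A))" if g: "bij g" and A: "A \<in> torus"
    proof -
      have "permute_matrix g A = mat \<zeta> ** A \<longleftrightarrow> twisted \<zeta> g (diag A)" if \<zeta>: "\<zeta> ^ k = 1" for \<zeta>
      proof -
        have "permute_matrix g A = mat \<zeta> ** A \<longleftrightarrow> diag (permute_matrix g A) = diag (mat \<zeta> ** A)"
          using diag_inj[OF permute_torus[OF g A] mat_mult_torus[OF \<zeta> k A]] by metis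
        also have "\<dots> \<longleftrightarrow> (\<forall>x. diag (permute_matrix g A) (g x) = diag (mat \<zeta> ** A) (g x))"
          using bij_is_surj[OF g] by (metis surjD)
        also have "\<dots> \<longleftrightarrow> (\<forall>x. diag A x = \<zeta> * diag A (g x))"
          by (simp add: mat_mult_entry permute_entry[OF g])
        also have "\<dots> \<longleftrightarrow> twisted \<zeta> g (diag A)"
          using A unfolding twisted_def torus_iff by simp
        finally show ?thesis .
      qed
      moreover have "Weyl_action g (?c A) = ?c A \<longleftrightarrow> (\<exists>\<zeta>. \<zeta> ^ k = 1 \<and> permute_matrix g A = mat \<zeta> ** A)"
        unfolding Weyl_action_def permute_coset[OF g] using coset_eq_iff[OF k(1), of A "permute_matrix g A"] by metis
      ultimately show ?thesis by blast
    qed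
    then show ?thesis by auto
  qed
  have cq: "quotient_map (top_of_set torus) (torus_mod k) ?c"
    unfolding torus_mod_def by (rule quotient_map_quotient_space)
  then have cc: "continuous_map (top_of_set torus) (torus_mod k) ?c" by (rule quotient_imp_continuous_map)
  have fq: "quotient_map (subtopology ?X ?U) (subtopology ?Y ?V) ?f"
  proof (rule continuous_open_imp_quotient_map)
    have "continuous_map ?X ?Y ?f"
      using cc by (simp add: case_prod_unfold continuous_map_pairwise comp_def continuous_map_of_snd[unfolded comp_def] continuous_map_fst)
    then show "continuous_map (subtopology ?X ?U) (subtopology ?Y ?V) ?f"
      by (auto simp: continuous_map_in_subtopology intro: continuous_map_from_subtopology)
    show "open_map (subtopology ?X ?U) (subtopology ?Y ?V) ?f"
      by (rule open_map_restriction[OF open_map_discrete_prod[OF open_map_coset[OF k]] refl])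
    show "?f ` topspace (subtopology ?X ?U) = topspace (subtopology ?Y ?V)"
    proof (intro equalityI subsetI)
      fix w assume "w \<in> topspace (subtopology ?Y ?V)"
      then obtain g S where w: "w = (g, S)" "bij g" "S \<in> topspace (torus_mod k)" "w \<in> ?V" by auto
      have "?c ` torus = topspace (torus_mod k)" using quotient_imp_surjective_map[OF cq] by simp
      then have "S \<in> ?c ` torus" using w(3) by simp
      then obtain A where A: "A \<in> torus" "S = ?c A" by blast
      then have "(g, A) \<in> topspace (subtopology ?X ?U)" "w = ?f (g, A)" using w by auto
      then show "w \<in> ?f ` topspace (subtopology ?X ?U)" by blast
    qed (use quotient_imp_surjective_map[OF cq] in auto)
  qed
  define P where "P = (\<lambda>((g :: 'n \<Rightarrow> 'n, \<zeta> :: complex), A). (g, ?c A))"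
  \<comment> \<open>The label is the ratio of two neighbouring entries, read off at the arbitrary
    index \<open>undefined\<close>. It is continuous into a discrete space since only finitely many
    values occur over the inertia space.\<close>
  define s where "s = (\<lambda>(g :: 'n \<Rightarrow> 'n, A :: complex^'n^'n). ((g, A $ undefined $ undefined / A $ g undefined $ g undefined), A))"
  have szeta: "A $ undefined $ undefined / A $ g undefined $ g undefined = \<zeta>" if "twisted \<zeta> g (diag A)" for g :: "'n \<Rightarrow> 'n" and A \<zeta>
    using twistedD(1)[OF that, of undefined] twistedD(3)[OF that, of "g undefined"] by simp
  have s: "continuous_map (subtopology ?X ?U) (twisted_torus k) s"
  proof (rule continuous_map_discrete_prod)
    fix g :: "'n \<Rightarrow> 'n" assume "g \<in> {g. bij g}"
    then have g: "bij g" by simp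
    let ?S = "subtopology (top_of_set torus) {A. (g, A) \<in> ?U}"
    have top: "A \<in> topspace ?S \<Longrightarrow> A \<in> torus \<and> (\<exists>\<zeta>. \<zeta> ^ k = 1 \<and> twisted \<zeta> g (diag A))" for A
      using U[of g A] by auto
    let ?q = "\<lambda>A :: complex^'n^'n. A $ undefined $ undefined / A $ g undefined $ g undefined"
    have "continuous_map ?S euclidean ?q"
    proof -
      have "A $ g undefined $ g undefined \<noteq> 0" if "A \<in> torus" for A :: "complex^'n^'n"
        using that unfolding torus_iff by (metis norm_zero zero_neq_one)
      then have "continuous_on torus ?q" by (intro continuous_intros) auto
      then show ?thesis by (rule continuous_map_from_subtopology[OF continuous_map_iff_continuous[THEN iffD2]])
    qed
    then have "continuous_map ?S (discrete_topology {\<zeta>. \<zeta> ^ k = 1}) ?q"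
    proof (rule continuous_map_discrete_finite_range)
      show "finite {\<zeta>::complex. \<zeta> ^ k = 1}" using k by (simp add: finite_roots_unity)
      show "?q ` topspace ?S \<subseteq> {\<zeta>. \<zeta> ^ k = 1}" using top szeta by fastforce
    qed
    moreover have "continuous_map (discrete_topology {\<zeta>::complex. \<zeta> ^ k = 1}) (discrete_topology ({g :: 'n \<Rightarrow> 'n. bij g} \<times> {\<zeta>. \<zeta> ^ k = 1})) (Pair g)"
      using g by simp
    ultimately have "continuous_map ?S (discrete_topology ({g :: 'n \<Rightarrow> 'n. bij g} \<times> {\<zeta>. \<zeta> ^ k = 1})) (Pair g \<circ> ?q)"
      by (rule continuous_map_compose)
    moreover have "continuous_map ?S (top_of_set torus) (\<lambda>A. A)"
      by (rule continuous_map_from_subtopology) (simp add: continuous_map_id[unfolded id_def])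
    moreover have "twisted (?q A) g (diag A)" if "A \<in> topspace ?S" for A using top[OF that] szeta by metis
    ultimately show "continuous_map ?S (twisted_torus k) (\<lambda>A. s (g, A))"
      unfolding twisted_torus_def s_def prod.case
      by (auto simp: continuous_map_in_subtopology continuous_map_pairwise comp_def)
  qed
  have Pc: "continuous_map (twisted_torus k) (subtopology ?Y ?V) P"
    unfolding twisted_torus_def
  proof (rule continuous_map_discrete_prod)
    fix b :: "('n \<Rightarrow> 'n) \<times> complex" assume b: "b \<in> {g. bij g} \<times> {\<zeta>. \<zeta> ^ k = 1}"
    obtain g \<zeta> where gz: "b = (g, \<zeta>)" "bij g" "\<zeta> ^ k = 1" using b by auto
    let ?S = "subtopology (top_of_set torus) {A. (b, A) \<in> {((g, \<zeta>), A). twisted \<zeta> g (diag A)}}"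
    have "continuous_map ?S ?Y (\<lambda>A. P (b, A))"
      using continuous_map_from_subtopology[OF cc] gz by (simp add: P_def gz continuous_map_pairwise comp_def)
    moreover have "P (b, A) \<in> ?V" if "A \<in> topspace ?S" for A
    proof -
      have "(g, A) \<in> ?U" using that gz by (subst U) auto
      then show ?thesis by (simp add: P_def gz)
    qed
    ultimately show "continuous_map ?S (subtopology ?Y ?V) (\<lambda>A. P (b, A))"
      by (auto simp: continuous_map_in_subtopology)
  qed
  have "P \<circ> s = ?f" by (auto simp: P_def s_def fun_eq_iff)
  then have "quotient_map (subtopology ?X ?U) (subtopology ?Y ?V) (P \<circ> s)" using fq by simp
  then have "quotient_map (twisted_torus k) (subtopology ?Y ?V) P"
    by (rule quotient_map_from_composition[OF s Pc])
  then have "quotient_map (twisted_torus k)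
      (extended_quotient Weyl Weyl_action (torus_mod k)) (Weyl_orbit \<circ> P)"
    unfolding extended_quotient_def inertia
    by (rule quotient_map_compose) (rule quotient_map_quotient_space)
  moreover have "Weyl_orbit \<circ> P = quotient_class k"
    by (auto simp: P_def quotient_class_def fun_eq_iff)
  ultimately show ?thesis by simp
qed

section \<open>Coefficient coordinates for the cycle values\<close>

definition coefs :: "(nat \<Rightarrow> complex multiset) \<Rightarrow> nat \<times> nat \<Rightarrow> complex" where
  "coefs U = (\<lambda>(m, j). coeff (root_poly (U m)) j)"

text \<open>The correction factors of \<open>prod_twisted\<close>, collected over all cycles. The
  monomial in the cycle values must equal this number when the entries have product
  \<open>1\<close>.\<close>

definition twist_det :: "nat multiset \<Rightarrow> complex \<Rightarrow> complex" where
  "twist_det \<mu> \<zeta> = (\<Prod>m\<in>#\<mu>. \<zeta> ^ (\<Sum>{..<m}))"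

definition labels :: "nat \<Rightarrow> nat \<Rightarrow> (nat multiset \<times> complex) set" where
  "labels n k = {(\<mu>, \<zeta>). \<mu> \<in> partitions n \<and> \<zeta> ^ k = 1 \<and> (\<forall>m\<in>#\<mu>. \<zeta> ^ m = 1)}"

text \<open>The determinant condition sees each multiset only through its product, that is, through
  a constant coefficient. Any change that keeps sizes, products and the circle therefore preserves
  admissibility.\<close>

definition admissible :: "nat multiset \<Rightarrow> complex \<Rightarrow> (nat \<Rightarrow> complex multiset) \<Rightarrow> bool" where
  "admissible \<mu> \<zeta> U \<longleftrightarrow> (\<forall>m. size (U m) = count \<mu> m \<and> set_mset (U m) \<subseteq> circle) \<and>
     (\<Prod>m\<in>set_mset \<mu>. prod_mset (U m) ^ (m div root_ord \<zeta>)) = twist_det \<mu> \<zeta>"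

section \<open>Deformation of the extended quotient\<close>

type_synonym coef_point = "(nat multiset \<times> complex) \<times> (nat \<times> nat \<Rightarrow> complex)"

text \<open>Inside a product of planes the Hausdorff property is immediate and the deformation has a
  closed formula. All pairs \<open>(m, j)\<close> serve as indices, so that the ambient space is the
  same for every label.\<close>

definition coef_space :: "nat \<Rightarrow> nat \<Rightarrow> coef_point topology" where
  "coef_space n k = subtopology
     (prod_topology (discrete_topology (labels n k)) (product_topology (\<lambda>_. euclidean) UNIV))
     {((\<mu>, \<zeta>), c). \<exists>U. admissible \<mu> \<zeta> U \<and> c = coefs U}"

definition coef_map :: "('n::finite) twisted_point \<Rightarrow> coef_point" where
  "coef_map = (\<lambda>((g, \<zeta>), A). ((cycle_type g, \<zeta>), coefs (cycle_values \<zeta> g (diag A))))"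

text \<open>A \<open>k\<close>-th root of unity \<open>\<eta>\<close> multiplies the cycle values by
  \<open>\<theta> = \<eta> ^ root_ord \<zeta>\<close>, and the coefficient of \<open>X ^ j\<close>
  is homogeneous of degree \<open>count \<mu> m - j\<close> in these values.\<close>

definition rotation_related :: "nat \<Rightarrow> coef_point \<Rightarrow> coef_point \<Rightarrow> bool" where
  "rotation_related k = (\<lambda>((\<mu>, \<zeta>), c) ((\<mu>', \<zeta>'), c'). \<mu>' = \<mu> \<and> \<zeta>' = \<zeta> \<and>
     (\<exists>\<theta>. \<theta> ^ (k div root_ord \<zeta>) = 1 \<and> (\<forall>m j. c' (m, j) = \<theta> ^ (count \<mu> m - j) * c (m, j))))"

lemma topspace_coef_space:
  "((\<mu>, \<zeta>), c) \<in> topspace (coef_space n k) \<longleftrightarrow> (\<mu>, \<zeta>) \<in> labels n k \<and> (\<exists>U. admissible \<mu> \<zeta> U \<and> c = coefs U)"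
  by (auto simp: coef_space_def)

lemma labelsD:
  assumes "(\<mu>, \<zeta>) \<in> labels n k" "n > 0" "k > 0"
  shows "\<mu> \<noteq> {#}" "\<And>m. m \<in># \<mu> \<Longrightarrow> m > 0" "root_ord \<zeta> > 0" "root_ord \<zeta> dvd k" "\<And>m. m \<in># \<mu> \<Longrightarrow> root_ord \<zeta> dvd m"
    "norm \<zeta> = 1" "sum_mset \<mu> = n" "twist_det \<mu> \<zeta> \<in> circle"
proof -
  have p: "\<mu> \<in> partitions n" "\<zeta> ^ k = 1" "\<And>m. m \<in># \<mu> \<Longrightarrow> \<zeta> ^ m = 1" using assms(1) by (auto simp: labels_def)
  show s: "sum_mset \<mu> = n" and "\<And>m. m \<in># \<mu> \<Longrightarrow> m > 0" using p(1) by (auto simp: partitions_def)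
  show "\<mu> \<noteq> {#}" using s assms(2) by auto
  note r = power_eq_1_iff_root_ord_dvd[OF assms(3) p(2)]
  show "root_ord \<zeta> > 0" using root_ord_pos(1)[OF assms(3) p(2)] .
  show "root_ord \<zeta> dvd k" using r p(2) by blast
  show "root_ord \<zeta> dvd m" if "m \<in># \<mu>" for m using r p(3)[OF that] by blast
  show n: "norm \<zeta> = 1" using norm_eq_1_if_power[OF p(2) assms(3)] .
  show "twist_det \<mu> \<zeta> \<in> circle" by (simp add: twist_det_def norm_prod_mset norm_power n)
qed

lemma prod_cycle_values:
  fixes g :: "'n::finite \<Rightarrow> 'n"
  assumes "bij g" "twisted \<zeta> g t"
  shows "(\<Prod>m\<in>set_mset (cycle_type g). prod_mset (cycle_values \<zeta> g t m) ^ (m div root_ord \<zeta>)) =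
    (\<Prod>x\<in>UNIV. t x) * twist_det (cycle_type g) \<zeta>"
proof -
  let ?d = "root_ord \<zeta>"
  have "(\<Prod>m\<in>set_mset (cycle_type g). prod_mset (cycle_values \<zeta> g t m) ^ (m div ?d)) =
      (\<Prod>m\<in>card ` cycles g. \<Prod>C\<in>{C \<in> cycles g. card C = m}. cycle_value \<zeta> t C ^ (card C div ?d))"
  proof (rule prod.cong)
    fix m
    have "prod_mset (cycle_values \<zeta> g t m) = (\<Prod>C\<in>{C \<in> cycles g. card C = m}. cycle_value \<zeta> t C)"
      by (simp add: cycle_values_def prod_unfold_prod_mset)
    then show "prod_mset (cycle_values \<zeta> g t m) ^ (m div ?d) =
        (\<Prod>C\<in>{C \<in> cycles g. card C = m}. cycle_value \<zeta> t C ^ (card C div ?d))"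
      by (simp add: prod_power_distrib)
  qed (simp add: cycle_type_def)
  also have "\<dots> = (\<Prod>C\<in>cycles g. cycle_value \<zeta> t C ^ (card C div ?d))"
    by (rule prod.group) auto
  also have "\<dots> = (\<Prod>x\<in>UNIV. t x) * (\<Prod>C\<in>cycles g. \<zeta> ^ (\<Sum>{..<card C}))"
    by (rule prod_twisted[OF assms])
  also have "(\<Prod>C\<in>cycles g. \<zeta> ^ (\<Sum>{..<card C})) = twist_det (cycle_type g) \<zeta>"
    by (simp add: twist_det_def cycle_type_def prod_unfold_prod_mset image_mset.compositionality comp_def)
  finally show ?thesis .
qed

lemma coef_map_admissible:
  fixes A :: "complex^'n::finite^'n"
  assumes g: "bij g" and A: "A \<in> torus" and t: "twisted \<zeta> g (diag A)"
  shows "admissible (cycle_type g) \<zeta> (cycle_values \<zeta> g (diag A))"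
  unfolding admissible_def
proof (intro conjI allI)
  fix m
  show "size (cycle_values \<zeta> g (diag A) m) = count (cycle_type g) m"
    by (simp add: cycle_values_def cycle_type_def count_image_mset_eq_card_vimage)
  show "set_mset (cycle_values \<zeta> g (diag A) m) \<subseteq> circle"
    using cycle_value_circle[OF t] by (auto simp: cycle_values_def)
qed (use A in \<open>simp add: prod_cycle_values[OF g t] torus_iff\<close>)

lemma coef_map_in:
  fixes A :: "complex^'n::finite^'n"
  assumes "((g, \<zeta>), A) \<in> topspace (twisted_torus k)"
  shows "coef_map ((g, \<zeta>), A) \<in> topspace (coef_space CARD('n) k)"
proof -
  have z: "bij g" "\<zeta> ^ k = 1" "A \<in> torus" "twisted \<zeta> g (diag A)" using assms by (simp_all add: topspace_twisted_torus)
  have "\<forall>m\<in>#cycle_type g. \<zeta> ^ m = 1"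
    using twisted_root[OF z(1,4)] by (auto simp: cycle_type_def)
  then show ?thesis
    unfolding coef_map_def prod.case topspace_coef_space labels_def
    using cycle_type_partition[OF z(1)] z(2) coef_map_admissible[OF z(1,3,4)] by blast
qed

text \<open>\<open>ex_twisted_with_values\<close> supplies entries with the right cycle values.
  Admissibility forces their product to be \<open>1\<close>, since
  \<open>twist_det \<mu> \<zeta>\<close> is nonzero and cancels.\<close>

lemma coef_map_surj:
  assumes x: "((\<mu>, \<zeta>), c) \<in> topspace (coef_space CARD('n::finite) k)" and k: "k > 0"
  shows "\<exists>z \<in> topspace (twisted_torus k :: 'n twisted_point topology). coef_map z = ((\<mu>, \<zeta>), c)"
proof -
  obtain U where U: "(\<mu>, \<zeta>) \<in> labels CARD('n) k" "admissible \<mu> \<zeta> U" "c = coefs U"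
    using x unfolding topspace_coef_space by blast
  have lab: "\<mu> \<in> partitions CARD('n)" "\<zeta> ^ k = 1" "\<And>m. m \<in># \<mu> \<Longrightarrow> \<zeta> ^ m = 1"
    using U(1) by (auto simp: labels_def)
  have adm: "\<And>m. size (U m) = count \<mu> m" "\<And>m. set_mset (U m) \<subseteq> circle"
    using U(2) unfolding admissible_def by blast+
  obtain g :: "'n \<Rightarrow> 'n" and t where g: "bij g" and t: "twisted \<zeta> g t" and type: "cycle_type g = \<mu>"
    and vals: "\<forall>m. cycle_values \<zeta> g t m = U m"
    using ex_twisted_with_values[OF lab(1,3) adm] by blast
  have vals': "cycle_values \<zeta> g t = U" using vals by blast
  have "twist_det \<mu> \<zeta> \<noteq> 0"
    using labelsD(8)[OF U(1) _ k] by auto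
  moreover have "(\<Prod>x\<in>UNIV. t x) * twist_det \<mu> \<zeta> = 1 * twist_det \<mu> \<zeta>"
    using prod_cycle_values[OF g t] U(2) unfolding type vals' admissible_def by simp
  ultimately have "(\<Prod>x\<in>UNIV. t x) = 1" by (metis mult_right_cancel)
  moreover have "norm (t x) = 1" for x using twistedD(2)[OF t, of x] by simp
  ultimately obtain A where A: "A \<in> torus" "diag A = t" using ex_torus_diag by metis
  have "((g, \<zeta>), A) \<in> topspace (twisted_torus k)"
    using g lab(2) A t by (simp add: topspace_twisted_torus)
  moreover have "coef_map ((g, \<zeta>), A) = ((\<mu>, \<zeta>), c)"
    by (simp add: coef_map_def A(2) type U(3) vals')
  ultimately show ?thesis by blast
qed

lemma continuous_coef_map:
  "continuous_map (twisted_torus k :: ('n::finite) twisted_point topology)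
     (coef_space CARD('n) k) coef_map"
proof -
  have c1: "continuous_map (twisted_torus k :: 'n twisted_point topology)
      (prod_topology (discrete_topology (labels CARD('n) k)) (product_topology (\<lambda>_. euclidean) UNIV)) coef_map"
    unfolding twisted_torus_def
  proof (rule continuous_map_discrete_prod)
    fix b :: "('n \<Rightarrow> 'n) \<times> complex" assume b: "b \<in> {g. bij g} \<times> {\<zeta>. \<zeta> ^ k = 1}"
    obtain g \<zeta> where gz: "b = (g, \<zeta>)" "bij g" "\<zeta> ^ k = 1" using b by auto
    let ?S = "subtopology (top_of_set torus) {A. (b, A) \<in> {((g, \<zeta>), A). twisted \<zeta> g (diag A)}}"
    have "(cycle_type g, \<zeta>) \<in> labels CARD('n) k" if "A \<in> topspace ?S" for A
    proof -
      have "((g, \<zeta>), A) \<in> topspace (twisted_torus k)" using that gz by (simp add: topspace_twisted_torus)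
      from coef_map_in[OF this] show ?thesis by (simp add: coef_map_def topspace_coef_space)
    qed
    note lab = this
    have 1: "continuous_map ?S (discrete_topology (labels CARD('n) k)) (\<lambda>A. (cycle_type g, \<zeta>))"
    proof (cases "topspace ?S = {}")
      case True
      then have "?S = trivial_topology" by (simp only: null_topspace_iff_trivial)
      then show ?thesis by (simp only: continuous_map_const simp_thms)
    next
      case False
      then have "(cycle_type g, \<zeta>) \<in> topspace (discrete_topology (labels CARD('n) k))"
        using lab unfolding topspace_discrete_topology by blast
      then show ?thesis by (simp only: continuous_map_const simp_thms)
    qed
    have cont: "continuous_map ?S euclidean (\<lambda>A. cycle_value \<zeta> (diag A) C)" for C
    proof -
      have "continuous_on torus (\<lambda>A :: complex^'n^'n. cycle_value \<zeta> (diag A) C)"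
        unfolding cycle_value_def by (intro continuous_intros)
      then show ?thesis by (rule continuous_map_from_subtopology[OF continuous_map_iff_continuous[THEN iffD2]])
    qed
    have "continuous_map ?S euclidean (\<lambda>A. coefs (cycle_values \<zeta> g (diag A)) (m, j))" for m j
    proof -
      have "coefs (cycle_values \<zeta> g (diag A)) (m, j) =
          coeff (\<Prod>C\<in>{C \<in> cycles g. card C = m}. [:- cycle_value \<zeta> (diag A) C, 1:]) j" for A
        by (simp add: coefs_def root_poly_def cycle_values_def prod_unfold_prod_mset image_mset.compositionality comp_def)
      then show ?thesis using continuous_map_coeff_prod[OF cont] by simp
    qed
    then have 2: "continuous_map ?S (product_topology (\<lambda>_. euclidean) UNIV) (\<lambda>A. coefs (cycle_values \<zeta> g (diag A)))"
      unfolding continuous_map_componentwise_UNIV by auto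
    show "continuous_map ?S (prod_topology (discrete_topology (labels CARD('n) k)) (product_topology (\<lambda>_. euclidean) UNIV)) (\<lambda>A. coef_map (b, A))"
      unfolding coef_map_def gz(1) prod.case continuous_map_pairwise comp_def fst_conv snd_conv
      using 1 2 unfolding gz(1) by blast
  qed
  have "coef_map z \<in> {((\<mu>, \<zeta>), c). \<exists>U. admissible \<mu> \<zeta> U \<and> c = coefs U}"
    if "z \<in> topspace (twisted_torus k :: 'n twisted_point topology)" for z
  proof -
    obtain g \<zeta> A where z: "z = ((g, \<zeta>), A)" by (metis surj_pair)
    obtain \<mu> \<zeta>' c where w: "coef_map z = ((\<mu>, \<zeta>'), c)" by (metis surj_pair)
    have "coef_map z \<in> topspace (coef_space CARD('n) k)"
      using coef_map_in[of g \<zeta> A k] that unfolding z by blast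
    then show ?thesis unfolding w topspace_coef_space by blast
  qed
  note c2 = this
  show ?thesis
    unfolding coef_space_def continuous_map_in_subtopology by (intro conjI c1 Pi_I) (rule c2)
qed

lemma Hausdorff_coef_space: "Hausdorff_space (coef_space n k)"
  unfolding coef_space_def
  by (intro Hausdorff_space_subtopology)
    (simp add: Hausdorff_space_prod_topology Hausdorff_space_product_topology)

lemma quotient_map_coef_map:
  assumes "k > 0"
  shows "quotient_map (twisted_torus k :: ('n::finite) twisted_point topology)
     (coef_space CARD('n) k) coef_map"
    and "compact_space (coef_space CARD('n) k)"
proof -
  let ?Z = "twisted_torus k :: 'n twisted_point topology"
  have surj: "coef_map ` topspace ?Z = topspace (coef_space CARD('n) k)"
  proof (intro equalityI subsetI)
    fix w assume "w \<in> coef_map ` topspace ?Z"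
    then obtain z where "z \<in> topspace ?Z" "w = coef_map z" by blast
    then show "w \<in> topspace (coef_space CARD('n) k)" using coef_map_in by (metis surj_pair)
  next
    fix w assume w: "w \<in> topspace (coef_space CARD('n) k)"
    obtain \<mu> \<zeta> c where "w = ((\<mu>, \<zeta>), c)" by (metis surj_pair)
    then obtain z where "z \<in> topspace ?Z" "coef_map z = w" using coef_map_surj assms w by blast
    then show "w \<in> coef_map ` topspace ?Z" by blast
  qed
  show "quotient_map ?Z (coef_space CARD('n) k) coef_map"
    by (rule continuous_imp_quotient_map[OF continuous_coef_map compact_twisted_torus[OF assms] Hausdorff_coef_space surj])
  have "compactin (coef_space CARD('n) k) (coef_map ` topspace ?Z)"
    using compact_twisted_torus[OF assms] unfolding compact_space_def by (rule image_compactin[OF _ continuous_coef_map])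
  then show "compact_space (coef_space CARD('n) k)" by (simp add: surj compact_space_def)
qed

text \<open>Both halves of the classification of orbits meet here. Nothing is lost in passing from
  \<open>\<eta>\<close> to \<open>\<theta> = \<eta> ^ d\<close>: every \<open>\<theta>\<close> with
  \<open>\<theta> ^ (k div d) = 1\<close> has a \<open>d\<close>-th root, which is automatically a
  \<open>k\<close>-th root of unity.\<close>

lemma quotient_class_eq_iff_related:
  fixes z z' :: "('n::finite) twisted_point"
  assumes k: "k > 0" "k dvd CARD('n)" and z: "z \<in> topspace (twisted_torus k)" "z' \<in> topspace (twisted_torus k)"
  shows "quotient_class k z = quotient_class k z' \<longleftrightarrow> rotation_related k (coef_map z) (coef_map z')"
proof -
  obtain g \<zeta> A where zz: "z = ((g, \<zeta>), A)" by (metis surj_pair)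
  obtain g' \<zeta>' A' where zz': "z' = ((g', \<zeta>'), A')" by (metis surj_pair)
  have Z: "bij g" "\<zeta> ^ k = 1" "A \<in> torus" "twisted \<zeta> g (diag A)"
    and Z': "bij g'" "\<zeta>' ^ k = 1" "A' \<in> torus" "twisted \<zeta>' g' (diag A')"
    using z unfolding zz zz' by (simp_all add: topspace_twisted_torus)
  let ?d = "root_ord \<zeta>" and ?U = "cycle_values \<zeta> g (diag A)" and ?U' = "cycle_values \<zeta>' g' (diag A')"
  have dk: "?d dvd k" using power_eq_1_iff_root_ord_dvd[OF k(1) Z(2)] Z(2) by blast
  have d0: "?d > 0" using root_ord_pos(1)[OF k(1) Z(2)] .
  have pow: "\<eta> ^ k = (\<eta> ^ ?d) ^ (k div ?d)" for \<eta> :: complex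
    using dk by (simp flip: power_mult)
  have size: "size (?U m) = count (cycle_type g) m" for m
    using coef_map_admissible[OF Z(1,3,4)] unfolding admissible_def by blast
  have scale: "(\<forall>m j. coefs ?U' (m, j) = \<theta> ^ (count (cycle_type g) m - j) * coefs ?U (m, j)) \<longleftrightarrow>
      (\<forall>m. ?U' m = image_mset ((*) \<theta>) (?U m))" for \<theta>
  proof -
    have "(\<forall>j. coefs ?U' (m, j) = \<theta> ^ (count (cycle_type g) m - j) * coefs ?U (m, j)) \<longleftrightarrow>
        root_poly (?U' m) = root_poly (image_mset ((*) \<theta>) (?U m))" for m
      unfolding poly_eq_iff coeff_root_poly_scale size by (simp add: coefs_def)
    then show ?thesis unfolding root_poly_eq_iff by blast
  qed
  have rel: "rotation_related k (coef_map z) (coef_map z') \<longleftrightarrow> cycle_type g' = cycle_type g \<and> \<zeta>' = \<zeta> \<and>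
      (\<exists>\<theta>. \<theta> ^ (k div ?d) = 1 \<and> (\<forall>m. ?U' m = image_mset ((*) \<theta>) (?U m)))"
    unfolding rotation_related_def coef_map_def zz zz' prod.case scale ..
  show ?thesis
    unfolding rel
  proof
    assume "quotient_class k z = quotient_class k z'"
    then obtain \<alpha> \<eta> where a: "bij \<alpha>" "\<eta> ^ k = 1" "\<And>x. g' (\<alpha> x) = \<alpha> (g x)" "\<And>x. diag A' (\<alpha> x) = \<eta> * diag A x"
      using quotient_class_eq_iff[OF k] z unfolding zz zz' by blast
    note c = cycle_values_conj[OF Z(1) Z'(1) Z(4) Z'(4) a(1,3,4)]
    have "(\<eta> ^ ?d) ^ (k div ?d) = 1" using pow a(2) by metis
    then show "cycle_type g' = cycle_type g \<and> \<zeta>' = \<zeta> \<and>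
      (\<exists>\<theta>. \<theta> ^ (k div ?d) = 1 \<and> (\<forall>m. ?U' m = image_mset ((*) \<theta>) (?U m)))"
      using c by blast
  next
    assume "cycle_type g' = cycle_type g \<and> \<zeta>' = \<zeta> \<and>
      (\<exists>\<theta>. \<theta> ^ (k div ?d) = 1 \<and> (\<forall>m. ?U' m = image_mset ((*) \<theta>) (?U m)))"
    then obtain \<theta> where th: "\<zeta>' = \<zeta>" "\<theta> ^ (k div ?d) = 1" "\<And>m. ?U' m = image_mset ((*) \<theta>) (?U m)" by blast
    obtain \<eta> where \<eta>: "\<eta> ^ ?d = \<theta>" using nth_root_exists[OF d0, of \<theta>] by blast
    then have \<eta>k: "\<eta> ^ k = 1" using pow th(2) by metis
    have "cycle_values \<zeta> g' (diag A') m = image_mset ((*) (\<eta> ^ ?d)) (?U m)" for m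
      using th(3)[of m] unfolding th(1) \<eta> .
    then obtain \<alpha> where "bij \<alpha>" "\<And>x. g' (\<alpha> x) = \<alpha> (g x)" "\<And>x. diag A' (\<alpha> x) = \<eta> * diag A x"
      using ex_conj_of_cycle_values[OF Z(1) Z'(1) Z(4) Z'(4)[unfolded th(1)] norm_eq_1_if_power[OF \<eta>k k(1)]] by blast
    then show "quotient_class k z = quotient_class k z'"
      using quotient_class_eq_iff[OF k] z \<eta>k unfolding zz zz' by blast
  qed
qed

section \<open>The damping deformation on the coefficient space\<close>

definition damp_map :: "real \<Rightarrow> coef_point \<Rightarrow> coef_point" where
  "damp_map s = (\<lambda>((\<mu>, \<zeta>), c). ((\<mu>, \<zeta>), \<lambda>(m, j). damp s (count \<mu> m) j * c (m, j)))"

lemma damp_map_in: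
  assumes x: "x \<in> topspace (coef_space n k)" and s: "s \<in> {0..1}"
  shows "damp_map s x \<in> topspace (coef_space n k)"
proof -
  obtain \<mu> \<zeta> c where xx: "x = ((\<mu>, \<zeta>), c)" by (metis surj_pair)
  obtain U where U: "(\<mu>, \<zeta>) \<in> labels n k" "admissible \<mu> \<zeta> U" "c = coefs U"
    using x unfolding xx topspace_coef_space by blast
  have adm: "\<And>m. size (U m) = count \<mu> m" "\<And>m. set_mset (U m) \<subseteq> circle"
    "(\<Prod>m\<in>set_mset \<mu>. prod_mset (U m) ^ (m div root_ord \<zeta>)) = twist_det \<mu> \<zeta>"
    using U(2) unfolding admissible_def by blast+
  have "\<forall>m. \<exists>V. set_mset V \<subseteq> circle \<and> size V = size (U m) \<and> prod_mset V = prod_mset (U m) \<and>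
      (\<forall>j. coeff (root_poly V) j = damp s (size (U m)) j * coeff (root_poly (U m)) j)"
    using ex_damped_roots[OF adm(2)] s by simp
  then obtain V where V: "\<forall>m. set_mset (V m) \<subseteq> circle \<and> size (V m) = size (U m) \<and> prod_mset (V m) = prod_mset (U m) \<and>
      (\<forall>j. coeff (root_poly (V m)) j = damp s (size (U m)) j * coeff (root_poly (U m)) j)"
    by (rule choice[THEN exE])
  have "admissible \<mu> \<zeta> V" unfolding admissible_def using V adm by simp
  moreover have "(\<lambda>(m, j). damp s (count \<mu> m) j * c (m, j)) = coefs V"
    using V adm(1) by (auto simp: U(3) coefs_def)
  ultimately show ?thesis using U(1) unfolding xx damp_map_def prod.case topspace_coef_space by blast
qed

lemma continuous_damp_map:
  "continuous_map (prod_topology (top_of_set {0..1::real}) (coef_space n k)) (coef_space n k) (\<lambda>(s, x). damp_map s x)"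
proof -
  let ?I = "top_of_set {0..1::real}" and ?D = "discrete_topology (labels n k)"
  let ?L = "coef_space n k" and ?P = "product_topology (\<lambda>_::nat \<times> nat. euclidean :: complex topology) UNIV"
  have fst: "continuous_map (prod_topology ?I ?L) ?D (\<lambda>z. fst (snd z))"
    by (rule continuous_map_compose[OF continuous_map_snd, unfolded comp_def])
       (simp add: coef_space_def continuous_map_from_subtopology continuous_map_fst)
  have snd: "continuous_map (prod_topology ?I ?L) euclidean (\<lambda>z. snd (snd z) (m, j))" for m j
  proof -
    have "continuous_map ?L ?P snd"
      by (simp add: coef_space_def continuous_map_from_subtopology continuous_map_snd)
    then have "continuous_map ?L euclidean (\<lambda>x. snd x (m, j))"
      unfolding continuous_map_componentwise_UNIV by blast
    then show ?thesis by (rule continuous_map_compose[OF continuous_map_snd, unfolded comp_def])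
  qed
  have damp: "continuous_map (prod_topology ?I ?L) euclidean (\<lambda>z. damp (fst z) (count (fst (fst (snd z))) m) j)" for m j
  proof -
    \<comment> \<open>The discrete factor is put first to argue label by label: the multiplicity in
      the exponents is then constant and only \<open>s\<close> varies.\<close>
    have "continuous_map (subtopology (prod_topology ?D ?I) UNIV) euclidean (\<lambda>w. damp (snd w) (count (fst (fst w)) m) j)"
    proof (rule continuous_map_discrete_prod)
      fix b :: "nat multiset \<times> complex"
      have "1 + s ^ r \<noteq> 0" if "s \<in> {0..1}" for s :: real and r
      proof -
        have "0 \<le> s ^ r" using that by simp
        then show ?thesis by linarith
      qed
      then have "continuous_on {0..1} (\<lambda>s. damp s (count (fst b) m) j)"
        unfolding damp_def by (intro continuous_intros) auto
      then show "continuous_map (subtopology ?I {x. (b, x) \<in> UNIV}) euclidean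
          (\<lambda>s. damp (snd (b, s)) (count (fst (fst (b, s))) m) j)" by simp
    qed
    then have *: "continuous_map (prod_topology ?D ?I) euclidean (\<lambda>w. damp (snd w) (count (fst (fst w)) m) j)"
      by (simp only: subtopology_UNIV)
    have "continuous_map (prod_topology ?I ?L) (prod_topology ?D ?I) (\<lambda>z. (fst (snd z), fst z))"
      using fst by (simp add: continuous_map_pairwise comp_def continuous_map_fst[unfolded comp_def])
    from continuous_map_compose[OF this *] show ?thesis by (simp add: comp_def)
  qed
  have eq: "damp_map s x = (fst x, \<lambda>(m, j). damp s (count (fst (fst x)) m) j * snd x (m, j))" for s x
    by (simp add: damp_map_def case_prod_unfold)
  have "continuous_map (prod_topology ?I ?L) ?P (\<lambda>z. \<lambda>(m, j). damp (fst z) (count (fst (fst (snd z))) m) j * snd (snd z) (m, j))"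
    unfolding continuous_map_componentwise_UNIV
    using damp snd by (auto intro!: continuous_map_field_mult)
  note snd' = this
  have eq': "(\<lambda>(s, x). damp_map s x) =
      (\<lambda>z. (fst (snd z), \<lambda>(m, j). damp (fst z) (count (fst (fst (snd z))) m) j * snd (snd z) (m, j)))"
    by (simp add: fun_eq_iff eq)
  have c1: "continuous_map (prod_topology ?I ?L) (prod_topology ?D ?P) (\<lambda>(s, x). damp_map s x)"
    unfolding eq' continuous_map_pairwise comp_def fst_conv snd_conv using fst snd' by (rule conjI)
  have "(\<lambda>(s, x). damp_map s x) z \<in> {((\<mu>, \<zeta>), c). \<exists>U. admissible \<mu> \<zeta> U \<and> c = coefs U}"
    if "z \<in> topspace (prod_topology ?I ?L)" for z
  proof -
    obtain s x where z: "z = (s, x)" by (cases z)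
    obtain \<mu> \<zeta> c where w: "damp_map s x = ((\<mu>, \<zeta>), c)" by (metis surj_pair)
    have "damp_map s x \<in> topspace ?L" using damp_map_in[of x n k s] that z by simp
    then show ?thesis unfolding z prod.case w topspace_coef_space by blast
  qed
  note c2 = this
  have "continuous_map (prod_topology ?I ?L)
      (subtopology (prod_topology ?D ?P) {((\<mu>, \<zeta>), c). \<exists>U. admissible \<mu> \<zeta> U \<and> c = coefs U}) (\<lambda>(s, x). damp_map s x)"
    unfolding continuous_map_in_subtopology by (intro conjI c1 Pi_I) (rule c2)
  then show ?thesis by (simp only: coef_space_def)
qed

lemma damp_1: "damp 1 r j = 1"
  by (simp add: damp_def)

lemma damp_const: "0 \<le> s \<Longrightarrow> damp s r 0 = 1"
proof -
  assume "0 \<le> s"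
  then have "0 \<le> s ^ r" by simp
  then have "1 + s ^ r \<noteq> 0" by linarith
  then have "(s ^ 0 + s ^ (r - 0)) / (1 + s ^ r) = 1" by simp
  then show ?thesis unfolding damp_def by (simp only: of_real_1)
qed

text \<open>Damping and rotation both act by scalars on each coefficient, hence they
  commute.\<close>

lemma rotation_related_damp:
  assumes "rotation_related k x y"
  shows "rotation_related k (damp_map s x) (damp_map s y)"
proof -
  obtain \<mu> \<zeta> c where x: "x = ((\<mu>, \<zeta>), c)" by (metis surj_pair)
  obtain \<mu>' \<zeta>' c' where y: "y = ((\<mu>', \<zeta>'), c')" by (metis surj_pair)
  show ?thesis
    using assms unfolding x y rotation_related_def damp_map_def prod.case by (auto simp: mult.left_commute)
qed

section \<open>Counting the components\<close>

lemma sum_mset_eq_sum_count: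
  assumes "finite A" "set_mset \<mu> \<subseteq> A"
  shows "sum_mset \<mu> = (\<Sum>m\<in>A. m * count \<mu> m :: nat)"
  using assms(2)
proof (induction \<mu>)
  case (add x \<mu>)
  have "(\<Sum>m\<in>A. m * count (add_mset x \<mu>) m) = (\<Sum>m\<in>A. m * count \<mu> m + (if m = x then x else 0))"
    by (intro sum.cong) auto
  then show ?case using add assms(1) by (simp add: sum.distrib)
qed simp

text \<open>The number from \<open>ex_torus_orbit_map\<close> for the exponents
  \<open>m div d\<close>, whose gcd is \<open>g div d\<close>, the group of order
  \<open>k div d\<close> and \<open>h = n div g\<close>.\<close>

definition component_count :: "nat \<Rightarrow> nat \<Rightarrow> nat multiset \<Rightarrow> complex \<Rightarrow> nat" where
  "component_count n k \<mu> \<zeta> = (let d = root_ord \<zeta>; g = parts_gcd \<mu> in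
     (g div d) div ((k div d) div gcd (k div d) (n div g)))"

lemma parts_gcd_facts:
  assumes "\<mu> \<in> partitions n" "n > 0"
  shows "parts_gcd \<mu> > 0" "parts_gcd \<mu> dvd n" "n div parts_gcd \<mu> > 0" "\<And>m. m \<in># \<mu> \<Longrightarrow> parts_gcd \<mu> dvd m"
proof -
  have s: "sum_mset \<mu> = n" using assms(1) by (simp add: partitions_def)
  show dvd: "parts_gcd \<mu> dvd m" if "m \<in># \<mu>" for m using that by (simp add: parts_gcd_def)
  have "sum_mset \<mu> = (\<Sum>m\<in>set_mset \<mu>. m * count \<mu> m)" by (rule sum_mset_eq_sum_count) auto
  then show dn: "parts_gcd \<mu> dvd n" using dvd s by (auto intro: dvd_sum dvd_mult2)
  then show "parts_gcd \<mu> > 0" "n div parts_gcd \<mu> > 0" using assms(2) by (auto elim: dvdE)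
qed

abbreviation component_set :: "nat \<Rightarrow> nat \<Rightarrow> nat multiset \<Rightarrow> (complex \<times> nat) set" where
  "component_set n k \<mu> \<equiv> SIGMA \<zeta>:{\<zeta>. (\<mu>, \<zeta>) \<in> labels n k}. {..<component_count n k \<mu> \<zeta>}"

text \<open>Rotating all \<open>count \<mu> m\<close> values rotates their product by that power, so
  the weights are multiplicities. The sum of \<open>(m div d) * count \<mu> m\<close> is
  \<open>n div d\<close>, which equals \<open>(g div d) * (n div g)\<close> and identifies
  \<open>h\<close>. It is divisible by \<open>k div d\<close> because \<open>k\<close> divides
  \<open>n\<close>.\<close>

lemma ex_component_map:
  assumes lab: "(\<mu>, \<zeta>) \<in> labels n k" and n: "n > 0" and k: "k > 0" "k dvd n"
  shows "\<exists>F. torus_orbit_map (set_mset \<mu>) (\<lambda>m. m div root_ord \<zeta>) (count \<mu>) (k div root_ord \<zeta>)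
    (twist_det \<mu> \<zeta>) (component_count n k \<mu> \<zeta>) F"
proof -
  let ?d = "root_ord \<zeta>" and ?g = "parts_gcd \<mu>"
  let ?a = "\<lambda>m. m div ?d"
  note L = labelsD[OF lab n k(1)]
  have part: "\<mu> \<in> partitions n" using lab by (simp add: labels_def)
  note G = parts_gcd_facts[OF part n]
  have "(*) ?d ` ?a ` set_mset \<mu> = set_mset \<mu>"
    using L(5) by (force simp: image_image)
  then have dG: "?g = ?d * Gcd (?a ` set_mset \<mu>)"
    using Gcd_mult[of ?d "?a ` set_mset \<mu>"] by (simp add: parts_gcd_def)
  then have Gd: "Gcd (?a ` set_mset \<mu>) = ?g div ?d" using L(3) by simp
  have "?d * (\<Sum>m\<in>set_mset \<mu>. ?a m * count \<mu> m) = (\<Sum>m\<in>set_mset \<mu>. m * count \<mu> m)"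
    unfolding sum_distrib_left using L(5) by (intro sum.cong) (auto simp: mult.assoc[symmetric])
  also have "\<dots> = n" using sum_mset_eq_sum_count[of "set_mset \<mu>" \<mu>] L(7) by simp
  also have "n = ?d * (Gcd (?a ` set_mset \<mu>) * (n div ?g))"
    using G(2) dG by (metis dvd_mult_div_cancel mult.assoc)
  finally have sum: "(\<Sum>m\<in>set_mset \<mu>. ?a m * count \<mu> m) = Gcd (?a ` set_mset \<mu>) * (n div ?g)"
    using L(3) by simp
  have "n = ?d * (Gcd (?a ` set_mset \<mu>) * (n div ?g))"
    using G(2) dG by (metis dvd_mult_div_cancel mult.assoc)
  moreover have "k = ?d * (k div ?d)" using L(4) by simp
  ultimately have "?d * (k div ?d) dvd ?d * (Gcd (?a ` set_mset \<mu>) * (n div ?g))" using k(2) by metis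
  then have K: "k div ?d dvd Gcd (?a ` set_mset \<mu>) * (n div ?g)" using L(3) by simp
  have K0: "k div ?d > 0" using L(3,4) k(1) by (auto elim: dvdE)
  obtain m where "m \<in># \<mu>" using L(1) by blast
  then have "?a m > 0" using L(2,3) L(5)[of m] by (simp add: div_greater_zero_iff dvd_imp_le)
  then have "\<exists>m\<in>set_mset \<mu>. ?a m > 0" using \<open>m \<in># \<mu>\<close> by blast
  from ex_torus_orbit_map[OF finite_set_mset this K0 sum K L(8)]
  show ?thesis unfolding component_count_def Let_def Gd .
qed

text \<open>The order of \<open>\<zeta>\<close> has to divide \<open>k\<close> and every part, hence
  their gcd. So the labels over a fixed \<open>\<mu>\<close> are the index set of
  \<open>sum_component_count\<close>.\<close>

lemma labels_roots:
  assumes part: "\<mu> \<in> partitions n" and k: "k > 0"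
  shows "(\<mu>, \<zeta>) \<in> labels n k \<longleftrightarrow> \<zeta> ^ gcd (parts_gcd \<mu>) k = 1"
proof
  assume lab: "(\<mu>, \<zeta>) \<in> labels n k"
  then have p: "\<zeta> ^ k = 1" "\<And>m. m \<in># \<mu> \<Longrightarrow> \<zeta> ^ m = 1" by (auto simp: labels_def)
  show "\<zeta> ^ gcd (parts_gcd \<mu>) k = 1"
  proof -
    note r = power_eq_1_iff_root_ord_dvd[OF k p(1)]
    have "root_ord \<zeta> dvd parts_gcd \<mu>" unfolding parts_gcd_def using p(2) r by (auto intro: Gcd_greatest)
    moreover have "root_ord \<zeta> dvd k" using p(1) r by blast
    ultimately show ?thesis unfolding r by simp
  qed
next
  assume z: "\<zeta> ^ gcd (parts_gcd \<mu>) k = 1"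
  have one: "\<zeta> ^ l = 1" if "gcd (parts_gcd \<mu>) k dvd l" for l
    using z that by (metis dvdE power_mult power_one)
  have "gcd (parts_gcd \<mu>) k dvd m" if "m \<in># \<mu>" for m
    using that by (auto simp: parts_gcd_def intro: dvd_trans[OF gcd_dvd1] Gcd_dvd)
  then show "(\<mu>, \<zeta>) \<in> labels n k" using part one by (auto simp: labels_def)
qed

text \<open>The components of all \<open>\<zeta>\<close> over one \<open>\<mu>\<close> are pooled.
  Their total comes from \<open>sum_component_count\<close> with \<open>h = n div g\<close>, and for
  a discrete space the cardinality suffices.\<close>

lemma ex_component_bij:
  assumes part: "\<mu> \<in> partitions n" and n: "n > 0" and k: "k > 0" "k dvd n"
  shows "\<exists>\<beta>. bij_betw \<beta> (component_set n k \<mu>) {..<Y_card n k \<mu>}"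
proof -
  let ?g = "parts_gcd \<mu>"
  note G = parts_gcd_facts[OF part n]
  have roots: "{\<zeta>. (\<mu>, \<zeta>) \<in> labels n k} = {\<zeta>. \<zeta> ^ gcd ?g k = 1}" using labels_roots[OF part k(1)] by blast
  have fin: "finite {\<zeta>::complex. \<zeta> ^ gcd ?g k = 1}"
    using k(1) by (intro finite_roots_unity) (simp add: Suc_le_eq)
  have gh: "?g * (n div ?g) = n" using G(2) by simp
  have "(\<Sum>\<zeta> | \<zeta> ^ gcd ?g k = 1. component_count n k \<mu> \<zeta>) = Y_card n k \<mu>"
    using sum_component_count[OF G(1,3) k(1)] k(2) gh
    unfolding component_count_def Let_def Y_card_def common_gcd_def by simp
  then have "card (component_set n k \<mu>) = card {..<Y_card n k \<mu>}"
    unfolding roots using fin by simp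
  then show ?thesis
    using finite_same_card_bij[of "component_set n k \<mu>" "{..<Y_card n k \<mu>}"]
    unfolding roots using fin by blast
qed

text \<open>The sign turns the constant coefficient of a monic polynomial into the product of its
  roots. The restriction to the parts makes the result a point of
  \<open>circle_power\<close>.\<close>

definition const_terms :: "nat multiset \<Rightarrow> (nat \<times> nat \<Rightarrow> complex) \<Rightarrow> nat \<Rightarrow> complex" where
  "const_terms \<mu> c = (\<lambda>m\<in>set_mset \<mu>. (- 1) ^ count \<mu> m * c (m, 0))"

lemma prod_mset_circle: "set_mset U \<subseteq> circle \<Longrightarrow> prod_mset U \<in> circle"
  by (induction U) (simp_all add: norm_mult)

lemma const_terms_coefs:
  assumes "admissible \<mu> \<zeta> U"
  shows "const_terms \<mu> (coefs U) = (\<lambda>m\<in>set_mset \<mu>. prod_mset (U m))"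
proof -
  have "size (U m) = count \<mu> m" for m using assms unfolding admissible_def by blast
  moreover have "(- 1) ^ r * ((- 1) ^ r * z) = z" for r and z :: complex
    by (simp add: mult.assoc[symmetric] flip: power_mult_distrib)
  ultimately show ?thesis by (simp add: const_terms_def coefs_def coeff_0_root_poly)
qed

lemma const_terms_in:
  assumes "admissible \<mu> \<zeta> U"
  shows "const_terms \<mu> (coefs U) \<in> {p \<in> topspace (circle_power (set_mset \<mu>)).
    mono_eval (set_mset \<mu>) (\<lambda>m. m div root_ord \<zeta>) p = twist_det \<mu> \<zeta>}"
proof -
  have "prod_mset (U m) \<in> circle" for m using assms prod_mset_circle unfolding admissible_def by blast
  then have "(\<lambda>m\<in>set_mset \<mu>. prod_mset (U m)) \<in> topspace (circle_power (set_mset \<mu>))" by simp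
  moreover have "mono_eval (set_mset \<mu>) (\<lambda>m. m div root_ord \<zeta>) (\<lambda>m\<in>set_mset \<mu>. prod_mset (U m)) = twist_det \<mu> \<zeta>"
    using assms unfolding admissible_def mono_eval_def by simp
  ultimately show ?thesis unfolding const_terms_coefs[OF assms] by blast
qed

lemma ex_coefs_of_const_terms:
  assumes p: "p \<in> topspace (circle_power (set_mset \<mu>))"
    and eq: "mono_eval (set_mset \<mu>) (\<lambda>m. m div root_ord \<zeta>) p = twist_det \<mu> \<zeta>"
  shows "\<exists>U. admissible \<mu> \<zeta> U \<and> const_terms \<mu> (coefs U) = p"
proof -
  \<comment> \<open>One root carries the whole prescribed product and the others are
    \<open>1\<close>; the size is right because \<open>count \<mu> m\<close> is positive on the
    parts.\<close>
  define U where "U = (\<lambda>m. if m \<in># \<mu> then add_mset (p m) (replicate_mset (count \<mu> m - 1) 1) else {#})"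
  have prod: "prod_mset (U m) = p m" if "m \<in># \<mu>" for m using that by (simp add: U_def prod_mset_replicate_mset)
  have "size (U m) = count \<mu> m" for m by (auto simp: U_def not_in_iff)
  moreover have "set_mset (U m) \<subseteq> circle" for m using p by (auto simp: U_def PiE_iff)
  moreover have "(\<Prod>m\<in>set_mset \<mu>. prod_mset (U m) ^ (m div root_ord \<zeta>)) = twist_det \<mu> \<zeta>"
    using eq by (simp add: mono_eval_def prod)
  ultimately have adm: "admissible \<mu> \<zeta> U" by (simp add: admissible_def)
  moreover have "(\<lambda>m\<in>set_mset \<mu>. prod_mset (U m)) = p"
    using p prod by (auto simp: PiE_iff extensional_def fun_eq_iff)
  ultimately show ?thesis using const_terms_coefs[OF adm] by metis
qed

lemma const_terms_damp: "const_terms \<mu> (\<lambda>(m, j). damp 0 (count \<mu> m) j * c (m, j)) = const_terms \<mu> c"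
  by (simp add: const_terms_def damp_const)

text \<open>At \<open>s = 0\<close> every coefficient strictly between the ends is erased. The
  leading coefficient is \<open>1\<close> and meets the factor \<open>\<theta> ^ 0\<close>, so only
  the constant terms are compared, with the multiplicities as weights.\<close>

lemma damped_rotation_iff:
  assumes U: "admissible \<mu> \<zeta> U" and U': "admissible \<mu> \<zeta> U'"
  shows "rotation_related k (damp_map 0 ((\<mu>, \<zeta>), coefs U)) (damp_map 0 ((\<mu>, \<zeta>), coefs U')) \<longleftrightarrow>
    rotated (set_mset \<mu>) (k div root_ord \<zeta>) (count \<mu>) (const_terms \<mu> (coefs U)) (const_terms \<mu> (coefs U'))"
proof -
  have size: "size (U m) = count \<mu> m" "size (U' m) = count \<mu> m" for m
    using U U' unfolding admissible_def by blast+
  have "(\<forall>m j. damp 0 (count \<mu> m) j * coefs U' (m, j) = \<theta> ^ (count \<mu> m - j) * (damp 0 (count \<mu> m) j * coefs U (m, j)))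
    \<longleftrightarrow> (\<forall>m\<in>set_mset \<mu>. const_terms \<mu> (coefs U') m = \<theta> ^ count \<mu> m * const_terms \<mu> (coefs U) m)" for \<theta>
  proof -
    have "(\<forall>j. damp 0 (count \<mu> m) j * coefs U' (m, j) = \<theta> ^ (count \<mu> m - j) * (damp 0 (count \<mu> m) j * coefs U (m, j)))
      \<longleftrightarrow> (m \<in># \<mu> \<longrightarrow> coefs U' (m, 0) = \<theta> ^ count \<mu> m * coefs U (m, 0))" (is "(\<forall>j. ?E j) \<longleftrightarrow> ?R") for m
    proof (cases "m \<in># \<mu>")
      case False
      then have "U m = {#}" "U' m = {#}" "count \<mu> m = 0" using size[of m] by (simp_all add: not_in_iff)
      then show ?thesis using False by (simp add: coefs_def)
    next
      case True
      define r where "r = count \<mu> m"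
      have r: "r > 0" using True by (simp add: r_def)
      have E0: "?E 0 \<longleftrightarrow> ?R" using True by (simp add: damp_const)
      have "?E j" if "j > 0" for j
      proof -
        consider "j < r" | "j = r" | "j > r" by linarith
        then show ?thesis
        proof cases
          case 1
          then have "damp 0 r j = 0" using that by (simp add: damp_def power_0_left)
          then show ?thesis by (simp add: r_def)
        next
          case 2
          then have "coefs U (m, j) = 1" "coefs U' (m, j) = 1"
            using lead_coeff_root_poly[of "U m"] lead_coeff_root_poly[of "U' m"] size[of m]
            by (simp_all add: coefs_def r_def)
          then show ?thesis using 2 by (simp add: r_def)
        next
          case 3
          then have "coefs U (m, j) = 0" "coefs U' (m, j) = 0"
            using size[of m] by (simp_all add: coefs_def r_def coeff_root_poly_gt)
          then show ?thesis by simp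
        qed
      qed
      then show ?thesis using E0 by (metis gr0I)
    qed
    moreover have "const_terms \<mu> (coefs U') m = \<theta> ^ count \<mu> m * const_terms \<mu> (coefs U) m \<longleftrightarrow>
        coefs U' (m, 0) = \<theta> ^ count \<mu> m * coefs U (m, 0)" if "m \<in># \<mu>" for m
    proof -
      have e: "const_terms \<mu> (coefs U') m = (- 1) ^ count \<mu> m * coefs U' (m, 0)"
        "\<theta> ^ count \<mu> m * const_terms \<mu> (coefs U) m = (- 1) ^ count \<mu> m * (\<theta> ^ count \<mu> m * coefs U (m, 0))"
        using that by (simp_all add: const_terms_def)
      show ?thesis unfolding e by simp
    qed
    ultimately show ?thesis by blast
  qed
  then show ?thesis
    unfolding rotation_related_def damp_map_def rotated_def prod.case by simp
qed

text \<open>On the coefficient space \<open>L\<close> the map \<open>q\<close> divides by rotations,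
  while \<open>f\<close> reads only the label and the constant terms. Damping to
  \<open>s = 0\<close> leaves \<open>f\<close> unchanged, and on damped points the identifications
  made by \<open>q\<close> are exactly those made by \<open>f\<close>. This is the situation of
  \<open>homotopy_equivalent_quotients\<close>.\<close>

theorem extended_quotient_components:
  fixes n k :: nat
  assumes n: "CARD('n::finite) = n" and k: "k > 0" "k dvd n"
  shows "extended_quotient Weyl Weyl_action (torus_mod k :: (complex^'n^'n) set topology)
           homotopy_equivalent_space
         sum_topology
           (\<lambda>\<mu>. prod_topology (power_circle (distinct_parts \<mu> - 1))
                              (discrete_topology {..<Y_card n k \<mu>}))
           (partitions n)"
proof -
  let ?E = "extended_quotient Weyl Weyl_action (torus_mod k :: (complex^'n^'n) set topology)"
  let ?Z = "twisted_torus k :: 'n twisted_point topology"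
  let ?P = "product_topology (\<lambda>_::nat \<times> nat. euclidean :: complex topology) UNIV"
  let ?T = "{((\<mu>, \<zeta>), c). \<exists>U. admissible \<mu> \<zeta> U \<and> c = coefs U}"
  define L where "L = coef_space n k"
  have L: "L = subtopology (prod_topology (discrete_topology (labels n k)) ?P) ?T"
    by (simp add: L_def coef_space_def)
  define Y where "Y = (\<lambda>\<mu>. prod_topology (power_circle (distinct_parts \<mu> - 1)) (discrete_topology {..<Y_card n k \<mu>}))"
  define M where "M = sum_topology Y (partitions n)"
  have n0: "n > 0" using n by auto
  have k': "k dvd CARD('n)" using k n by simp
  have Lcases: "\<exists>\<mu> \<zeta> U. x = ((\<mu>, \<zeta>), coefs U) \<and> (\<mu>, \<zeta>) \<in> labels n k \<and> admissible \<mu> \<zeta> U"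
    if "x \<in> topspace L" for x
  proof -
    obtain \<mu> \<zeta> c where x: "x = ((\<mu>, \<zeta>), c)" by (metis surj_pair)
    then show ?thesis using that unfolding L_def x topspace_coef_space by blast
  qed
  have Lin: "((\<mu>, \<zeta>), coefs U) \<in> topspace L" if "(\<mu>, \<zeta>) \<in> labels n k" "admissible \<mu> \<zeta> U" for \<mu> \<zeta> U
    using that unfolding L_def topspace_coef_space by blast
  have \<Theta>: "quotient_map ?Z L coef_map" and Lcomp: "compact_space L"
    using quotient_map_coef_map[OF k(1), where 'n = 'n] unfolding L_def n by blast+
  have cls: "quotient_map ?Z ?E (quotient_class k)" by (rule quotient_map_quotient_class[OF k(1) k'])
  have refl: "rotation_related k x x" for x
    unfolding rotation_related_def by (auto intro!: exI[of _ 1] split: prod.splits)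
  \<comment> \<open>The class factors through the coefficients, since points with equal coefficients
    are related by the trivial rotation.\<close>
  have "\<exists>q. continuous_map L ?E q \<and> (\<forall>z\<in>topspace ?Z. q (coef_map z) = quotient_class k z)"
  proof (rule quotient_map_lift_exists[OF \<Theta> quotient_imp_continuous_map[OF cls]])
    fix z z' :: "'n twisted_point"
    assume "z \<in> topspace ?Z" "z' \<in> topspace ?Z" "coef_map z = coef_map z'"
    then show "quotient_class k z = quotient_class k z'"
      using quotient_class_eq_iff_related[OF k(1) k'] refl by metis
  qed blast
  then obtain q where q: "continuous_map L ?E q" "\<And>z. z \<in> topspace ?Z \<Longrightarrow> q (coef_map z) = quotient_class k z"
    by blast
  have "quotient_map ?Z ?E (q \<circ> coef_map)"
    by (rule quotient_map_eq[OF cls]) (simp add: q(2))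
  then have qq: "quotient_map L ?E q"
    by (rule quotient_map_from_composition[OF quotient_imp_continuous_map[OF \<Theta>] q(1)])
  have qiff: "q x = q y \<longleftrightarrow> rotation_related k x y" if xy: "x \<in> topspace L" "y \<in> topspace L" for x y
  proof -
    obtain z where z: "z \<in> topspace ?Z" "x = coef_map z"
      using quotient_imp_surjective_map[OF \<Theta>] xy(1) by blast
    obtain z' where z': "z' \<in> topspace ?Z" "y = coef_map z'"
      using quotient_imp_surjective_map[OF \<Theta>] xy(2) by blast
    show ?thesis unfolding z(2) z'(2) q(2)[OF z(1)] q(2)[OF z'(1)]
      by (rule quotient_class_eq_iff_related[OF k(1) k' z(1) z'(1)])
  qed
  define S where "S = (\<lambda>(\<mu>, \<zeta>). {p \<in> topspace (circle_power (set_mset \<mu>)).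
      mono_eval (set_mset \<mu>) (\<lambda>m. m div root_ord \<zeta>) p = twist_det \<mu> \<zeta>})"
  define W where "W = (\<lambda>(\<mu>, \<zeta>). prod_topology (power_circle (distinct_parts \<mu> - 1))
      (discrete_topology {..<component_count n k \<mu> \<zeta>}))"
  have "\<forall>b\<in>labels n k. \<exists>F. torus_orbit_map (set_mset (fst b)) (\<lambda>m. m div root_ord (snd b)) (count (fst b))
      (k div root_ord (snd b)) (twist_det (fst b) (snd b)) (component_count n k (fst b) (snd b)) F"
    using ex_component_map[OF _ n0 k] by (auto split: prod.splits)
  then obtain F where F: "\<forall>b\<in>labels n k. torus_orbit_map (set_mset (fst b)) (\<lambda>m. m div root_ord (snd b)) (count (fst b))
      (k div root_ord (snd b)) (twist_det (fst b) (snd b)) (component_count n k (fst b) (snd b)) (F b)"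
    by (rule bchoice[THEN exE])
  have Fb: "continuous_map (subtopology (circle_power (set_mset \<mu>)) (S (\<mu>, \<zeta>))) (W (\<mu>, \<zeta>)) (F (\<mu>, \<zeta>))"
    "F (\<mu>, \<zeta>) ` S (\<mu>, \<zeta>) = topspace (W (\<mu>, \<zeta>))"
    "\<And>p p'. p \<in> S (\<mu>, \<zeta>) \<Longrightarrow> p' \<in> S (\<mu>, \<zeta>) \<Longrightarrow>
      F (\<mu>, \<zeta>) p = F (\<mu>, \<zeta>) p' \<longleftrightarrow> rotated (set_mset \<mu>) (k div root_ord \<zeta>) (count \<mu>) p p'"
    if "(\<mu>, \<zeta>) \<in> labels n k" for \<mu> \<zeta>
  proof -
    have t: "torus_orbit_map (set_mset \<mu>) (\<lambda>m. m div root_ord \<zeta>) (count \<mu>) (k div root_ord \<zeta>)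
        (twist_det \<mu> \<zeta>) (component_count n k \<mu> \<zeta>) (F (\<mu>, \<zeta>))" using F that by force
    have SW: "S (\<mu>, \<zeta>) = {p \<in> topspace (circle_power (set_mset \<mu>)).
        mono_eval (set_mset \<mu>) (\<lambda>m. m div root_ord \<zeta>) p = twist_det \<mu> \<zeta>}"
      "W (\<mu>, \<zeta>) = prod_topology (power_circle (card (set_mset \<mu>) - 1)) (discrete_topology {..<component_count n k \<mu> \<zeta>})"
      by (simp_all add: S_def W_def distinct_parts_def)
    note t' = t[unfolded torus_orbit_map_def Let_def SW(1)[symmetric] SW(2)[symmetric]]
    show "continuous_map (subtopology (circle_power (set_mset \<mu>)) (S (\<mu>, \<zeta>))) (W (\<mu>, \<zeta>)) (F (\<mu>, \<zeta>))"
      using t' by (rule conjunct1)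
    show "F (\<mu>, \<zeta>) ` S (\<mu>, \<zeta>) = topspace (W (\<mu>, \<zeta>))"
      using t' by (rule conjunct2[THEN conjunct1])
    show "F (\<mu>, \<zeta>) p = F (\<mu>, \<zeta>) p' \<longleftrightarrow> rotated (set_mset \<mu>) (k div root_ord \<zeta>) (count \<mu>) p p'"
      if "p \<in> S (\<mu>, \<zeta>)" "p' \<in> S (\<mu>, \<zeta>)" for p p'
      using conjunct2[OF conjunct2[OF t']] that by blast
  qed
  have "\<forall>\<mu>\<in>partitions n. \<exists>\<beta>. bij_betw \<beta> (component_set n k \<mu>) {..<Y_card n k \<mu>}"
    using ex_component_bij[OF _ n0 k] by blast
  then obtain \<beta> where \<beta>: "\<forall>\<mu>\<in>partitions n. bij_betw (\<beta> \<mu>) (component_set n k \<mu>) {..<Y_card n k \<mu>}"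
    by (rule bchoice[THEN exE])
  have labpart: "\<mu> \<in> partitions n" if "(\<mu>, \<zeta>) \<in> labels n k" for \<mu> \<zeta> using that by (simp add: labels_def)
  have constS: "const_terms \<mu> (coefs U) \<in> S (\<mu>, \<zeta>)" if "admissible \<mu> \<zeta> U" for \<mu> \<zeta> U
    using const_terms_in[OF that] by (simp add: S_def)
  \<comment> \<open>Here \<open>\<beta>\<close> renumbers pairs of a root \<open>\<zeta>\<close> and
    a component index, so that all labels with the same \<open>\<mu>\<close> land in one summand, on
    different sheets.\<close>
  define G where "G = (\<lambda>b w. (fst b, (fst w :: nat \<Rightarrow> complex, \<beta> (fst b) (snd b :: complex, snd w :: nat))))"
  define f where "f = (\<lambda>(b, c). G b (F b (const_terms (fst b) c)))"
  have fM: "f ((\<mu>, \<zeta>), c) = (\<mu>, (fst (F (\<mu>, \<zeta>) (const_terms \<mu> c)), \<beta> \<mu> (\<zeta>, snd (F (\<mu>, \<zeta>) (const_terms \<mu> c)))))" for \<mu> \<zeta> c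
    by (simp add: f_def G_def)
  have sndF: "snd (F (\<mu>, \<zeta>) p) < component_count n k \<mu> \<zeta>" if "(\<mu>, \<zeta>) \<in> labels n k" "p \<in> S (\<mu>, \<zeta>)" for \<mu> \<zeta> p
  proof -
    have "F (\<mu>, \<zeta>) p \<in> topspace (W (\<mu>, \<zeta>))" using Fb(2)[OF that(1)] that(2) by blast
    then show ?thesis by (auto simp: W_def)
  qed
  have fcont: "continuous_map L M f"
    unfolding L
  proof (rule continuous_map_discrete_prod)
    fix b assume b: "b \<in> labels n k"
    obtain \<mu> \<zeta> where bb: "b = (\<mu>, \<zeta>)" by (cases b)
    have lab: "(\<mu>, \<zeta>) \<in> labels n k" using b bb by simp
    let ?X = "subtopology ?P {c. (b, c) \<in> ?T}"
    have inS: "const_terms \<mu> c \<in> S (\<mu>, \<zeta>)" if c: "c \<in> topspace ?X" for c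
    proof -
      obtain U where "admissible \<mu> \<zeta> U" "c = coefs U" using c by (auto simp: bb)
      then show ?thesis using constS by simp
    qed
    have "continuous_map ?X (circle_power (set_mset \<mu>)) (const_terms \<mu>)"
      unfolding continuous_map_componentwise
    proof (intro conjI ballI)
      show "const_terms \<mu> ` topspace ?X \<subseteq> extensional (set_mset \<mu>)" by (auto simp: const_terms_def)
      fix m assume m: "m \<in> set_mset \<mu>"
      have "continuous_map ?P euclidean (\<lambda>c. c (m, 0))"
        using continuous_map_product_projection[of "(m, 0)" UNIV "\<lambda>_. euclidean :: complex topology"] by simp
      then have "continuous_map ?X euclidean (\<lambda>c. c (m, 0))" by (rule continuous_map_from_subtopology)
      then have "continuous_map ?X euclidean (\<lambda>c. const_terms \<mu> c m)"
        using m by (simp add: const_terms_def continuous_map_field_mult)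
      moreover have "const_terms \<mu> c m \<in> circle" if "c \<in> topspace ?X" for c
        using inS[OF that] m by (auto simp: S_def PiE_iff)
      ultimately show "continuous_map ?X (top_of_set circle) (\<lambda>c. const_terms \<mu> c m)"
        unfolding continuous_map_in_subtopology by blast
    qed
    then have "continuous_map ?X (subtopology (circle_power (set_mset \<mu>)) (S (\<mu>, \<zeta>))) (const_terms \<mu>)"
      unfolding continuous_map_in_subtopology using inS by blast
    from continuous_map_compose[OF this Fb(1)[OF lab]]
    have 1: "continuous_map ?X (W (\<mu>, \<zeta>)) (F (\<mu>, \<zeta>) \<circ> const_terms \<mu>)" .
    have "continuous_map (discrete_topology {..<component_count n k \<mu> \<zeta>}) (discrete_topology {..<Y_card n k \<mu>}) (\<lambda>i. \<beta> \<mu> (\<zeta>, i))"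
      using \<beta> labpart[OF lab] lab by (auto simp: bij_betw_def)
    from continuous_map_compose[OF continuous_map_snd this]
    have "continuous_map (W (\<mu>, \<zeta>)) (Y \<mu>) (\<lambda>w. (fst w, \<beta> \<mu> (\<zeta>, snd w)))"
      by (simp add: W_def Y_def continuous_map_pairwise comp_def continuous_map_fst[unfolded comp_def])
    from continuous_map_compose[OF this continuous_map_component_injection[where X = Y, OF labpart[OF lab]]]
    have "continuous_map (W (\<mu>, \<zeta>)) M (G (\<mu>, \<zeta>))" by (simp add: M_def G_def comp_def)
    from continuous_map_compose[OF 1 this]
    show "continuous_map ?X M (\<lambda>c. f (b, c))" by (simp add: f_def bb comp_def)
  qed
  have fsurj: "f ` topspace L = topspace M"
  proof (intro equalityI subsetI)
    fix w assume "w \<in> f ` topspace L"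
    then show "w \<in> topspace M" using continuous_map_image_subset_topspace[OF fcont] by blast
  next
    fix w assume w: "w \<in> topspace M"
    obtain \<mu> v s where ww: "w = (\<mu>, (v, s))" by (metis surj_pair)
    have \<mu>: "\<mu> \<in> partitions n" "v \<in> topspace (power_circle (distinct_parts \<mu> - 1))" "s \<in> {..<Y_card n k \<mu>}"
      using w by (auto simp: ww M_def Y_def)
    have "s \<in> \<beta> \<mu> ` (component_set n k \<mu>)"
      using bij_betw_imp_surj_on[OF bspec[OF \<beta> \<mu>(1)]] \<mu>(3) by blast
    then obtain \<zeta> i where zi: "(\<mu>, \<zeta>) \<in> labels n k" "i < component_count n k \<mu> \<zeta>" "s = \<beta> \<mu> (\<zeta>, i)" by auto
    have "(v, i) \<in> topspace (W (\<mu>, \<zeta>))" using \<mu>(2) zi(2) by (simp add: W_def)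
    then obtain p where p: "p \<in> S (\<mu>, \<zeta>)" "F (\<mu>, \<zeta>) p = (v, i)" using Fb(2)[OF zi(1)] by (metis imageE)
    have "\<exists>U. admissible \<mu> \<zeta> U \<and> const_terms \<mu> (coefs U) = p"
      using p(1) by (intro ex_coefs_of_const_terms) (auto simp: S_def)
    then obtain U where U: "admissible \<mu> \<zeta> U" "const_terms \<mu> (coefs U) = p" by blast
    have "f ((\<mu>, \<zeta>), coefs U) = w" by (simp add: fM U(2) p(2) ww zi(3))
    then show "w \<in> f ` topspace L" using Lin[OF zi(1) U(1)] by (metis imageI)
  qed
  have "Hausdorff_space (Y \<mu>)" for \<mu>
    unfolding Y_def power_circle_def
    by (simp add: Hausdorff_space_prod_topology Hausdorff_space_product_topology Hausdorff_space_subtopology)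
  then have "Hausdorff_space M" unfolding M_def by (rule Hausdorff_space_sum_topology)
  then have fq: "quotient_map L M f"
    by (rule continuous_imp_quotient_map[OF fcont Lcomp _ fsurj])
  have Hin: "damp_map s x \<in> topspace L" if "s \<in> {0..1}" "x \<in> topspace L" for s x
    using damp_map_in that unfolding L_def by blast
  have "?E homotopy_equivalent_space M"
  proof (rule homotopy_equivalent_quotients[OF qq fq])
    show "continuous_map (prod_topology (top_of_set {0..1}) L) L (\<lambda>(s, x). damp_map s x)"
      unfolding L_def by (rule continuous_damp_map)
    fix x assume x: "x \<in> topspace L"
    obtain \<mu> \<zeta> U where xx: "x = ((\<mu>, \<zeta>), coefs U)" and lab: "(\<mu>, \<zeta>) \<in> labels n k" and U: "admissible \<mu> \<zeta> U"
      using Lcases[OF x] by blast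
    show "damp_map 1 x = x" by (simp add: xx damp_map_def damp_1)
    show "f (damp_map 0 x) = f x" unfolding xx damp_map_def prod.case fM const_terms_damp ..
    fix y assume y: "y \<in> topspace L"
    obtain \<mu>' \<zeta>' U' where yy: "y = ((\<mu>', \<zeta>'), coefs U')" and lab': "(\<mu>', \<zeta>') \<in> labels n k" and U': "admissible \<mu>' \<zeta>' U'"
      using Lcases[OF y] by blast
    let ?p = "const_terms \<mu> (coefs U)" and ?p' = "const_terms \<mu>' (coefs U')"
    \<comment> \<open>Injectivity of \<open>\<beta> \<mu>\<close> recovers both
      \<open>\<zeta>\<close> and the component from the single number in the discrete
      factor.\<close>
    have lhs: "f x = f y \<longleftrightarrow> \<mu>' = \<mu> \<and> \<zeta>' = \<zeta> \<and> F (\<mu>, \<zeta>) ?p = F (\<mu>', \<zeta>') ?p'"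
    proof
      assume "f x = f y"
      then have eq: "\<mu>' = \<mu>" "fst (F (\<mu>, \<zeta>) ?p) = fst (F (\<mu>', \<zeta>') ?p')"
        "\<beta> \<mu> (\<zeta>, snd (F (\<mu>, \<zeta>) ?p)) = \<beta> \<mu> (\<zeta>', snd (F (\<mu>', \<zeta>') ?p'))"
        unfolding xx yy fM by auto
      have "(\<zeta>, snd (F (\<mu>, \<zeta>) ?p)) = (\<zeta>', snd (F (\<mu>', \<zeta>') ?p'))"
      proof (rule inj_onD[OF bij_betw_imp_inj_on[OF bspec[OF \<beta> labpart[OF lab]]] eq(3)])
        show "(\<zeta>, snd (F (\<mu>, \<zeta>) ?p)) \<in> (component_set n k \<mu>)"
          using lab sndF[OF lab constS[OF U]] by simp
        show "(\<zeta>', snd (F (\<mu>', \<zeta>') ?p')) \<in> (component_set n k \<mu>)"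
          using lab' sndF[OF lab' constS[OF U']] unfolding eq(1) by simp
      qed
      then have "\<zeta>' = \<zeta>" "snd (F (\<mu>, \<zeta>) ?p) = snd (F (\<mu>', \<zeta>') ?p')" by (metis prod.inject)+
      then show "\<mu>' = \<mu> \<and> \<zeta>' = \<zeta> \<and> F (\<mu>, \<zeta>) ?p = F (\<mu>', \<zeta>') ?p'"
        using eq(1) prod_eqI[OF eq(2)] by blast
    next
      assume "\<mu>' = \<mu> \<and> \<zeta>' = \<zeta> \<and> F (\<mu>, \<zeta>) ?p = F (\<mu>', \<zeta>') ?p'"
      then show "f x = f y" unfolding xx yy fM by simp
    qed
    have rhs: "q (damp_map 0 x) = q (damp_map 0 y) \<longleftrightarrow> rotation_related k (damp_map 0 x) (damp_map 0 y)"
      using qiff Hin x y by simp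
    show "f x = f y \<longleftrightarrow> q (damp_map 0 x) = q (damp_map 0 y)"
    proof (cases "\<mu>' = \<mu> \<and> \<zeta>' = \<zeta>")
      case True
      then have e: "\<mu>' = \<mu>" "\<zeta>' = \<zeta>" by simp_all
      show ?thesis
        unfolding lhs rhs unfolding xx yy e damped_rotation_iff[OF U U'[unfolded e]]
        using Fb(3)[OF lab constS[OF U] constS[OF U'[unfolded e]]] by simp
    next
      case False
      then show ?thesis unfolding lhs rhs unfolding xx yy damp_map_def rotation_related_def prod.case by blast
    qed
    fix s :: real assume s: "s \<in> {0..1}" and "q x = q y"
    then have "rotation_related k x y" using qiff x y by simp
    then show "q (damp_map s x) = q (damp_map s y)"
      using qiff Hin[OF s] x y rotation_related_damp by simp
  qed
  then show ?thesis unfolding M_def Y_def .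
qed

theorem corollary1p7:
  fixes n k :: nat
  assumes "CARD('n::finite) = n" and "k > 0" and "k dvd n"
  shows "extended_quotient Weyl Weyl_action (torus_mod k :: (complex^'n^'n) set topology)
           homotopy_equivalent_space
         sum_topology
           (\<lambda>\<mu>. prod_topology (power_circle (distinct_parts \<mu> - 1))
                              (discrete_topology {..<Y_card n k \<mu>}))
           (partitions n) \<and>
         extended_quotient Weyl Weyl_action (torus_mod k :: (complex^'n^'n) set topology)
           homotopy_equivalent_space
         extended_quotient Weyl Weyl_action
           (torus_mod (n div k) :: (complex^'n^'n) set topology)"
proof -
  have k': "n div k > 0" "n div k dvd n" "n div (n div k) = k"
    using assms by (auto elim!: dvdE intro!: gr0I)
  \<comment> \<open>As \<open>n div (n div k) = k\<close>, exchanging \<open>k\<close> and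
    \<open>n div k\<close> only permutes the set inside \<open>Gcd\<close>, so both extended
    quotients are equivalent to the same union of tori.\<close>
  have "common_gcd n (n div k) \<mu> = common_gcd n k \<mu>" for \<mu>
    unfolding common_gcd_def k'(3) by (simp add: insert_commute)
  then have card: "Y_card n (n div k) = Y_card n k" by (simp add: Y_card_def fun_eq_iff)
  note equiv = extended_quotient_components[OF assms]
  note equiv' = extended_quotient_components[OF assms(1) k'(1,2), unfolded card]
  show ?thesis
    by (rule conjI[OF equiv homotopy_eqv_trans[OF equiv homotopy_equivalent_space_sym[THEN iffD1, OF equiv']]])
qed

end
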